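(* Let $d$ be a positive integer and $u_0\in\mathcal V(d)$, and let $u$ be the solution of the cubic Szeg\H{o} equation $i\partial_t u=\Pi(|u|^2u)$ with $u(0)=u_0$. Then the map $t\in\mathbb R\mapsto u(t)\in\mathcal V(d)$ is quasiperiodic: there exist a positive integer $n$, real numbers $\omega_1,\dots,\omega_n$, and a smooth map $\Phi:\mathbb T^n\to\mathcal V(d)$ such that $u(t)=\Phi(\omega_1t,\dots,\omega_nt)$ for every $t\in\mathbb R$. In particular, for every $s>\frac12$, $\sup_{t\in\mathbb R}\|u(t)\|_{H^s}<+\infty$.
   Context: $\mathbb T=\mathbb R/2\pi\mathbb Z$; $L^2_+(\mathbb T)$ is the subspace of $L^2(\mathbb T)$ of functions with vanishing negative Fourier coefficients, $\Pi$ is the orthogonal projector $L^2\to L^2_+$, and $H^s_+=H^s(\mathbb T)\cap L^2_+$. For $u\in H^{1/2}_+$, $H_u(h)=\Pi(u\bar h)$ (antilinear on $L^2_+$), $S$ is multiplication by $e^{ix}$ and $K_u=H_uS$. $\mathcal V(d)$ is the set of $u\in H^{1/2}_+$ with $\operatorname{rk}H_u=[\frac{d+1}2]$ and $\operatorname{rk}K_u=[\frac d2]$ ($[\cdot]$ = integer part); it is a complex submanifold of $L^2_+$ of dimension $d$, consisting of the functions $u=A(e^{ix})/B(e^{ix})$ with $A,B$ coprime polynomials, $B$ without zeros in the closed unit disc, $B(0)=1$, and: if $d=2N$, $\deg A\le N-1$ and $\deg B=N$; if $d=2N+1$, $\deg A=N$ and $\deg B\le N$. The cubic Szeg\H{o}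 flow preserves $\mathcal V(d)$. *)

theory Defs
  imports "HOL-Analysis.Analysis"
begin

text \<open>Convention: an element of L^2_+(T) is represented by its sequence of
Fourier coefficients (indexed by nat, the nonnegative frequencies),
u(x) = sum_k u_k e^{ikx}.  All norms are computed on coefficients.\<close>

type_synonym seq = "nat \<Rightarrow> complex"

definition hs_sq :: "real \<Rightarrow> seq \<Rightarrow> ennreal" where
  "hs_sq s u = (\<Sum>k. ennreal ((1 + (real k)\<^sup>2) powr s * (cmod (u k))\<^sup>2))"

definition l2_sq :: "seq \<Rightarrow> ennreal" where
  "l2_sq u = (\<Sum>k. ennreal ((cmod (u k))\<^sup>2))"

definition in_L2plus :: "seq \<Rightarrow> bool" where
  "in_L2plus u \<longleftrightarrow> l2_sq u < \<infinity>"

definition in_Hs_plus :: "real \<Rightarrow> seq \<Rightarrow> bool" where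
  "in_Hs_plus s u \<longleftrightarrow> hs_sq s u < \<infinity>"

text \<open>Hankel operator H_u h = Pi(u conj h) and K_u = H_u S, on coefficients.\<close>
definition hankel :: "seq \<Rightarrow> seq \<Rightarrow> seq" where
  "hankel u h = (\<lambda>k. \<Sum>j. u (k + j) * cnj (h j))"

definition shift :: "seq \<Rightarrow> seq" where
  "shift h = (\<lambda>j. if j = 0 then 0 else h (j - 1))"

definition hankelK :: "seq \<Rightarrow> seq \<Rightarrow> seq" where
  "hankelK u h = hankel u (shift h)"

definition has_dim :: "seq set \<Rightarrow> nat \<Rightarrow> bool" where
  "has_dim R r \<longleftrightarrow> (\<exists>b :: nat \<Rightarrow> seq.
      (\<forall>c :: nat \<Rightarrow> complex. (\<forall>k. (\<Sum>i<r. c i * b i k) = 0) \<longrightarrow> (\<forall>i<r. c i = 0)) \<and>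
      R = {(\<lambda>k. \<Sum>i<r. c i * b i k) | c. True})"

definition op_rank_eq :: "(seq \<Rightarrow> seq) \<Rightarrow> nat \<Rightarrow> bool" where
  "op_rank_eq T r \<longleftrightarrow> has_dim (T ` {h. in_L2plus h}) r"

definition V :: "nat \<Rightarrow> seq set" where
  "V d = {u. in_Hs_plus (1/2) u \<and> op_rank_eq (hankel u) ((d + 1) div 2)
                               \<and> op_rank_eq (hankelK u) (d div 2)}"

text \<open>Fourier coefficients of Pi(|u|^2 u):
 sum over k1 - k2 + k3 = k of u_k1 conj(u_k2) u_k3, with k2 = m.\<close>
definition szego_nl :: "seq \<Rightarrow> seq" where
  "szego_nl v = (\<lambda>k. \<Sum>m. cnj (v m) * (\<Sum>a\<le>k + m. v a * v (k + m - a)))"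

definition szego_solution :: "(real \<Rightarrow> seq) \<Rightarrow> bool" where
  "szego_solution u \<longleftrightarrow>
     (\<forall>t. in_Hs_plus (1/2) (u t)) \<and>
     (\<forall>t::real. \<forall>\<epsilon>>0. \<exists>\<delta>>0. \<forall>\<tau>. \<bar>\<tau> - t\<bar> < \<delta> \<longrightarrow>
          hs_sq (1/2) (\<lambda>k. u \<tau> k - u t k) < ennreal \<epsilon>) \<and>
     (\<forall>t k. ((\<lambda>\<tau>::real. u \<tau> k) has_vector_derivative (- \<i> * szego_nl (u t) k)) (at t))"

definition torus_map :: "nat \<Rightarrow> ((nat \<Rightarrow> real) \<Rightarrow> 'b) \<Rightarrow> bool" where
  "torus_map n \<Phi> \<longleftrightarrow>
     (\<forall>\<theta> \<theta>'. (\<forall>j<n. \<theta> j = \<theta>' j) \<longrightarrow> \<Phi> \<theta> = \<Phi> \<theta>') \<and>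
     (\<forall>\<theta>. \<forall>j<n. \<Phi> (\<theta>(j := \<theta> j + 2 * pi)) = \<Phi> \<theta>)"

definition cont_L2 :: "nat \<Rightarrow> ((nat \<Rightarrow> real) \<Rightarrow> seq) \<Rightarrow> bool" where
  "cont_L2 n G \<longleftrightarrow> (\<forall>\<theta>. \<forall>\<epsilon>>0. \<exists>\<delta>>0. \<forall>\<theta>'. (\<forall>j<n. \<bar>\<theta>' j - \<theta> j\<bar> < \<delta>) \<longrightarrow>
       l2_sq (\<lambda>k. G \<theta>' k - G \<theta> k) < ennreal \<epsilon>)"

definition has_partial_L2 ::
    "nat \<Rightarrow> ((nat \<Rightarrow> real) \<Rightarrow> seq) \<Rightarrow> ((nat \<Rightarrow> real) \<Rightarrow> seq) \<Rightarrow> bool" where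
  "has_partial_L2 j G D \<longleftrightarrow> (\<forall>\<theta>. \<forall>\<epsilon>>0. \<exists>\<delta>>0. \<forall>h. h \<noteq> 0 \<and> \<bar>h\<bar> < \<delta> \<longrightarrow>
       l2_sq (\<lambda>k. (G (\<theta>(j := \<theta> j + h)) k - G \<theta> k) / complex_of_real h - D \<theta> k)
         < ennreal \<epsilon>)"

text \<open>C^infinity: all iterated partial derivatives exist and are continuous
(as maps into L^2_+).\<close>
definition smooth_L2 :: "nat \<Rightarrow> ((nat \<Rightarrow> real) \<Rightarrow> seq) \<Rightarrow> bool" where
  "smooth_L2 n F \<longleftrightarrow> (\<exists>\<F>. F \<in> \<F> \<and>
       (\<forall>G\<in>\<F>. cont_L2 n G \<and> (\<forall>j<n. \<exists>D\<in>\<F>. has_partial_L2 j G D)))"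

end

theory Submission
  imports Defs "HOL-Library.Function_Algebras" "HOL-Computational_Algebra.Fundamental_Theorem_Algebra"
    "HOL-Real_Asymp.Real_Asymp"
begin

text \<open>On the finite-dimensional range \<open>W\<close> of \<open>H\<^sub>u\<close> the backward shift \<open>T\<close>, the antilinear Hankel
  operator \<open>H\<close> and \<open>e = P\<^sub>W 1\<close> satisfy \<open>T\<^sup>*T = 1 - (\<cdot>|e)e\<close>, \<open>H\<close> and \<open>TH\<close> are symmetric, and
  \<open>u\<^sub>k = (T\<^sup>k He|e)\<close>; conversely such a triple without unimodular eigenvalue of \<open>T\<close> is a Hankel
  operator of the same ranks.  Multiplying \<open>H\<close> by phases on the eigenspaces of \<open>H\<^sup>2\<close>, and \<open>T\<close> by the same
  phases and by phases on the eigenspaces of \<open>(TH)\<^sup>2\<close>, again yields such a triple, which defines a map from a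
  torus to \<open>V d\<close>.  Phases rotating with the eigenvalues as frequencies solve the cubic Szego
  equation (this is the explicit formula of Gerard and Grellier).  Compactness of the torus gives a uniform
  geometric decay of \<open>T\<^sup>k\<close>, hence smoothness and all Sobolev bounds.  A weak-strong
  uniqueness argument in \<open>H\<^sup>1\<^sup>/\<^sup>2\<close> identifies this explicit solution with the given one.\<close>


section \<open>Finite-dimensional inner product spaces of sequences\<close>

text \<open>The identity that drives the flow is \<open>K2_eq\<close>: (TH)^2 differs from H^2 by
  the rank-one operator (.|u)u. Hence the derivative of the rotating \<open>T'\<close> is of rank
  one, and Leibniz' rule for its powers produces exactly the two pieces into which
  \<open>szego_nl_expand\<close> splits the cubic term. Eigenvalues may be multiple. A phase passes
  through the antilinear H as its conjugate only if it is constant on eigenspaces, so there is one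
  angle per eigenvalue (\<open>idx\<close>), not one per basis vector. Decay must be uniform over
  the torus, but a single step of \<open>T'\<close> loses only |(x|e)|^2, which may be zero.
  Compactness is therefore applied to a long block of steps, where observability forces a loss. The
  given solution is only known to be continuous in H^(1/2), a space that misses the bounded
  functions by a logarithm. The difference to the explicit solution is therefore estimated below a
  frequency cut-off, and the l1 bound on the explicit solution alone makes the estimate
  close.\<close>

definition scl :: "complex \<Rightarrow> seq \<Rightarrow> seq" (infixr "\<odot>" 75) where
  "c \<odot> x = (\<lambda>k. c * x k)"

lemma scl_apply [simp]: "(c \<odot> x) k = c * x k"
  by (simp add: scl_def)

lemma scl_simps [simp]: "0 \<odot> x = 0" "1 \<odot> x = x" "c \<odot> (0::seq) = 0" "a \<odot> b \<odot> x = (a * b) \<odot> x"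
  by (auto simp: fun_eq_iff)

lemma scl_add: "c \<odot> (x + y) = c \<odot> x + c \<odot> y"
  by (auto simp: fun_eq_iff algebra_simps)

lemma scl_add_left: "(a + b) \<odot> x = a \<odot> x + b \<odot> x"
  by (auto simp: fun_eq_iff algebra_simps)

lemma diff_eq_scl: "x - y = x + (-1) \<odot> (y::seq)"
  by (auto simp: fun_eq_iff)

lemma sum_seq_apply: "(\<Sum>i\<in>I. f i) k = (\<Sum>i\<in>I. f i k)" for f :: "'a \<Rightarrow> seq"
  by (induction I rule: infinite_finite_induct) auto

lemma linear_combination_eq: "(\<lambda>k. \<Sum>i\<in>I. c i * f i k) = (\<Sum>i\<in>I. c i \<odot> f i)"
  by (simp add: fun_eq_iff sum_seq_apply)

lemma scl_sum: "c \<odot> (\<Sum>i\<in>I. f i) = (\<Sum>i\<in>I. c \<odot> f i)"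
  by (simp add: fun_eq_iff sum_seq_apply sum_distrib_left)

definition subsp :: "seq set \<Rightarrow> bool" where
  "subsp F \<longleftrightarrow> 0 \<in> F \<and> (\<forall>x\<in>F. \<forall>y\<in>F. x + y \<in> F) \<and> (\<forall>c. \<forall>x\<in>F. c \<odot> x \<in> F)"

text \<open>\<open>semilin \<sigma>\<close> covers linear (\<open>\<sigma> = id\<close>) and antilinear (\<open>\<sigma> = cnj\<close>) self-maps of \<open>F\<close>.\<close>
definition semilin :: "(complex \<Rightarrow> complex) \<Rightarrow> seq set \<Rightarrow> (seq \<Rightarrow> seq) \<Rightarrow> bool" where
  "semilin \<sigma> F A \<longleftrightarrow> (\<forall>x\<in>F. A x \<in> F) \<and> (\<forall>x\<in>F. \<forall>y\<in>F. A (x + y) = A x + A y)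
     \<and> (\<forall>c. \<forall>x\<in>F. A (c \<odot> x) = \<sigma> c \<odot> A x)"

lemma subspD:
  assumes "subsp F"
  shows "0 \<in> F" "x \<in> F \<Longrightarrow> y \<in> F \<Longrightarrow> x + y \<in> F" "x \<in> F \<Longrightarrow> c \<odot> x \<in> F"
    "x \<in> F \<Longrightarrow> y \<in> F \<Longrightarrow> x - y \<in> F"
  using assms unfolding subsp_def diff_eq_scl[of x y] by auto

lemma subsp_sum: "subsp F \<Longrightarrow> (\<And>i. i \<in> I \<Longrightarrow> f i \<in> F) \<Longrightarrow> (\<Sum>i\<in>I. f i) \<in> F"
  by (induction I rule: infinite_finite_induct) (auto simp: subspD)

lemma semilinD:
  assumes "semilin \<sigma> F A"
  shows "x \<in> F \<Longrightarrow> A x \<in> F" "x \<in> F \<Longrightarrow> y \<in> F \<Longrightarrow> A (x + y) = A x + A y"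
    "x \<in> F \<Longrightarrow> A (c \<odot> x) = \<sigma> c \<odot> A x"
  using assms unfolding semilin_def by auto

lemma semilin_sum:
  assumes "semilin \<sigma> F A" "subsp F" "\<And>i. i \<in> I \<Longrightarrow> f i \<in> F" "\<sigma> 0 = 0"
  shows "A (\<Sum>i\<in>I. f i) = (\<Sum>i\<in>I. A (f i))"
proof -
  have 0: "A 0 = 0" using semilinD(3)[OF assms(1), of 0 0] subspD(1)[OF assms(2)] assms(4) by simp
  show ?thesis using assms(3)
    by (induction I rule: infinite_finite_induct)
       (simp_all add: 0 semilinD(2)[OF assms(1)] subsp_sum[OF assms(2)])
qed

lemma semilin_comp:
  assumes "semilin \<sigma> F A" "semilin \<tau> F B"
  shows "semilin (\<sigma> \<circ> \<tau>) F (\<lambda>x. A (B x))"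
  using assms unfolding semilin_def by auto

lemma semilin_subset:
  assumes "semilin \<sigma> F A" "G \<subseteq> F" "\<And>x. x \<in> G \<Longrightarrow> A x \<in> G"
  shows "semilin \<sigma> G A"
  using assms unfolding semilin_def by blast

lemma semilin_pow:
  assumes "semilin id F A"
  shows "semilin id F (A ^^ k)"
  using assms unfolding semilin_def by (induction k) auto

lemma subsp_image:
  assumes "subsp F" "semilin \<sigma> F A" "surj \<sigma>"
  shows "subsp (A ` F)"
proof -
  have 0: "A 0 = 0" using semilinD(2)[OF assms(2) subspD(1)[OF assms(1)] subspD(1)[OF assms(1)]] by simp
  show ?thesis
    unfolding subsp_def ball_simps(9)
  proof (intro conjI ballI allI)
    show "0 \<in> A ` F" using imageI[OF subspD(1)[OF assms(1)], of A] unfolding 0 .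
  next
    fix x y assume F: "x \<in> F" "y \<in> F"
    show "A x + A y \<in> A ` F"
      unfolding semilinD(2)[OF assms(2) F, symmetric] by (rule imageI) (rule subspD(2)[OF assms(1) F])
  next
    fix c x assume F: "x \<in> F"
    obtain c' where c': "c = \<sigma> c'" using assms(3) by (rule surjE)
    have "c \<odot> A x = A (c' \<odot> x)" unfolding c' by (rule semilinD(3)[OF assms(2) F, symmetric])
    then show "c \<odot> A x \<in> A ` F" using subspD(3)[OF assms(1) F] by (rule image_eqI)
  qed
qed

interpretation seqvs: vector_space scl
  by standard (auto simp: fun_eq_iff algebra_simps)

text \<open>The inner product is abstract and constrained on \<open>W\<close> alone, so that no
  convergence question enters the algebra. One fixed \<open>W\<close>, \<open>ip\<close> and
  \<open>b\<close> serve all deformed operators at once, and \<open>b_exp\<close> fixes the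
  dimension as \<open>N\<close>.\<close>

locale fin_ip =
  fixes W :: "seq set" and ip :: "seq \<Rightarrow> seq \<Rightarrow> complex" and N :: nat and b :: "nat \<Rightarrow> seq"
  assumes W_subsp: "subsp W"
    and ip_add: "\<And>x y z. x \<in> W \<Longrightarrow> y \<in> W \<Longrightarrow> z \<in> W \<Longrightarrow> ip (x + y) z = ip x z + ip y z"
    and ip_scl: "\<And>c x z. x \<in> W \<Longrightarrow> z \<in> W \<Longrightarrow> ip (c \<odot> x) z = c * ip x z"
    and ip_cnj: "\<And>x y. x \<in> W \<Longrightarrow> y \<in> W \<Longrightarrow> ip y x = cnj (ip x y)"
    and ip_pos: "\<And>x. x \<in> W \<Longrightarrow> x \<noteq> 0 \<Longrightarrow> 0 < Re (ip x x)"
    and b_in: "\<And>i. i < N \<Longrightarrow> b i \<in> W"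
    and b_on: "\<And>i j. i < N \<Longrightarrow> j < N \<Longrightarrow> ip (b i) (b j) = (if i = j then 1 else 0)"
    and b_exp: "\<And>x. x \<in> W \<Longrightarrow> x = (\<Sum>i<N. ip x (b i) \<odot> b i)"
begin

lemmas W0 [simp, intro] = subspD(1)[OF W_subsp]
lemmas W_add [simp, intro] = subspD(2)[OF W_subsp]
lemmas W_scl [simp, intro] = subspD(3)[OF W_subsp]
lemmas W_diff [simp, intro] = subspD(4)[OF W_subsp]
lemmas W_sum [simp, intro] = subsp_sum[OF W_subsp]

lemma ip_add2:
  assumes "x \<in> W" "y \<in> W" "z \<in> W"
  shows "ip z (x + y) = ip z x + ip z y"
  using ip_cnj[of "x + y" z] ip_cnj[of x z] ip_cnj[of y z] ip_add[of x y z] assms by auto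

lemma ip_scl2:
  assumes "x \<in> W" "z \<in> W"
  shows "ip z (c \<odot> x) = cnj c * ip z x"
  using ip_cnj[of "c \<odot> x" z] ip_cnj[of x z] ip_scl[of x z c] assms by auto

lemma ip_0 [simp]: "z \<in> W \<Longrightarrow> ip 0 z = 0" "z \<in> W \<Longrightarrow> ip z 0 = 0"
  using ip_scl[of 0 z 0] ip_scl2[of 0 z 0] by auto

lemma ip_sum: "(\<And>i. i \<in> I \<Longrightarrow> f i \<in> W) \<Longrightarrow> z \<in> W \<Longrightarrow> ip (\<Sum>i\<in>I. f i) z = (\<Sum>i\<in>I. ip (f i) z)"
  by (induction I rule: infinite_finite_induct) (auto simp: ip_add)

lemma ip_sum2: "(\<And>i. i \<in> I \<Longrightarrow> f i \<in> W) \<Longrightarrow> z \<in> W \<Longrightarrow> ip z (\<Sum>i\<in>I. f i) = (\<Sum>i\<in>I. ip z (f i))"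
  by (induction I rule: infinite_finite_induct) (auto simp: ip_add2)

lemma ip_diff: "x \<in> W \<Longrightarrow> y \<in> W \<Longrightarrow> z \<in> W \<Longrightarrow> ip (x - y) z = ip x z - ip y z"
  using ip_add[of x "(-1) \<odot> y" z] ip_scl[of y z "-1"] by (simp only: diff_eq_scl[of x y] W_scl) simp

lemma ip_diff2: "x \<in> W \<Longrightarrow> y \<in> W \<Longrightarrow> z \<in> W \<Longrightarrow> ip z (x - y) = ip z x - ip z y"
  using ip_add2[of x "(-1) \<odot> y" z] ip_scl2[of y z "-1"] by (simp only: diff_eq_scl[of x y] W_scl) simp

definition nsq :: "seq \<Rightarrow> real" where "nsq x = Re (ip x x)"

lemma ip_self: "x \<in> W \<Longrightarrow> ip x x = of_real (nsq x)"
  unfolding nsq_def using ip_cnj[of x x] by (auto simp: complex_eq_iff)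

lemma nsq_nonneg [simp]: "x \<in> W \<Longrightarrow> 0 \<le> nsq x"
  unfolding nsq_def using ip_pos[of x] by (cases "x = 0") auto

lemma nsq_eq_0_iff: "x \<in> W \<Longrightarrow> nsq x = 0 \<longleftrightarrow> x = 0"
  unfolding nsq_def using ip_pos[of x] by (cases "x = 0") auto

lemma nsq_scl:
  assumes "x \<in> W"
  shows "nsq (c \<odot> x) = (cmod c)\<^sup>2 * nsq x"
proof -
  have "ip (c \<odot> x) (c \<odot> x) = (c * cnj c) * of_real (nsq x)"
    using assms by (simp add: ip_scl[OF assms] ip_scl2 ip_self[OF assms])
  also have "\<dots> = of_real ((cmod c)\<^sup>2 * nsq x)" by (simp add: complex_norm_square[symmetric])
  finally show ?thesis unfolding nsq_def[of "c \<odot> x"] by simp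
qed

lemma ip_eqI: "x \<in> W \<Longrightarrow> y \<in> W \<Longrightarrow> (\<And>z. z \<in> W \<Longrightarrow> ip x z = ip y z) \<Longrightarrow> x = y"
  using nsq_eq_0_iff[of "x - y"] ip_diff[of x y "x - y"] by (simp add: nsq_def)

definition on_fam :: "nat \<Rightarrow> (nat \<Rightarrow> seq) \<Rightarrow> bool" where
  "on_fam m f \<longleftrightarrow> (\<forall>i<m. f i \<in> W) \<and> (\<forall>i<m. \<forall>j<m. ip (f i) (f j) = (if i = j then 1 else 0))"

definition proj :: "nat \<Rightarrow> (nat \<Rightarrow> seq) \<Rightarrow> seq \<Rightarrow> seq" where
  "proj m f x = (\<Sum>i<m. ip x (f i) \<odot> f i)"

lemma proj_in: "on_fam m f \<Longrightarrow> proj m f x \<in> W"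
  unfolding proj_def on_fam_def by auto

lemma ip_proj:
  assumes "on_fam m f" "j < m" "x \<in> W"
  shows "ip (proj m f x) (f j) = ip x (f j)"
proof -
  have "ip (proj m f x) (f j) = (\<Sum>i<m. ip x (f i) * ip (f i) (f j))"
    unfolding proj_def using assms unfolding on_fam_def by (subst ip_sum) (auto intro!: sum.cong simp: ip_scl)
  also have "\<dots> = (\<Sum>i<m. if i = j then ip x (f i) else 0)"
    using assms unfolding on_fam_def by (intro sum.cong) auto
  finally show ?thesis using assms by simp
qed

lemma ip_proj_residual: "on_fam m f \<Longrightarrow> j < m \<Longrightarrow> x \<in> W \<Longrightarrow> ip (x - proj m f x) (f j) = 0"
  using ip_proj[of m f j x] by (subst ip_diff) (auto simp: proj_in on_fam_def)

lemma nsq_proj_residual: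
  assumes "on_fam m f" "x \<in> W"
  shows "nsq (x - proj m f x) = nsq x - (\<Sum>i<m. (cmod (ip x (f i)))\<^sup>2)"
proof -
  have 1: "ip (x - proj m f x) (proj m f x) = 0"
    unfolding proj_def[of m f x]
    apply (subst ip_sum2)
    using assms ip_proj_residual[OF assms(1) _ assms(2)] proj_in[OF assms(1)]
    by (auto simp: on_fam_def proj_def[symmetric] ip_scl2)
  have "ip (x - proj m f x) (x - proj m f x) = ip (x - proj m f x) x"
    using 1 assms proj_in[OF assms(1)] by (simp add: ip_diff2)
  also have "\<dots> = ip x x - (\<Sum>i<m. ip x (f i) * ip (f i) x)"
  proof -
    have "f i \<in> W" if "i < m" for i using assms(1) that by (auto simp: on_fam_def)
    then have "ip (proj m f x) x = (\<Sum>i<m. ip x (f i) * ip (f i) x)"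
      unfolding proj_def using assms(2) by (subst ip_sum) (auto intro!: sum.cong simp: ip_scl)
    then show ?thesis using assms proj_in[OF assms(1)] by (simp add: ip_diff)
  qed
  also have "(\<Sum>i<m. ip x (f i) * ip (f i) x) = (\<Sum>i<m. of_real ((cmod (ip x (f i)))\<^sup>2))"
  proof (intro sum.cong refl)
    fix i assume "i \<in> {..<m}"
    then have "f i \<in> W" using assms(1) by (auto simp: on_fam_def)
    then show "ip x (f i) * ip (f i) x = of_real ((cmod (ip x (f i)))\<^sup>2)"
      by (simp only: ip_cnj[OF assms(2), of "f i"] complex_norm_square[symmetric] of_real_power)
  qed
  finally have "Re (ip (x - proj m f x) (x - proj m f x))
      = Re (ip x x - (\<Sum>i<m. of_real ((cmod (ip x (f i)))\<^sup>2)))" by (rule arg_cong)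
  then show ?thesis by (simp only: nsq_def minus_complex.sel Re_sum Re_complex_of_real)
qed

lemma nsq_parseval:
  assumes "on_fam N f" "x \<in> W" "x = proj N f x"
  shows "nsq x = (\<Sum>i<N. (cmod (ip x (f i)))\<^sup>2)"
  using nsq_proj_residual[OF assms(1,2)] assms(2,3) by (simp add: nsq_def)

lemma on_fam_b: "on_fam N b"
  unfolding on_fam_def using b_in b_on by auto

lemma proj_b: "x \<in> W \<Longrightarrow> proj N b x = x"
  using b_exp unfolding proj_def by simp

text \<open>The sum over \<open>b\<close> computes the trace of the projection onto the complement of the family.\<close>
lemma trace_residual:
  assumes "on_fam m f"
  shows "(\<Sum>a<N. nsq (b a - proj m f (b a))) = real N - real m"
proof -
  have "(\<Sum>a<N. nsq (b a - proj m f (b a))) = (\<Sum>a<N. 1 - (\<Sum>i<m. (cmod (ip (b a) (f i)))\<^sup>2))"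
    by (intro sum.cong refl, subst nsq_proj_residual[OF assms]) (auto simp: b_in b_on nsq_def)
  also have "\<dots> = real N - (\<Sum>i<m. \<Sum>a<N. (cmod (ip (b a) (f i)))\<^sup>2)"
    by (subst sum.swap) (simp add: sum_subtractf)
  also have "(\<Sum>i<m. \<Sum>a<N. (cmod (ip (b a) (f i)))\<^sup>2) = (\<Sum>i<m. 1)"
  proof (intro sum.cong refl)
    fix i assume i: "i \<in> {..<m}"
    have "(\<Sum>a<N. (cmod (ip (b a) (f i)))\<^sup>2) = (\<Sum>a<N. (cmod (ip (f i) (b a)))\<^sup>2)"
    proof (intro sum.cong refl)
      fix a assume "a \<in> {..<N}"
      then show "(cmod (ip (b a) (f i)))\<^sup>2 = (cmod (ip (f i) (b a)))\<^sup>2"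
        using ip_cnj[of "f i" "b a"] b_in[of a] assms i by (auto simp: on_fam_def)
    qed
    also have "\<dots> = nsq (f i)"
      using nsq_parseval[OF on_fam_b, of "f i"] assms i proj_b[of "f i"] by (auto simp: on_fam_def)
    also have "\<dots> = 1" using assms i by (auto simp: on_fam_def nsq_def)
    finally show "(\<Sum>a<N. (cmod (ip (b a) (f i)))\<^sup>2) = 1" .
  qed
  finally show ?thesis by (simp only: sum_constant card_lessThan of_nat_mult mult_1_right)
qed

text \<open>Otherwise every residual of a basis vector vanishes, although the trace of the
  complementary projection is N - m > 0.\<close>

lemma on_fam_extend:
  assumes "on_fam m f" "m < N"
  shows "\<exists>x\<in>W. x \<noteq> 0 \<and> (\<forall>i<m. ip x (f i) = 0)"
proof (rule ccontr)
  assume "\<not> ?thesis"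
  then have "b a - proj m f (b a) = 0" if "a < N" for a
    using ip_proj_residual[OF assms(1) _ b_in[OF that]] proj_in[OF assms(1)] b_in[OF that] by blast
  then show False using trace_residual[OF assms(1)] assms(2) by (simp add: nsq_def)
qed

text \<open>For m = N the trace is 0 and its summands are nonnegative, so each \<open>b a\<close>
  equals its projection; linearity carries this over to x.\<close>

lemma onb_exp:
  assumes "on_fam N f" "x \<in> W"
  shows "proj N f x = x"
proof -
  have 0: "b a - proj N f (b a) = 0" if "a < N" for a
  proof -
    have "(\<Sum>a<N. nsq (b a - proj N f (b a))) = 0" using trace_residual[OF assms(1)] by simp
    moreover have "0 \<le> nsq (b a - proj N f (b a))" if "a \<in> {..<N}" for a
      using that by (intro nsq_nonneg W_diff b_in proj_in assms) simp
    ultimately have "nsq (b a - proj N f (b a)) = 0"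
      using that sum_nonneg_eq_0_iff[of "{..<N}" "\<lambda>a. nsq (b a - proj N f (b a))"] by blast
    then show ?thesis using nsq_eq_0_iff[OF W_diff[OF b_in[OF that] proj_in[OF assms(1), of "b a"]]] by simp
  qed
  have fin: "f i \<in> W" if "i < N" for i using assms that by (auto simp: on_fam_def)
  have "x = (\<Sum>a<N. ip x (b a) \<odot> b a)" using b_exp assms by simp
  also have "\<dots> = (\<Sum>a<N. ip x (b a) \<odot> proj N f (b a))"
    using 0 by (intro sum.cong) auto
  also have "\<dots> = (\<Sum>a<N. \<Sum>i<N. (ip x (b a) * ip (b a) (f i)) \<odot> f i)"
    by (simp add: proj_def scl_sum)
  also have "\<dots> = (\<Sum>i<N. (\<Sum>a<N. ip x (b a) * ip (b a) (f i)) \<odot> f i)"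
    by (subst sum.swap) (simp add: fun_eq_iff sum_seq_apply sum_distrib_right)
  also have "\<dots> = (\<Sum>i<N. ip (\<Sum>a<N. ip x (b a) \<odot> b a) (f i) \<odot> f i)"
  proof (intro sum.cong refl)
    fix i assume "i \<in> {..<N}"
    then have "ip (\<Sum>a<N. ip x (b a) \<odot> b a) (f i) = (\<Sum>a<N. ip x (b a) * ip (b a) (f i))"
      by (subst ip_sum) (auto intro!: W_scl b_in fin sum.cong ip_scl)
    then show "(\<Sum>a<N. ip x (b a) * ip (b a) (f i)) \<odot> f i
        = ip (\<Sum>a<N. ip x (b a) \<odot> b a) (f i) \<odot> f i" by simp
  qed
  also have "\<dots> = proj N f x" using b_exp[OF assms(2)] by (simp add: proj_def)
  finally show ?thesis by simp
qed

section \<open>Linear dependence, eigenvectors and the spectral theorem on \<open>W\<close>\<close>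

lemma linear_dependence:
  assumes "\<And>i. i \<le> N \<Longrightarrow> v i \<in> W"
  shows "\<exists>c. (\<exists>i\<le>N. c i \<noteq> 0) \<and> (\<Sum>i\<le>N. c i \<odot> v i) = 0"
proof (cases "inj_on v {..N}")
  case True
  have sp: "v ` {..N} \<subseteq> seqvs.span (b ` {..<N})"
  proof clarify
    fix i assume "i \<le> N"
    then have "v i = (\<Sum>j<N. ip (v i) (b j) \<odot> b j)" using assms b_exp by simp
    also have "\<dots> \<in> seqvs.span (b ` {..<N})"
      by (intro seqvs.span_sum seqvs.span_scale seqvs.span_base) auto
    finally show "v i \<in> seqvs.span (b ` {..<N})" .
  qed
  have "\<not> seqvs.independent (v ` {..N})"
  proof
    assume "seqvs.independent (v ` {..N})"
    then have "card (v ` {..N}) \<le> card (b ` {..<N})"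
      using seqvs.independent_span_bound[OF _ _ sp] by auto
    also have "\<dots> \<le> N" using card_image_le[of "{..<N}" b] by simp
    finally show False using True by (simp add: card_image)
  qed
  then obtain U where U: "\<exists>w\<in>v ` {..N}. U w \<noteq> 0" "(\<Sum>w\<in>v ` {..N}. U w \<odot> w) = 0"
    using seqvs.dependent_finite[of "v ` {..N}"] by auto
  then have "(\<Sum>i\<le>N. U (v i) \<odot> v i) = 0" by (simp add: sum.reindex[OF True] o_def)
  then show ?thesis using U(1) by (intro exI[of _ "\<lambda>i. U (v i)"]) auto
next
  \<comment> \<open>Independence is a property of sets, so a repeated vector is treated apart, by
    the relation v i - v j = 0.\<close>
  case False
  then obtain i j where ij: "i \<le> N" "j \<le> N" "i \<noteq> j" "v i = v j" by (auto simp: inj_on_def)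
  let ?c = "\<lambda>k. if k = i then 1 else if k = j then -1 else (0::complex)"
  have "(\<Sum>k\<le>N. ?c k \<odot> v k) = (\<Sum>k\<in>{i, j}. ?c k \<odot> v k)"
    using ij by (intro sum.mono_neutral_right) auto
  also have "\<dots> = 0" using ij by (simp add: fun_eq_iff)
  finally show ?thesis using ij by (intro exI[of _ ?c]) auto
qed

text \<open>The iterates of x are dependent, so some nonzero polynomial p in A annihilates x.
  Splitting off a root r of p, either (A - r) z = 0 and z is an eigenvector, or the quotient
  annihilates (A - r) z and has lower degree. An arbitrary invariant subspace F is allowed because
  it is applied to orthogonal complements, unobservable spaces and eigenspaces.\<close>

lemma exists_eigenvector:
  assumes "subsp F" "F \<subseteq> W" "semilin id F A" "x \<in> F" "x \<noteq> 0"
  shows "\<exists>c y. y \<in> F \<and> y \<noteq> 0 \<and> A y = c \<odot> y"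
proof -
  have pw: "(A ^^ i) y \<in> F" if "y \<in> F" for i y
    using semilinD(1)[OF semilin_pow[OF assms(3)]] that by auto
  have main: "\<exists>c y. y \<in> F \<and> y \<noteq> 0 \<and> A y = c \<odot> y"
    if "degree p = n" "p \<noteq> 0" "z \<in> F" "z \<noteq> 0" "(\<Sum>i\<le>degree p. coeff p i \<odot> (A ^^ i) z) = 0" for p n z
    using that
  proof (induction n arbitrary: p z)
    case 0
    have "(\<Sum>i\<le>0. coeff p i \<odot> (A ^^ i) z) = coeff p 0 \<odot> z" by simp
    then have c0: "coeff p 0 \<odot> z = 0" using 0(5) unfolding 0(1) by (rule trans[OF sym])
    moreover have "coeff p 0 \<noteq> 0" using 0(1,2) leading_coeff_0_iff[of p] by simp
    ultimately have False using c0 0(4) seqvs.scale_eq_0_iff by blast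
    then show ?case ..
  next
    case (Suc n)
    have "\<not> constant (poly p)" using Suc.prems by (simp add: constant_degree)
    then obtain r where "poly p r = 0" using fundamental_theorem_of_algebra by blast
    then obtain q where q: "p = [:-r, 1:] * q" by (metis dvdE poly_eq_0_iff_dvd)
    have q0: "q \<noteq> 0" using q Suc.prems by auto
    have dq: "degree q = n" using q Suc.prems q0 degree_mult_eq[of "[:-r, 1:]" q] by auto
    define y where "y = A z - r \<odot> z"
    have yF: "y \<in> F" unfolding y_def
      by (intro subspD(4)[OF assms(1)] subspD(3)[OF assms(1)] semilinD(1)[OF assms(3)] Suc.prems(3))
    have Ay: "(A ^^ i) y = (A ^^ Suc i) z + (-r) \<odot> (A ^^ i) z" for i
    proof -
      have "(A ^^ i) y = (A ^^ i) (A z) + (A ^^ i) ((-r) \<odot> z)"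
        unfolding y_def using semilinD(2)[OF semilin_pow[OF assms(3), of i], of "A z" "(-r) \<odot> z"]
          semilinD(1)[OF assms(3) Suc.prems(3)] subspD(3)[OF assms(1) Suc.prems(3)]
        by (simp del: seqvs.scale_minus_left add: diff_eq_scl[of "A z"])
      then show ?thesis using semilinD(3)[OF semilin_pow[OF assms(3), of i] Suc.prems(3), of "-r"]
        by (simp add: funpow_swap1)
    qed
    have cp: "coeff p i = (case i of 0 \<Rightarrow> 0 | Suc j \<Rightarrow> coeff q j) - r * coeff q i" for i
      unfolding q by (cases i) (simp_all add: coeff_pCons)
    show ?case
    proof (cases "y = 0")
      case True
      then have "A z = r \<odot> z" unfolding y_def by simp
      then show ?thesis using Suc.prems by blast
    next
      case False
      have "0 = (\<Sum>i\<le>Suc n. coeff p i \<odot> (A ^^ i) z)" using Suc.prems(5) unfolding Suc.prems(1) by (rule sym)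
      also have "\<dots> = (\<Sum>i\<le>Suc n. (case i of 0 \<Rightarrow> 0 | Suc j \<Rightarrow> coeff q j) \<odot> (A ^^ i) z)
          + (\<Sum>i\<le>Suc n. (- r * coeff q i) \<odot> (A ^^ i) z)"
        by (simp only: cp diff_conv_add_uminus mult_minus_left scl_add_left sum.distrib)
      also have "(\<Sum>i\<le>Suc n. (case i of 0 \<Rightarrow> 0 | Suc j \<Rightarrow> coeff q j) \<odot> (A ^^ i) z)
          = (\<Sum>i\<le>n. coeff q i \<odot> (A ^^ Suc i) z)"
        by (subst sum.atMost_Suc_shift) simp
      also have "(\<Sum>i\<le>Suc n. (- r * coeff q i) \<odot> (A ^^ i) z) = (\<Sum>i\<le>n. (- r * coeff q i) \<odot> (A ^^ i) z)"
        using dq coeff_eq_0[of q "Suc n"] by simp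
      also have "(\<Sum>i\<le>n. coeff q i \<odot> (A ^^ Suc i) z) + (\<Sum>i\<le>n. (- r * coeff q i) \<odot> (A ^^ i) z)
          = (\<Sum>i\<le>n. coeff q i \<odot> (A ^^ i) y)"
        by (simp only: Ay scl_add sum.distrib scl_simps(4)) (simp add: mult.commute)
      finally have "(\<Sum>i\<le>degree q. coeff q i \<odot> (A ^^ i) y) = 0" unfolding dq by (rule sym)
      then show ?thesis by (rule Suc.IH[OF dq q0 yF False])
    qed
  qed
  obtain c where c: "\<exists>i\<le>N. c i \<noteq> 0" "(\<Sum>i\<le>N. c i \<odot> (A ^^ i) x) = 0"
    using linear_dependence[of "\<lambda>i. (A ^^ i) x"] pw[OF assms(4)] assms(2) by blast
  define p where "p = (\<Sum>i\<le>N. monom (c i) i)"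
  have cp: "coeff p i = (if i \<le> N then c i else 0)" for i
    unfolding p_def by (auto simp: coeff_sum if_distrib cong: if_cong)
  have "p \<noteq> 0" using c(1) cp by (metis coeff_0)
  have "degree p \<le> N" by (rule degree_le) (simp add: cp)
  have "(\<Sum>i\<le>degree p. coeff p i \<odot> (A ^^ i) x) = (\<Sum>i\<le>N. coeff p i \<odot> (A ^^ i) x)"
    using \<open>degree p \<le> N\<close> by (intro sum.mono_neutral_left) (auto simp: coeff_eq_0)
  also have "\<dots> = 0" using c(2) by (simp add: cp)
  finally show ?thesis by (rule main[OF refl \<open>p \<noteq> 0\<close> assms(4,5)])
qed

lemma selfadjoint_eigenbasis:
  assumes "semilin id W A" and sa: "\<And>x y. x \<in> W \<Longrightarrow> y \<in> W \<Longrightarrow> ip (A x) y = ip x (A y)"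
  shows "\<exists>f l. on_fam N f \<and> (\<forall>i<N. A (f i) = of_real (l i) \<odot> f i)"
proof -
  have "\<exists>f l. on_fam m f \<and> (\<forall>i<m. A (f i) = of_real (l i) \<odot> f i)" if "m \<le> N" for m
    using that
  proof (induction m)
    case 0
    then show ?case by (simp add: on_fam_def)
  next
    case (Suc m)
    then obtain f l where f: "on_fam m f" "\<And>i. i < m \<Longrightarrow> A (f i) = complex_of_real (l i) \<odot> f i"
      using Suc_leD by blast
    have fW: "f i \<in> W" if "i < m" for i using f that by (auto simp: on_fam_def)
    define F where "F = {x\<in>W. \<forall>i<m. ip x (f i) = 0}"
    have F: "subsp F" unfolding F_def subsp_def using fW by (auto simp: ip_add ip_scl)
    have FW: "F \<subseteq> W" by (auto simp: F_def)
    \<comment> \<open>Self-adjointness moves A onto the eigenvectors already found, so their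
      orthogonal complement is invariant and contains the next one.\<close>
    have "A x \<in> F" if "x \<in> F" for x
      using that fW f(2) semilinD(1)[OF assms(1)] unfolding F_def by (auto simp: sa ip_scl2)
    then have "semilin id F A" using semilin_subset[OF assms(1) FW] by blast
    moreover obtain x where "x \<in> F" "x \<noteq> 0" using on_fam_extend[OF f(1)] Suc.prems by (auto simp: F_def)
    ultimately obtain c y where y: "y \<in> F" "y \<noteq> 0" "A y = c \<odot> y"
      using exists_eigenvector[OF F FW] by blast
    then have yW: "y \<in> W" and y_orth: "\<And>i. i < m \<Longrightarrow> ip y (f i) = 0" by (auto simp: F_def)
    have ny: "nsq y > 0" using ip_pos[OF yW y(2)] by (simp add: nsq_def)
    have "c * ip y y = cnj c * ip y y" using sa[OF yW yW] y(3) yW by (simp add: ip_scl ip_scl2)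
    then have "c = cnj c" using ny by (auto simp: ip_self[OF yW])
    then have c: "c = of_real (Re c)" by (auto simp: complex_eq_iff)
    define z where "z = of_real (1 / sqrt (nsq y)) \<odot> y"
    have zW: "z \<in> W" unfolding z_def using yW by simp
    have zz: "ip z z = 1"
      using ny nsq_scl[OF yW, of "of_real (1 / sqrt (nsq y))"] unfolding ip_self[OF zW]
      by (simp add: z_def power_divide norm_divide)
    have z_orth: "ip z (f i) = 0" "ip (f i) z = 0" if "i < m" for i
      using y_orth[OF that] ip_cnj[OF yW fW[OF that]] fW[OF that] yW unfolding z_def by (auto simp: ip_scl ip_scl2)
    have "A z = c \<odot> z" unfolding z_def using semilinD(3)[OF assms(1) yW] y(3) by (simp add: mult.commute)
    then have Az: "A z = of_real (Re c) \<odot> z" using c by simp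
    have "on_fam (Suc m) (f(m := z))"
      using f(1) zW zz z_orth unfolding on_fam_def by (auto simp: less_Suc_eq)
    moreover have "\<forall>i<Suc m. A ((f(m := z)) i) = complex_of_real ((l(m := Re c)) i) \<odot> (f(m := z)) i"
      using f(2) Az by (simp add: less_Suc_eq)
    ultimately show ?case by blast
  qed
  then show ?thesis by blast
qed

end

section \<open>Series\<close>

lemma abs_summable_pairs:
  fixes f :: "nat \<Rightarrow> nat \<Rightarrow> complex"
  assumes "\<And>i. summable (\<lambda>j. norm (f i j))" "summable (\<lambda>i. \<Sum>j. norm (f i j))"
  shows "(\<lambda>z. norm (case_prod f z)) summable_on UNIV \<times> UNIV"
proof -
  have hs: "((\<lambda>j. norm (f i j)) has_sum (\<Sum>j. norm (f i j))) UNIV" for i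
    using assms(1)[of i] by (intro sums_nonneg_imp_has_sum summable_sums) auto
  have inf: "infsum (\<lambda>j. norm (f i j)) UNIV = (\<Sum>j. norm (f i j))" for i
    using hs by (rule infsumI)
  have nn: "0 \<le> (\<Sum>j. norm (f i j))" for i by (intro suminf_nonneg assms(1)) simp
  have "(\<lambda>i. \<Sum>j. norm (f i j)) summable_on UNIV"
    using assms(2) nn by (intro norm_summable_imp_summable_on) auto
  then show ?thesis
    unfolding Infinite_Sum.abs_summable_on_Sigma_iff using hs nn by (auto simp: inf summable_on_def)
qed

lemma infsum_nat_eq_suminf:
  fixes f :: "nat \<Rightarrow> complex"
  assumes "f summable_on UNIV"
  shows "infsum f UNIV = suminf f" "summable f"
  using has_sum_imp_sums[OF has_sum_infsum[OF assms]] by (auto simp: sums_iff)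

lemma suminf_swap:
  fixes f :: "nat \<Rightarrow> nat \<Rightarrow> complex"
  assumes "\<And>i. summable (\<lambda>j. norm (f i j))" "summable (\<lambda>i. \<Sum>j. norm (f i j))"
  shows "(\<Sum>i. \<Sum>j. f i j) = (\<Sum>j. \<Sum>i. f i j)"
    and "summable (\<lambda>i. \<Sum>j. f i j)"
proof -
  have s: "(\<lambda>(i, j). f i j) summable_on UNIV \<times> UNIV"
    by (rule abs_summable_summable[OF abs_summable_pairs[OF assms]])
  have s': "(\<lambda>(j, i). f i j) summable_on UNIV \<times> UNIV"
    using s by (subst summable_on_swap) (simp add: case_prod_unfold)
  have 1: "f i summable_on UNIV" for i
    using summable_on_SigmaD1[OF s] by simp
  have 2: "(\<lambda>i. f i j) summable_on UNIV" for j
    using summable_on_SigmaD1[OF s'] by simp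
  have 3: "(\<lambda>i. infsum (f i) UNIV) summable_on UNIV"
    using summable_on_Sigma_banach[OF s] by simp
  have 4: "(\<lambda>j. infsum (\<lambda>i. f i j) UNIV) summable_on UNIV"
    using summable_on_Sigma_banach[OF s'] by simp
  have "infsum (\<lambda>x. infsum (\<lambda>y. f x y) UNIV) UNIV = infsum (\<lambda>y. infsum (\<lambda>x. f x y) UNIV) UNIV"
    by (rule infsum_swap_banach[OF s])
  then show "(\<Sum>i. \<Sum>j. f i j) = (\<Sum>j. \<Sum>i. f i j)"
    using infsum_nat_eq_suminf[OF 3] infsum_nat_eq_suminf[OF 4] infsum_nat_eq_suminf(1)[OF 1]
      infsum_nat_eq_suminf(1)[OF 2] by simp
  show "summable (\<lambda>i. \<Sum>j. f i j)"
    using infsum_nat_eq_suminf[OF 3] infsum_nat_eq_suminf(1)[OF 1] by simp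
qed

text \<open>Reindexing of the quadrant by antidiagonals, (m, i) to (i, m - i); absolute summability
  makes the order irrelevant.\<close>

lemma suminf_triangle:
  fixes g :: "nat \<Rightarrow> nat \<Rightarrow> complex"
  assumes "\<And>i. summable (\<lambda>j. norm (g i j))" "summable (\<lambda>i. \<Sum>j. norm (g i j))"
  shows "(\<Sum>m. \<Sum>i\<le>m. g i (m - i)) = (\<Sum>i. \<Sum>j. g i j)"
    and "summable (\<lambda>m. \<Sum>i\<le>m. g i (m - i))"
proof -
  have s: "(\<lambda>(i, j). g i j) summable_on UNIV \<times> UNIV"
    by (rule abs_summable_summable[OF abs_summable_pairs[OF assms]])
  have bij: "bij_betw (\<lambda>(m, i). (i, m - i)) (SIGMA m:UNIV. {..m}) (UNIV \<times> UNIV :: (nat \<times> nat) set)"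
    by (rule bij_betwI[where g = "\<lambda>(i, j). (i + j, i)"]) auto
  have s2: "(\<lambda>(m, i). g i (m - i)) summable_on (SIGMA m:UNIV. {..m})"
    using s summable_on_reindex_bij_betw[OF bij, of "\<lambda>(i, j). g i j"] by (simp add: case_prod_unfold)
  have e: "infsum (\<lambda>(m, i). g i (m - i)) (SIGMA m:UNIV. {..m}) = infsum (\<lambda>(i, j). g i j) (UNIV \<times> UNIV)"
    using infsum_reindex_bij_betw[OF bij, of "\<lambda>(i, j). g i j"] by (simp add: case_prod_unfold)
  have 0: "(\<lambda>m. \<Sum>i\<le>m. g i (m - i)) summable_on UNIV"
    using summable_on_Sigma_banach[OF s2] by simp
  have 1: "g i summable_on UNIV" for i using summable_on_SigmaD1[OF s] by simp
  have 3: "(\<lambda>i. infsum (g i) UNIV) summable_on UNIV" using summable_on_Sigma_banach[OF s] by simp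
  have "infsum (\<lambda>m. \<Sum>i\<le>m. g i (m - i)) UNIV = infsum (\<lambda>i. infsum (g i) UNIV) UNIV"
    using infsum_Sigma'_banach[OF s2] infsum_Sigma'_banach[OF s] e by simp
  then show "(\<Sum>m. \<Sum>i\<le>m. g i (m - i)) = (\<Sum>i. \<Sum>j. g i j)"
    using infsum_nat_eq_suminf[OF 3] infsum_nat_eq_suminf[OF 0] infsum_nat_eq_suminf(1)[OF 1] by simp
  show "summable (\<lambda>m. \<Sum>i\<le>m. g i (m - i))" by (rule infsum_nat_eq_suminf(2)[OF 0])
qed

section \<open>Coefficient norms and geometric decay\<close>

lemma l2_sq_finite_iff: "in_L2plus u \<longleftrightarrow> summable (\<lambda>k. (cmod (u k))\<^sup>2)"
  unfolding in_L2plus_def l2_sq_def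
  by (auto simp: suminf_ennreal2 ennreal_suminf_neq_top intro: summable_suminf_not_top dest!: less_imp_neq)

lemma in_Hs_plus_iff: "in_Hs_plus s u \<longleftrightarrow> summable (\<lambda>k. (1 + (real k)\<^sup>2) powr s * (cmod (u k))\<^sup>2)"
  unfolding in_Hs_plus_def hs_sq_def
  by (auto simp: suminf_ennreal2 ennreal_suminf_neq_top intro: summable_suminf_not_top dest!: less_imp_neq)

lemma l2_eq_hs0: "l2_sq = hs_sq 0"
  unfolding l2_sq_def hs_sq_def by (auto simp: fun_eq_iff intro!: suminf_cong) (smt (verit) powr_zero_eq_one zero_le_power2)

text \<open>The quantitative property carried through the proof: for 0 <= q < 1 it yields membership
  in every H^s, absolute convergence and l1 bounds, with constants depending on K, q and s
  only.\<close>

definition geo :: "real \<Rightarrow> real \<Rightarrow> seq \<Rightarrow> bool" where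
  "geo K q u \<longleftrightarrow> (\<forall>k. cmod (u k) \<le> K * q ^ k)"

lemma geo_weight_summable:
  assumes "0 \<le> q" "q < 1"
  shows "summable (\<lambda>k. (1 + (real k)\<^sup>2) powr s * q ^ k)"
proof (cases "q = 0")
  case True
  then show ?thesis by (intro summable_finite[of "{0}"]) auto
next
  case False
  \<comment> \<open>One factor p^k absorbs the polynomial weight, the other remains as a convergent
    geometric series.\<close>
  define p where "p = sqrt q"
  have p: "0 < p" "p < 1" "q = p * p" using assms False by (auto simp: p_def)
  have "(\<lambda>k::nat. (1 + (real k)\<^sup>2) powr s * p ^ k) \<longlonglongrightarrow> 0"
    using p by real_asymp
  then have "Bseq (\<lambda>k::nat. (1 + (real k)\<^sup>2) powr s * p ^ k)" by (meson convergentI convergent_imp_Bseq)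
  then obtain M where M: "\<And>k::nat. norm ((1 + (real k)\<^sup>2) powr s * p ^ k) \<le> M" by (meson BseqE)
  have "summable (\<lambda>k. M * p ^ k)" using p by (intro summable_mult summable_geometric) auto
  then show ?thesis
  proof (rule summable_comparison_test')
    fix k :: nat
    have "(1 + (real k)\<^sup>2) powr s * q ^ k = ((1 + (real k)\<^sup>2) powr s * p ^ k) * p ^ k"
      unfolding p(3) by (simp add: power_mult_distrib)
    also have "norm \<dots> \<le> M * p ^ k" using M[of k] p by (simp add: abs_mult mult_right_mono)
    finally show "norm ((1 + (real k)\<^sup>2) powr s * q ^ k) \<le> M * p ^ k" .
  qed
qed

text \<open>\<open>M\<close> depends on q and s only. Fixed K gives uniform Sobolev bounds, K
  tending to 0 gives the smallness needed for continuity and differentiability in L2.\<close>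

lemma geo_hs_bound:
  assumes "0 \<le> q" "q < 1"
  shows "\<exists>M\<ge>0. \<forall>K u. geo K q u \<longrightarrow> hs_sq s u \<le> ennreal (K\<^sup>2 * M)"
proof -
  have s: "summable (\<lambda>k. (1 + (real k)\<^sup>2) powr s * (q\<^sup>2) ^ k)"
    using assms by (intro geo_weight_summable) (auto simp: power_less_one_iff)
  define M where "M = (\<Sum>k. (1 + (real k)\<^sup>2) powr s * (q\<^sup>2) ^ k)"
  have "hs_sq s u \<le> ennreal (K\<^sup>2 * M)" if "geo K q u" for K u
  proof -
    have "hs_sq s u \<le> (\<Sum>k. ennreal (K\<^sup>2 * ((1 + (real k)\<^sup>2) powr s * (q\<^sup>2) ^ k)))"
      unfolding hs_sq_def
    proof (intro suminf_le summableI ennreal_leI)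
      fix k
      have "(cmod (u k))\<^sup>2 \<le> (K * q ^ k)\<^sup>2" using that by (intro power_mono) (auto simp: geo_def)
      then have "(1 + (real k)\<^sup>2) powr s * (cmod (u k))\<^sup>2 \<le> (1 + (real k)\<^sup>2) powr s * (K * q ^ k)\<^sup>2"
        by (intro mult_left_mono) auto
      then show "(1 + (real k)\<^sup>2) powr s * (cmod (u k))\<^sup>2 \<le> K\<^sup>2 * ((1 + (real k)\<^sup>2) powr s * (q\<^sup>2) ^ k)"
        by (simp add: power_mult_distrib power_mult[symmetric] mult.commute mult.left_commute)
    qed
    also have "\<dots> = ennreal (K\<^sup>2 * M)"
      unfolding M_def using s by (subst suminf_ennreal2) (auto simp: suminf_mult intro!: summable_mult)
    finally show ?thesis .
  qed
  moreover have "M \<ge> 0" unfolding M_def by (intro suminf_nonneg s) auto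
  ultimately show ?thesis by blast
qed

lemma geo_in_Hs: "geo K q u \<Longrightarrow> 0 \<le> q \<Longrightarrow> q < 1 \<Longrightarrow> in_Hs_plus s u"
  using geo_hs_bound[of q s] unfolding in_Hs_plus_def infinity_ennreal_def
  by (meson ennreal_less_top le_less_trans)

lemma geo_in_L2: "geo K q u \<Longrightarrow> 0 \<le> q \<Longrightarrow> q < 1 \<Longrightarrow> in_L2plus u"
  using geo_in_Hs[of K q u 0] unfolding in_L2plus_def in_Hs_plus_def l2_eq_hs0 .

lemma geo_nonneg: "geo K q u \<Longrightarrow> 0 \<le> K"
  unfolding geo_def by (metis norm_ge_zero order_trans mult.right_neutral power_0)

lemma geo_mult_summable:
  assumes "geo K q u" "0 \<le> q" "q < 1" "\<And>k. cmod (h k) \<le> B"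
  shows "summable (\<lambda>k. norm (u k * h k))"
proof -
  have "summable (\<lambda>k. K * B * q ^ k)" using assms(2,3) by (intro summable_mult summable_geometric) auto
  then show ?thesis
  proof (rule summable_comparison_test')
    fix k
    have "cmod (u k) * cmod (h k) \<le> (K * q ^ k) * B"
      using assms geo_nonneg[OF assms(1)] by (intro mult_mono) (auto simp: geo_def)
    then show "norm (norm (u k * h k)) \<le> K * B * q ^ k" by (simp add: norm_mult algebra_simps)
  qed
qed

lemma geo_shift:
  assumes "geo K q u" "0 \<le> q" "q < 1"
  shows "geo K q (\<lambda>j. u (k + j))" "geo K q (\<lambda>j. u (j + k))"
proof -
  have "cmod (u (k + j)) \<le> K * q ^ j" for j
  proof -
    have "cmod (u (k + j)) \<le> K * (q ^ k * q ^ j)"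
      using assms(1) by (simp add: geo_def flip: power_add)
    also have "\<dots> \<le> K * (1 * q ^ j)"
      using assms geo_nonneg[OF assms(1)] by (intro mult_left_mono mult_right_mono power_le_one) auto
    finally show ?thesis by simp
  qed
  then show "geo K q (\<lambda>j. u (k + j))" "geo K q (\<lambda>j. u (j + k))" by (auto simp: geo_def add.commute)
qed

lemma geo_bounded: "geo K q u \<Longrightarrow> 0 \<le> q \<Longrightarrow> q < 1 \<Longrightarrow> cmod (u k) \<le> K"
  unfolding geo_def using geo_nonneg[of K q u] mult_left_le[of "q ^ k" K] power_le_one[of q k]
  by (metis geo_def order.strict_implies_order order_trans)

lemma in_L2plus_bounded:
  assumes "in_L2plus h"
  shows "\<exists>B. \<forall>k. cmod (h k) \<le> B"
proof -
  have s: "summable (\<lambda>k. (cmod (h k))\<^sup>2)" using assms by (simp add: l2_sq_finite_iff)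
  have "cmod (h k) \<le> sqrt (\<Sum>k. (cmod (h k))\<^sup>2)" for k
    using sum_le_suminf[OF s, of "{k}"] by (intro real_le_rsqrt) auto
  then show ?thesis by blast
qed

text \<open>Since |v|^2 is real, it is the sum of its strictly positive frequencies and of the
  conjugate of Pi(|v|^2) = H_v v. Multiplied by v and projected, the first part gives the finite sum
  and the second gives H_v(H_v v).\<close>

lemma szego_nl_expand:
  assumes v: "geo K q v" "0 \<le> q" "q < 1"
  shows "szego_nl v k = (\<Sum>a<k. v a * hankel v v (k - a)) + hankel v (hankel v v) k"
proof -
  have vb: "cmod (cnj (v j)) \<le> K" for j using geo_bounded[OF v] by simp
  have hs: "summable (\<lambda>m. v (i + m) * cnj (v m))" for i
    using geo_mult_summable[OF geo_shift(1)[OF v] v(2,3), of "\<lambda>m. cnj (v m)" K i] vb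
    by (intro summable_norm_cancel[of "\<lambda>m. v (i + m) * cnj (v m)"]) simp
  define g where "g b j = v (k + b) * v j * cnj (v (b + j))" for b j
  have g1: "norm (g b j) \<le> K * K * K * q ^ b * q ^ j" for b j
  proof -
    have "norm (g b j) \<le> (K * q ^ b) * (K * q ^ j) * K"
      unfolding g_def norm_mult
      using geo_shift(1)[OF v, of k] v(1) geo_bounded[OF v, of "b + j"] geo_nonneg[OF v(1)] v(2)
      by (intro mult_mono) (auto simp: geo_def)
    then show ?thesis by (simp add: algebra_simps)
  qed
  have sg: "summable (\<lambda>j. C * q ^ j)" for C using v(2,3) by (intro summable_mult summable_geometric) auto
  have gs1: "summable (\<lambda>j. norm (g b j))" for b
    by (rule summable_comparison_test'[OF sg[of "K * K * K * q ^ b"]]) (use g1 in auto)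
  have gs2: "summable (\<lambda>b. \<Sum>j. norm (g b j))"
  proof (rule summable_comparison_test'[OF sg[of "K * K * K * (\<Sum>j. q ^ j)"]])
    fix b
    have "(\<Sum>j. norm (g b j)) \<le> (\<Sum>j. K * K * K * q ^ b * q ^ j)" by (intro suminf_le g1 gs1 sg)
    also have "\<dots> = K * K * K * q ^ b * (\<Sum>j. q ^ j)"
      using v(2,3) by (intro suminf_mult summable_geometric) auto
    finally show "norm (\<Sum>j. norm (g b j)) \<le> K * K * K * (\<Sum>j. q ^ j) * q ^ b"
      using suminf_nonneg[OF gs1[of b]] by (simp add: algebra_simps)
  qed
  have split: "cnj (v m) * (\<Sum>a\<le>k + m. v a * v (k + m - a))
      = (\<Sum>a<k. v a * (v ((k - a) + m) * cnj (v m))) + (\<Sum>b\<le>m. g b (m - b))" for m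
  proof -
    \<comment> \<open>For a < k the index k - a is a positive frequency of |v|^2; for a = k + b the
      frequencies of |v|^2 are nonpositive, and m = b + j separates the two remaining sums.\<close>
    have "{..k + m} = {..<k} \<union> {k..k + m}" by auto
    then have "(\<Sum>a\<le>k + m. v a * v (k + m - a))
        = (\<Sum>a<k. v a * v (k + m - a)) + (\<Sum>a=k..k + m. v a * v (k + m - a))"
      by (simp add: sum.union_disjoint ivl_disj_int)
    also have "(\<Sum>a=k..k + m. v a * v (k + m - a)) = (\<Sum>b\<le>m. v (k + b) * v (m - b))"
      using sum.shift_bounds_cl_nat_ivl[of "\<lambda>a. v a * v (k + m - a)" 0 k m]
      by (simp add: atLeast0AtMost add.commute)
    also have "(\<Sum>a<k. v a * v (k + m - a)) = (\<Sum>a<k. v a * v ((k - a) + m))"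
      by (intro sum.cong) auto
    finally show ?thesis
      by (simp add: distrib_left sum_distrib_left g_def mult_ac)
  qed
  have s1: "summable (\<lambda>m. \<Sum>a<k. v a * (v ((k - a) + m) * cnj (v m)))"
    by (intro summable_sum summable_mult hs)
  have "szego_nl v k = (\<Sum>m. \<Sum>a<k. v a * (v ((k - a) + m) * cnj (v m))) + (\<Sum>m. \<Sum>b\<le>m. g b (m - b))"
    unfolding szego_nl_def split by (intro suminf_add[symmetric] s1 suminf_triangle(2) gs1 gs2)
  also have "(\<Sum>m. \<Sum>a<k. v a * (v ((k - a) + m) * cnj (v m))) = (\<Sum>a<k. v a * hankel v v (k - a))"
    unfolding hankel_def
    by (subst suminf_sum[OF summable_mult[OF hs]], intro sum.cong refl, rule suminf_mult[OF hs])
  also have "(\<Sum>m. \<Sum>b\<le>m. g b (m - b)) = (\<Sum>b. \<Sum>j. g b j)"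
    by (rule suminf_triangle(1)[OF gs1 gs2])
  also have "\<dots> = hankel v (hankel v v) k"
    unfolding hankel_def g_def
  proof (intro suminf_cong)
    fix b
    have "(\<Sum>j. v (k + b) * v j * cnj (v (b + j))) = (\<Sum>j. v (k + b) * cnj (v (b + j) * cnj (v j)))"
      by (simp add: mult.commute mult.left_commute)
    also have "\<dots> = v (k + b) * (\<Sum>j. cnj (v (b + j) * cnj (v j)))"
      by (intro suminf_mult sums_summable[OF sums_cnj[THEN iffD2, OF summable_sums[OF hs[of b]]]])
    also have "(\<Sum>j. cnj (v (b + j) * cnj (v j))) = cnj (\<Sum>j. v (b + j) * cnj (v j))"
      using sums_unique[OF sums_cnj[THEN iffD2, OF summable_sums[OF hs[of b]]]] by simp
    finally show "(\<Sum>j. v (k + b) * v j * cnj (v (b + j))) = v (k + b) * cnj (\<Sum>j. v (b + j) * cnj (v j))" .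
  qed
  finally show ?thesis .
qed

section \<open>Abstract Hankel pairs\<close>

lemma has_dim_image:
  assumes F: "subsp F" and add: "\<And>x y. x \<in> F \<Longrightarrow> y \<in> F \<Longrightarrow> L (x + y) = L x + L y"
    and scl: "\<And>c x. x \<in> F \<Longrightarrow> L (c \<odot> x) = c \<odot> L x"
    and inj: "\<And>x. x \<in> F \<Longrightarrow> L x = 0 \<Longrightarrow> x = 0" and "has_dim F r"
  shows "has_dim (L ` F) r"
proof -
  obtain b where ind: "\<And>c. (\<forall>k. (\<Sum>i<r. c i * b i k) = 0) \<Longrightarrow> (\<forall>i<r. c i = 0)"
    and F_eq: "F = {(\<lambda>k. \<Sum>i<r. c i * b i k) | c. True}"
    using assms(5) unfolding has_dim_def by blast
  note comb = linear_combination_eq[where I = "{..<r}"]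
  have L0: "L 0 = 0" using scl[of 0 0] subspD(1)[OF F] by simp
  have bF: "b i \<in> F" if "i < r" for i
    unfolding F_eq comb using that
    by (intro CollectI exI[of _ "\<lambda>j. if j = i then 1 else 0"])
       (simp add: fun_eq_iff sum_seq_apply if_distrib[of "\<lambda>c. c * _"] cong: if_cong)
  have L_sum: "L (\<Sum>i\<in>I. c i \<odot> b i) = (\<Sum>i\<in>I. c i \<odot> L (b i))" if "I \<subseteq> {..<r}" for I c
    using finite_subset[OF that finite_lessThan] that
  proof (induction I rule: finite_induct)
    case empty
    show ?case unfolding sum.empty by (rule L0)
  next
    case (insert i I)
    have "(\<Sum>i\<in>I. c i \<odot> b i) \<in> F" using insert by (intro subsp_sum[OF F] subspD(3)[OF F] bF) auto
    then have "L (c i \<odot> b i + (\<Sum>i\<in>I. c i \<odot> b i)) = L (c i \<odot> b i) + L (\<Sum>i\<in>I. c i \<odot> b i)"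
      using insert(4) by (intro add subspD(3)[OF F] bF) auto
    also have "L (c i \<odot> b i) = c i \<odot> L (b i)" using insert(4) by (intro scl bF) auto
    also have "L (\<Sum>i\<in>I. c i \<odot> b i) = (\<Sum>i\<in>I. c i \<odot> L (b i))" using insert(4) by (intro insert.IH) auto
    finally show ?case unfolding sum.insert[OF insert(1,2)] .
  qed
  show ?thesis unfolding has_dim_def
  proof (intro exI[of _ "\<lambda>i. L (b i)"] conjI allI impI)
    fix c i assume z: "\<forall>k. (\<Sum>i<r. c i * L (b i) k) = 0" and i: "i < r"
    have "L (\<Sum>i<r. c i \<odot> b i) = (\<lambda>k. \<Sum>i<r. c i * L (b i) k)" unfolding comb by (rule L_sum) simp
    also have "\<dots> = 0" using z by (intro ext) (simp only: zero_fun_apply)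
    finally have L0': "L (\<Sum>i<r. c i \<odot> b i) = 0" .
    have mem: "(\<Sum>i<r. c i \<odot> b i) \<in> F" by (intro subsp_sum[OF F] subspD(3)[OF F] bF) auto
    have "(\<Sum>i<r. c i \<odot> b i) = 0" by (rule inj[OF mem L0'])
    then have "\<forall>k. (\<Sum>i<r. c i * b i k) = 0" unfolding comb[symmetric] by (metis zero_fun_apply)
    then show "c i = 0" using ind i by blast
  next
    have "L ` F = (\<lambda>c. L (\<Sum>i<r. c i \<odot> b i)) ` UNIV" unfolding F_eq comb by auto
    also have "\<dots> = (\<lambda>c k. \<Sum>i<r. c i * L (b i) k) ` UNIV" by (simp only: L_sum[OF order_refl] comb)
    finally show "L ` F = {(\<lambda>k. \<Sum>i<r. c i * L (b i) k) | c. True}" by auto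
  qed
qed

context fin_ip
begin

lemma has_dim_W: "has_dim W N"
  unfolding has_dim_def
proof (intro exI[of _ b] conjI allI impI)
  note comb = linear_combination_eq[where I = "{..<N}" and f = b]
  fix c i assume z: "\<forall>k. (\<Sum>i<N. c i * b i k) = 0" and i: "i < N"
  have "(\<lambda>k. \<Sum>i<N. c i * b i k) = 0" using z by (intro ext) (simp only: zero_fun_apply)
  then have 0: "(\<Sum>i<N. c i \<odot> b i) = 0" unfolding comb .
  have "c i = (\<Sum>j<N. c j * ip (b j) (b i))"
    using i by (simp add: b_on if_distrib[of "\<lambda>z. _ * z"] cong: if_cong)
  also have "\<dots> = ip (\<Sum>j<N. c j \<odot> b j) (b i)" 
    by (subst ip_sum) (auto intro!: sum.cong simp: ip_scl b_in i)
  finally show "c i = 0" unfolding 0 using b_in[OF i] by simp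
next
  note comb = linear_combination_eq[where I = "{..<N}" and f = b]
  show "W = {(\<lambda>k. \<Sum>i<N. c i * b i k) | c. True}"
    unfolding comb using b_exp b_in by fast
qed

lemma cauchy_schwarz:
  assumes "x \<in> W" "y \<in> W"
  shows "(cmod (ip x y))\<^sup>2 \<le> nsq x * nsq y"
proof (cases "y = 0")
  case True
  then show ?thesis using assms by (simp add: nsq_def)
next
  case False
  then have ny: "nsq y > 0" using ip_pos[OF assms(2)] by (simp add: nsq_def)
  define z where "z = of_real (1 / sqrt (nsq y)) \<odot> y"
  have zW: "z \<in> W" unfolding z_def using assms by simp
  have "nsq z = 1" using ny nsq_scl[OF assms(2), of "of_real (1 / sqrt (nsq y))"]
    by (simp add: z_def power_divide norm_divide)
  then have on: "on_fam 1 (\<lambda>_. z)" using zW by (simp add: on_fam_def ip_self)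
  have "nsq x - (cmod (ip x z))\<^sup>2 = nsq (x - proj 1 (\<lambda>_. z) x)"
    using nsq_proj_residual[OF on assms(1)] by simp
  also have "\<dots> \<ge> 0" using proj_in[OF on, of x] assms(1) by (intro nsq_nonneg W_diff)
  finally have "(cmod (ip x z))\<^sup>2 \<le> nsq x" by simp
  moreover have "(cmod (ip x z))\<^sup>2 = (cmod (ip x y))\<^sup>2 / nsq y"
    using ny assms by (simp add: z_def ip_scl2 norm_mult norm_divide power_divide)
  ultimately show ?thesis using ny by (simp add: field_simps)
qed

end

text \<open>In the model T is the backward shift, \<open>e\<close> represents the zeroth coefficient
  and TH is K_u. Adjoints are not part of the structure; they are recovered from the two symmetry
  axioms together with \<open>H_surj\<close>.\<close>

locale hankel_pair = fin_ip +
  fixes T H :: "seq \<Rightarrow> seq" and e :: seq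
  assumes T_lin: "semilin id W T" and H_anti: "semilin cnj W H" and e_in [simp]: "e \<in> W"
    and H_surj: "\<And>x. x \<in> W \<Longrightarrow> \<exists>y\<in>W. H y = x"
    and H_sym: "\<And>x y. x \<in> W \<Longrightarrow> y \<in> W \<Longrightarrow> ip (H x) y = ip (H y) x"
    and TH_sym: "\<And>x y. x \<in> W \<Longrightarrow> y \<in> W \<Longrightarrow> ip (T (H x)) y = ip (T (H y)) x"
    and T_defect: "\<And>x y. x \<in> W \<Longrightarrow> y \<in> W \<Longrightarrow> ip (T x) (T y) = ip x y - ip x e * cnj (ip y e)"
    and T_stable: "\<And>x c. x \<in> W \<Longrightarrow> T x = c \<odot> x \<Longrightarrow> cmod c = 1 \<Longrightarrow> x = 0"
begin

lemma T_in [simp, intro]: "x \<in> W \<Longrightarrow> T x \<in> W"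
  by (rule semilinD(1)[OF T_lin])

lemma H_in [simp, intro]: "x \<in> W \<Longrightarrow> H x \<in> W"
  by (rule semilinD(1)[OF H_anti])

lemma Tpow_lin: "semilin id W (T ^^ k)"
  by (rule semilin_pow[OF T_lin])

lemma Tpow_in [simp]: "x \<in> W \<Longrightarrow> (T ^^ k) x \<in> W"
  by (rule semilinD(1)[OF Tpow_lin])

text \<open>The adjoint of \<open>T\<close> is \<open>H\<^sup>-\<^sup>1TH\<close>, because \<open>H\<close> and \<open>TH\<close> are both symmetric.\<close>
lemma Tpow_adjoint:
  assumes "z \<in> W"
  shows "\<exists>a\<in>W. (T ^^ k) (H z) = H a \<and> (\<forall>x\<in>W. ip ((T ^^ k) x) z = ip x a)"
proof (induction k)
  case 0
  show ?case using assms by auto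
next
  case (Suc k)
  then obtain a where a: "a \<in> W" "(T ^^ k) (H z) = H a" "\<And>x. x \<in> W \<Longrightarrow> ip ((T ^^ k) x) z = ip x a"
    by blast
  obtain c where c: "c \<in> W" "H c = T (H a)" using H_surj[of "T (H a)"] a(1) by blast
  have "ip (T x) a = ip x c" if x: "x \<in> W" for x
  proof -
    obtain w where w: "w \<in> W" "H w = x" using H_surj[OF x] by blast
    have "ip (T x) a = ip (T (H w)) a" by (simp only: w(2))
    also have "\<dots> = ip (H c) w" unfolding c(2) by (rule TH_sym) (use w a in auto)
    also have "\<dots> = ip (H w) c" by (rule H_sym) (use w c in auto)
    finally show ?thesis by (simp only: w(2))
  qed
  then have "ip ((T ^^ Suc k) x) z = ip x c" if "x \<in> W" for x
    using a(3)[of "T x"] that by (simp add: funpow_swap1)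
  moreover have "(T ^^ Suc k) (H z) = H c" unfolding c(2) a(2)[symmetric] by simp
  ultimately show ?case using c(1) by blast
qed

text \<open>In the model this is the symmetry of the Hankel matrix of the symbol shifted k
  times.\<close>

lemma TpowH_sym:
  assumes "x \<in> W" "y \<in> W"
  shows "ip ((T ^^ k) (H x)) y = ip ((T ^^ k) (H y)) x"
proof -
  obtain a where a: "a \<in> W" "(T ^^ k) (H y) = H a" "\<forall>x\<in>W. ip ((T ^^ k) x) y = ip x a"
    using Tpow_adjoint[OF assms(2), of k] by blast
  have "ip ((T ^^ k) (H x)) y = ip (H x) a" using a(3) assms by blast
  also have "\<dots> = ip ((T ^^ k) (H y)) x" unfolding a(2) by (rule H_sym) (use assms a in auto)
  finally show ?thesis .
qed

text \<open>Turns an abstract vector into a sequence: the k-th coefficient is the zeroth one after k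
  backward shifts.\<close>

definition J :: "seq \<Rightarrow> seq" where "J x = (\<lambda>k. ip ((T ^^ k) x) e)"

definition u :: seq where "u = H e"

lemma u_in [simp]: "u \<in> W"
  unfolding u_def by simp

lemma J_add: "x \<in> W \<Longrightarrow> y \<in> W \<Longrightarrow> J (x + y) = J x + J y"
  by (intro ext) (simp add: J_def semilinD(2)[OF Tpow_lin] ip_add)

lemma J_scl: "x \<in> W \<Longrightarrow> J (c \<odot> x) = c \<odot> J x"
  by (intro ext) (simp add: J_def semilinD(3)[OF Tpow_lin] ip_scl)

lemma nsq_T: "x \<in> W \<Longrightarrow> nsq (T x) = nsq x - (cmod (ip x e))\<^sup>2"
  unfolding nsq_def by (simp add: T_defect complex_norm_square[symmetric] flip: of_real_power)

text \<open>The vectors with vanishing \<open>J\<close> form a T-invariant space orthogonal to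
  \<open>e\<close>, on which \<open>T_defect\<close> makes T isometric. An eigenvector in it would
  have a unimodular eigenvalue, against \<open>T_stable\<close>.\<close>

lemma observable:
  assumes "x \<in> W" "\<And>k. J x k = 0"
  shows "x = 0"
proof (rule ccontr)
  assume "x \<noteq> 0"
  define F where "F = {x\<in>W. \<forall>k. ip ((T ^^ k) x) e = 0}"
  have F: "subsp F" unfolding F_def subsp_def
    using semilinD(2,3)[OF Tpow_lin] semilinD(3)[OF Tpow_lin W0, of _ 0] by (auto simp: ip_add ip_scl)
  have "T x \<in> F" if "x \<in> F" for x
  proof -
    have "ip ((T ^^ k) (T x)) e = 0" for k
      using that unfolding F_def funpow_swap1[symmetric] by (metis (mono_tags) funpow.simps(2) comp_apply mem_Collect_eq)
    then show ?thesis using that by (auto simp: F_def)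
  qed
  then have "semilin id F T" by (intro semilin_subset[OF T_lin]) (auto simp: F_def)
  moreover have "x \<in> F" using assms by (auto simp: F_def J_def)
  moreover have FW: "F \<subseteq> W" by (auto simp: F_def)
  ultimately obtain c y where y: "y \<in> F" "y \<noteq> 0" "T y = c \<odot> y"
    using exists_eigenvector[OF F FW _ _ \<open>x \<noteq> 0\<close>] by blast
  have yW: "y \<in> W" using y(1) FW by blast
  have "ip ((T ^^ 0) y) e = 0" using y(1) unfolding F_def by blast
  then have "nsq (c \<odot> y) = nsq y" using nsq_T[OF yW] unfolding y(3) by simp
  then have "(cmod c)\<^sup>2 * nsq y = nsq y" using nsq_scl[OF yW] by simp
  then have "(cmod c)\<^sup>2 = 1" using nsq_eq_0_iff[OF yW] y(2) by simp
  then have "cmod c = 1" using power2_eq_1_iff[of "cmod c"] norm_ge_zero[of c] by linarith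
  then show False using T_stable[OF yW y(3)] y(2) by blast
qed

end

text \<open>The constants \<open>C\<close> and \<open>r\<close> are parameters so that one choice
  can serve all deformed pairs; they are supplied by \<open>T'_uniform_decay\<close>.\<close>

locale decaying_hankel_pair = hankel_pair +
  fixes C r :: real
  assumes r: "0 \<le> r" "r < 1" and C: "0 \<le> C"
    and decay: "\<And>x k. x \<in> W \<Longrightarrow> nsq ((T ^^ k) x) \<le> (C * r ^ k)\<^sup>2 * nsq x"
begin

lemma ip_Tpow_geo:
  assumes "x \<in> W" "y \<in> W"
  shows "geo (C * sqrt (nsq x * nsq y)) r (\<lambda>k. ip ((T ^^ k) x) y)"
  unfolding geo_def
proof
  fix k
  have "(cmod (ip ((T ^^ k) x) y))\<^sup>2 \<le> nsq ((T ^^ k) x) * nsq y"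
    using assms by (intro cauchy_schwarz) auto
  also have "\<dots> \<le> (C * r ^ k)\<^sup>2 * nsq x * nsq y"
    using assms decay by (intro mult_right_mono) auto
  also have "\<dots> = (C * sqrt (nsq x * nsq y) * r ^ k)\<^sup>2"
    using assms by (simp add: power_mult_distrib)
  finally show "cmod (ip ((T ^^ k) x) y) \<le> C * sqrt (nsq x * nsq y) * r ^ k"
    by (rule power2_le_imp_le) (simp add: C r assms)
qed

lemma J_geo: "x \<in> W \<Longrightarrow> geo (C * sqrt (nsq x * nsq e)) r (J x)"
  unfolding J_def by (rule ip_Tpow_geo) auto

text \<open>By \<open>T_defect\<close> the k-th term is (T^k x|T^k y) - (T^(k+1) x|T^(k+1) y), so
  the series telescopes and the decay removes the remainder. Thus \<open>J\<close> is an isometry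
  into l2.\<close>

lemma parseval:
  assumes "x \<in> W" "y \<in> W"
  shows "(\<lambda>k. J x k * cnj (J y k)) sums ip x y"
proof -
  have "(\<lambda>k. ip ((T ^^ k) x) ((T ^^ k) y)) \<longlonglongrightarrow> 0"
  proof (rule Lim_null_comparison)
    show "\<forall>\<^sub>F k in sequentially. norm (ip ((T ^^ k) x) ((T ^^ k) y)) \<le> C * C * sqrt (nsq x * nsq y) * (r ^ k * r ^ k)"
    proof (intro always_eventually allI)
      fix k
      have "(cmod (ip ((T ^^ k) x) ((T ^^ k) y)))\<^sup>2 \<le> nsq ((T ^^ k) x) * nsq ((T ^^ k) y)"
        using assms by (intro cauchy_schwarz) auto
      also have "\<dots> \<le> ((C * r ^ k)\<^sup>2 * nsq x) * ((C * r ^ k)\<^sup>2 * nsq y)"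
        using assms decay by (intro mult_mono) auto
      also have "\<dots> = (C * C * sqrt (nsq x * nsq y) * (r ^ k * r ^ k))\<^sup>2"
        using assms by (simp add: power_mult_distrib power2_eq_square)
      finally show "norm (ip ((T ^^ k) x) ((T ^^ k) y)) \<le> C * C * sqrt (nsq x * nsq y) * (r ^ k * r ^ k)"
        by (rule power2_le_imp_le) (simp add: C r assms)
    qed
    have "(\<lambda>k. r ^ k) \<longlonglongrightarrow> 0" using r by (intro LIMSEQ_power_zero) auto
    then show "(\<lambda>k. C * C * sqrt (nsq x * nsq y) * (r ^ k * r ^ k)) \<longlonglongrightarrow> 0"
      by (intro tendsto_mult_right_zero) (use tendsto_mult[of "\<lambda>k. r ^ k" 0 _ "\<lambda>k. r ^ k" 0] in simp)
  qed
  from telescope_sums'[OF this] show ?thesis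
    using assms by (simp add: J_def T_defect)
qed

lemma J_u_split:
  assumes "a \<in> W" "(T ^^ k) u = H a"
  shows "J u (k + j) = J (H a) j"
  unfolding J_def assms(2)[symmetric] by (simp add: funpow_add[symmetric, THEN fun_cong, simplified] add.commute)

text \<open>A sequence h acts only through the functional y to the sum of
  \<open>J y j * cnj (h j)\<close>; once x represents it on \<open>W\<close>, h itself need not come
  from \<open>W\<close>. Row k of the Hankel matrix is \<open>J (H a)\<close> with a the adjoint of
  T^k applied to \<open>e\<close>, and the symmetry of H exchanges a and x.\<close>

lemma hankel_Ju_gen:
  assumes x: "x \<in> W" and h: "\<And>y. y \<in> W \<Longrightarrow> (\<lambda>j. J y j * cnj (h j)) sums ip y x"
  shows "hankel (J u) h = J (H x)"
proof
  fix k
  obtain a where a: "a \<in> W" "(T ^^ k) u = H a" "\<And>x. x \<in> W \<Longrightarrow> ip ((T ^^ k) x) e = ip x a"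
    using Tpow_adjoint[OF e_in, of k] unfolding u_def by blast
  have "hankel (J u) h k = (\<Sum>j. J (H a) j * cnj (h j))"
    unfolding hankel_def by (simp only: J_u_split[OF a(1,2)])
  also have "\<dots> = ip (H a) x" using h[of "H a"] a(1) by (simp add: sums_iff)
  also have "\<dots> = ip (H x) a" by (rule H_sym) (use a x in auto)
  also have "\<dots> = J (H x) k" unfolding J_def using a(3)[of "H x"] x by simp
  finally show "hankel (J u) h k = J (H x) k" .
qed

lemma hankel_Ju: "x \<in> W \<Longrightarrow> hankel (J u) (J x) = J (H x)"
  by (rule hankel_Ju_gen) (auto intro: parseval)

lemma hankel_Ju_L2:
  assumes "in_L2plus h"
  shows "\<exists>x\<in>W. hankel (J u) h = J (H x)"
proof -
  obtain B where B: "\<And>k. cmod (cnj (h k)) \<le> B" using in_L2plus_bounded[OF assms] by auto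
  have s: "summable (\<lambda>j. J y j * cnj (h j))" if "y \<in> W" for y
    by (rule summable_norm_cancel[OF geo_mult_summable[OF J_geo[OF that] r B]])
  \<comment> \<open>The functional defined by h, evaluated on the basis; x is its Riesz representer,
    so \<open>J x\<close> is the projection of h to the range of \<open>J\<close>.\<close>
  define d where "d i = (\<Sum>j. J (b i) j * cnj (h j))" for i
  define x where "x = (\<Sum>i<N. cnj (d i) \<odot> b i)"
  have xW: "x \<in> W" unfolding x_def using b_in by auto
  have "(\<lambda>j. J y j * cnj (h j)) sums ip y x" if y: "y \<in> W" for y
  proof -
    have "J y j = (\<Sum>i<N. ip y (b i) * J (b i) j)" for j
    proof -
      have "J y j = ip ((T ^^ j) (\<Sum>i<N. ip y (b i) \<odot> b i)) e" unfolding J_def using b_exp[OF y] by simp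
      also have "(T ^^ j) (\<Sum>i<N. ip y (b i) \<odot> b i) = (\<Sum>i<N. ip y (b i) \<odot> (T ^^ j) (b i))"
        by (subst semilin_sum[OF Tpow_lin W_subsp])
           (auto intro!: W_scl b_in sum.cong simp: semilinD(3)[OF Tpow_lin] b_in)
      also have "ip (\<Sum>i<N. ip y (b i) \<odot> (T ^^ j) (b i)) e = (\<Sum>i<N. ip y (b i) * ip ((T ^^ j) (b i)) e)"
        by (subst ip_sum) (auto intro!: sum.cong simp: ip_scl b_in)
      finally show ?thesis unfolding J_def .
    qed
    then have "(\<lambda>j. J y j * cnj (h j)) = (\<lambda>j. \<Sum>i<N. ip y (b i) * (J (b i) j * cnj (h j)))"
      by (simp add: sum_distrib_right mult.assoc)
    also have "\<dots> sums (\<Sum>i<N. ip y (b i) * d i)"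
      unfolding d_def using s b_in by (intro sums_sum sums_mult summable_sums) auto
    also have "(\<Sum>i<N. ip y (b i) * d i) = ip y x"
      unfolding x_def by (subst ip_sum2) (auto intro!: sum.cong simp: ip_scl2 b_in y mult.commute)
    finally show ?thesis .
  qed
  then show ?thesis using hankel_Ju_gen[OF xW] xW by blast
qed

lemma range_hankel: "hankel (J u) ` {h. in_L2plus h} = J ` W"
proof (intro subset_antisym subsetI)
  fix f assume "f \<in> hankel (J u) ` {h. in_L2plus h}"
  then obtain h where "in_L2plus h" "f = hankel (J u) h" by blast
  then show "f \<in> J ` W" using hankel_Ju_L2[of h] by auto
next
  fix f assume "f \<in> J ` W"
  then obtain y where y: "y \<in> W" "f = J y" by blast
  obtain x where x: "x \<in> W" "H x = y" using H_surj[OF y(1)] by blast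
  have "f = hankel (J u) (J x)" unfolding y(2) x(2)[symmetric] by (rule hankel_Ju[OF x(1), symmetric])
  then show "f \<in> hankel (J u) ` {h. in_L2plus h}" using geo_in_L2[OF J_geo[OF x(1)] r] by blast
qed

lemma hankelK_Ju:
  assumes "in_L2plus h" "x \<in> W" "hankel (J u) h = J (H x)"
  shows "hankelK (J u) h = J (T (H x))"
proof
  fix k
  obtain B where B: "\<And>k. cmod (h k) \<le> B" using in_L2plus_bounded[OF assms(1)] by auto
  have B': "cmod (cnj (shift h k)) \<le> B" for k
    using B[of "k - 1"] order_trans[OF norm_ge_zero B[of 0]] by (auto simp: shift_def)
  have s: "summable (\<lambda>j. J u (k + j) * cnj (shift h j))"
    by (rule summable_norm_cancel[OF geo_mult_summable[OF geo_shift(1)[OF J_geo r] r B']]) simp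
  \<comment> \<open>The term j = 0 vanishes because \<open>shift h 0 = 0\<close>; reindexing turns
    the shift of the argument into a backward shift of the result.\<close>
  have "hankelK (J u) h k = (\<Sum>j. J u (k + Suc j) * cnj (shift h (Suc j)))"
    unfolding hankelK_def hankel_def by (subst suminf_split_head[OF s]) (simp add: shift_def)
  also have "\<dots> = hankel (J u) h (Suc k)" unfolding hankel_def shift_def by simp
  also have "\<dots> = J (T (H x)) k" unfolding assms(3) unfolding J_def by (simp add: funpow_swap1)
  finally show "hankelK (J u) h k = J (T (H x)) k" .
qed

lemma range_hankelK: "hankelK (J u) ` {h. in_L2plus h} = J ` (T ` W)"
proof (intro subset_antisym subsetI)
  fix f assume "f \<in> hankelK (J u) ` {h. in_L2plus h}"
  then obtain h where h: "in_L2plus h" "f = hankelK (J u) h" by blast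
  obtain x where x: "x \<in> W" "hankel (J u) h = J (H x)" using hankel_Ju_L2[OF h(1)] by blast
  then show "f \<in> J ` (T ` W)" using hankelK_Ju[OF h(1) x] h(2) by blast
next
  fix f assume "f \<in> J ` (T ` W)"
  then obtain y where y: "y \<in> W" "f = J (T y)" by blast
  obtain x where x: "x \<in> W" "H x = y" using H_surj[OF y(1)] by blast
  have l2: "in_L2plus (J x)" by (rule geo_in_L2[OF J_geo[OF x(1)] r])
  have "f = hankelK (J u) (J x)" unfolding y(2) x(2)[symmetric]
    by (rule hankelK_Ju[OF l2 x(1) hankel_Ju[OF x(1)], symmetric])
  then show "f \<in> hankelK (J u) ` {h. in_L2plus h}" using l2 by blast
qed

lemma J_eq_0: "x \<in> W \<Longrightarrow> J x = 0 \<Longrightarrow> x = 0"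
  by (rule observable) simp_all

lemma J_u_in_V:
  assumes "N = (d + 1) div 2" "has_dim (T ` W) (d div 2)"
  shows "J u \<in> V d"
proof -
  have "has_dim (J ` W) N"
    by (rule has_dim_image[OF W_subsp J_add J_scl J_eq_0 has_dim_W])
  moreover have TW: "T ` W \<subseteq> W" by (simp add: image_subset_iff)
  moreover have "has_dim (J ` (T ` W)) (d div 2)"
  proof (rule has_dim_image[OF _ _ _ _ assms(2)])
    show "subsp (T ` W)" by (rule subsp_image[OF W_subsp T_lin surj_id])
    show "J (x + y) = J x + J y" if "x \<in> T ` W" "y \<in> T ` W" for x y
      using that TW by (intro J_add) blast+
    show "J (c \<odot> x) = c \<odot> J x" if "x \<in> T ` W" for c x
      using that TW by (intro J_scl) blast
    show "x = 0" if "x \<in> T ` W" "J x = 0" for x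
      using that(1) TW by (intro J_eq_0[OF _ that(2)]) blast
  qed
  ultimately show ?thesis
    unfolding V_def op_rank_eq_def mem_Collect_eq range_hankel range_hankelK assms(1)[symmetric]
    using geo_in_Hs[OF J_geo[OF u_in] r] by blast
qed

text \<open>By \<open>TpowH_sym\<close> the coefficients of H u are (T^j u|u). Both parts of the
  cubic term are now matrix coefficients of powers of T, which can be compared with the Leibniz
  expansion in \<open>\<Phi>_flow\<close>.\<close>

lemma szego_nl_Ju:
  "szego_nl (J u) k = (\<Sum>a<k. J u a * ip ((T ^^ (k - a)) u) u) + J (H (H u)) k"
proof -
  have "J (H u) j = ip ((T ^^ j) u) u" for j
    unfolding J_def using TpowH_sym[of u e j] by (simp only: u_def[symmetric] u_in e_in)
  then show ?thesis
    using szego_nl_expand[OF J_geo[OF u_in] r, of k] hankel_Ju[OF u_in] hankel_Ju[of "H u"] by simp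
qed

end

section \<open>Phase deformations\<close>

context fin_ip
begin

text \<open>One notion for two purposes: unimodular \<open>p\<close> gives the unitary phases, real
  eigenvalues give back the self-adjoint operator (\<open>eigenbasis_apply\<close>).\<close>

definition dia :: "(nat \<Rightarrow> seq) \<Rightarrow> (nat \<Rightarrow> complex) \<Rightarrow> seq \<Rightarrow> seq" where
  "dia f p x = (\<Sum>i<N. (p i * ip x (f i)) \<odot> f i)"

lemma on_famD: "on_fam m f \<Longrightarrow> i < m \<Longrightarrow> f i \<in> W"
  unfolding on_fam_def by blast

lemma onb_ext:
  assumes "on_fam N f" "x \<in> W" "y \<in> W" "\<And>i. i < N \<Longrightarrow> ip x (f i) = ip y (f i)"
  shows "x = y"
proof -
  have "x = proj N f x" by (rule onb_exp[OF assms(1,2), symmetric])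
  also have "\<dots> = proj N f y" unfolding proj_def using assms(4) by (intro sum.cong) auto
  also have "\<dots> = y" by (rule onb_exp[OF assms(1,3)])
  finally show ?thesis .
qed

lemma dia_in: "on_fam N f \<Longrightarrow> dia f p x \<in> W"
  unfolding dia_def by (intro W_sum W_scl) (simp add: on_famD)

lemma ip_dia:
  assumes "on_fam N f" "x \<in> W" "j < N"
  shows "ip (dia f p x) (f j) = p j * ip x (f j)"
proof -
  have "ip (dia f p x) (f j) = (\<Sum>i<N. (p i * ip x (f i)) * ip (f i) (f j))"
    unfolding dia_def
    by (subst ip_sum) (auto intro!: sum.cong simp: on_famD[OF assms(1)] assms(3) ip_scl)
  also have "\<dots> = (\<Sum>i<N. if i = j then p j * ip x (f j) else 0)"
    using assms unfolding on_fam_def by (intro sum.cong) auto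
  finally show ?thesis using assms by simp
qed

lemma dia_lin: "on_fam N f \<Longrightarrow> semilin id W (dia f p)"
  unfolding semilin_def
proof (intro conjI ballI allI)
  assume f: "on_fam N f"
  fix x assume x: "x \<in> W"
  show "dia f p x \<in> W" by (rule dia_in[OF f])
  show "dia f p (x + y) = dia f p x + dia f p y" if y: "y \<in> W" for y
    by (rule onb_ext[OF f]) (simp_all add: dia_in f x y ip_dia ip_add on_famD[OF f] distrib_left)
  show "dia f p (c \<odot> x) = id c \<odot> dia f p x" for c
    by (rule onb_ext[OF f]) (simp_all add: dia_in f x ip_dia ip_scl on_famD[OF f])
qed

lemma dia_comp:
  assumes "on_fam N f" "x \<in> W"
  shows "dia f p (dia f q x) = dia f (\<lambda>i. p i * q i) x"
  by (rule onb_ext[OF assms(1)]) (simp_all add: assms dia_in ip_dia)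

lemma dia_one:
  assumes "on_fam N f" "x \<in> W" "\<And>i. i < N \<Longrightarrow> p i = 1"
  shows "dia f p x = x"
  by (rule onb_ext[OF assms(1)]) (simp_all add: assms dia_in ip_dia)

lemma dia_cancel:
  assumes "on_fam N f" "x \<in> W" "\<And>i. i < N \<Longrightarrow> cmod (p i) = 1"
  shows "dia f p (dia f (\<lambda>i. cnj (p i)) x) = x" "dia f (\<lambda>i. cnj (p i)) (dia f p x) = x"
  using assms
  by (simp_all add: dia_comp dia_one complex_norm_square[symmetric] mult.commute[of "cnj _"])

lemma dia_adjoint:
  assumes "on_fam N f" "x \<in> W" "y \<in> W"
  shows "ip (dia f p x) y = ip x (dia f (\<lambda>i. cnj (p i)) y)"
proof -
  have fW: "\<And>i. i < N \<Longrightarrow> f i \<in> W" using assms(1) by (rule on_famD)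
  have "ip (dia f p x) y = (\<Sum>i<N. (p i * ip x (f i)) * ip (f i) y)"
    unfolding dia_def by (subst ip_sum) (auto intro!: sum.cong simp: fW ip_scl assms)
  also have "\<dots> = (\<Sum>i<N. cnj (cnj (p i) * ip y (f i)) * ip x (f i))"
    using ip_cnj[OF assms(3) fW] by (intro sum.cong) auto
  also have "\<dots> = ip x (dia f (\<lambda>i. cnj (p i)) y)"
    unfolding dia_def by (subst ip_sum2) (auto intro!: sum.cong simp: fW ip_scl2 assms)
  finally show ?thesis .
qed

lemma dia_isometry:
  assumes "on_fam N f" "x \<in> W" "y \<in> W" "\<And>i. i < N \<Longrightarrow> cmod (p i) = 1"
  shows "ip (dia f p x) (dia f p y) = ip x y"
  using dia_adjoint[OF assms(1,2) dia_in[OF assms(1), of p y], of p] dia_cancel(2)[OF assms(1,3), of p] assms(4)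
  by simp

lemma eigenbasis_apply:
  assumes "on_fam N f" "semilin id W A" "\<And>i. i < N \<Longrightarrow> A (f i) = of_real (l i) \<odot> f i" "x \<in> W"
  shows "A x = dia f (\<lambda>i. of_real (l i)) x"
proof -
  have fW: "\<And>i. i < N \<Longrightarrow> f i \<in> W" using assms(1) by (rule on_famD)
  have "A x = A (\<Sum>i<N. ip x (f i) \<odot> f i)"
    using onb_exp[OF assms(1,4)] unfolding proj_def by (rule arg_cong[OF sym])
  also have "\<dots> = (\<Sum>i<N. A (ip x (f i) \<odot> f i))"
    by (rule semilin_sum[OF assms(2) W_subsp]) (auto simp: fW)
  also have "\<dots> = dia f (\<lambda>i. of_real (l i)) x"
    unfolding dia_def by (intro sum.cong refl) (simp add: semilinD(3)[OF assms(2)] fW assms(3) mult.commute)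
  finally show ?thesis .
qed

text \<open>An eigenvector has components only along those \<open>f j\<close> that share its
  eigenvalue, and there the phase is constant.\<close>

lemma eigenvector_phase:
  assumes f: "on_fam N f" "semilin id W A" "\<And>i. i < N \<Longrightarrow> A (f i) = of_real (l i) \<odot> f i"
    and x: "x \<in> W" "x \<noteq> 0" "A x = c \<odot> x"
  shows "\<exists>i<N. c = of_real (l i) \<and>
    (\<forall>p. (\<forall>j<N. l j = l i \<longrightarrow> p j = p i) \<longrightarrow> dia f p x = p i \<odot> x)"
proof -
  have fW: "\<And>i. i < N \<Longrightarrow> f i \<in> W" using f(1) by (rule on_famD)
  have coeff: "(of_real (l i) - c) * ip x (f i) = 0" if "i < N" for i
  proof -
    have "A x = dia f (\<lambda>i. of_real (l i)) x" by (rule eigenbasis_apply[OF f x(1)])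
    then have "of_real (l i) * ip x (f i) = ip (A x) (f i)"
      using ip_dia[OF f(1) x(1) that, of "\<lambda>i. of_real (l i)"] by presburger
    also have "\<dots> = c * ip x (f i)" unfolding x(3) using x(1) fW[OF that] by (simp add: ip_scl)
    finally show ?thesis by (simp add: algebra_simps)
  qed
  have "\<exists>i<N. ip x (f i) \<noteq> 0"
    using onb_ext[OF f(1) x(1) W0] x(2) fW by fastforce
  then obtain i where i: "i < N" "ip x (f i) \<noteq> 0" by blast
  have c: "c = of_real (l i)" using coeff[OF i(1)] i(2) by simp
  have "dia f p x = p i \<odot> x" if "\<forall>j<N. l j = l i \<longrightarrow> p j = p i" for p
  proof (rule onb_ext[OF f(1)])
    fix j assume j: "j < N"
    show "ip (dia f p x) (f j) = ip (p i \<odot> x) (f j)"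
      using coeff[OF j] that j fW[OF j] x(1) unfolding c
      by (cases "l j = l i") (auto simp: ip_dia[OF f(1) x(1)] ip_scl)
  qed (use x dia_in[OF f(1)] in auto)
  then show ?thesis using i(1) c by blast
qed

text \<open>H commutes with H^2, so it preserves each eigenspace of H^2; there the phase is a
  scalar, which an antilinear map conjugates. Applied to H and to TH.\<close>

lemma antilinear_dia:
  assumes f: "on_fam N f" and H: "semilin cnj W H"
    and HH: "\<And>i. i < N \<Longrightarrow> H (H (f i)) = of_real (l i) \<odot> f i"
    and p: "\<And>i j. i < N \<Longrightarrow> j < N \<Longrightarrow> l j = l i \<Longrightarrow> p j = p i" and x: "x \<in> W"
  shows "H (dia f p x) = dia f (\<lambda>i. cnj (p i)) (H x)"
proof -
  have fW: "\<And>i. i < N \<Longrightarrow> f i \<in> W" using f by (rule on_famD)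
  have HHlin: "semilin id W (\<lambda>x. H (H x))" using semilin_comp[OF H H] by (simp add: comp_def id_def)
  have Hf: "dia f (\<lambda>i. cnj (p i)) (H (f i)) = cnj (p i) \<odot> H (f i)" if i: "i < N" for i
  \<comment> \<open>\<open>H (f i)\<close> is an eigenvector of H^2 for the same eigenvalue, unless
    it is zero.\<close>
  proof (cases "H (f i) = 0")
    case True
    have "dia f (\<lambda>i. cnj (p i)) 0 = 0"
      using semilinD(3)[OF dia_lin[OF f, of "\<lambda>i. cnj (p i)"] W0, of 0] by simp
    then show ?thesis unfolding True by simp
  next
    case False
    have e: "H (H (H (f i))) = of_real (l i) \<odot> H (f i)"
      unfolding HH[OF i] using semilinD(3)[OF H fW[OF i]] by simp
    obtain i' where i': "i' < N" "complex_of_real (l i) = of_real (l i')"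
      "\<And>p. (\<forall>j<N. l j = l i' \<longrightarrow> p j = p i') \<Longrightarrow> dia f p (H (f i)) = p i' \<odot> H (f i)"
      using eigenvector_phase[OF f HHlin HH semilinD(1)[OF H fW[OF i]] False e] by blast
    have "p i' = p i" using p[OF i i'(1)] i'(2) by simp
    then show ?thesis using i'(3)[of "\<lambda>i. cnj (p i)"] p[OF i'(1)] by (metis (no_types, lifting))
  qed
  have x_eq: "x = (\<Sum>i<N. ip x (f i) \<odot> f i)" using onb_exp[OF f x] unfolding proj_def by (rule sym)
  have "H (dia f p x) = (\<Sum>i<N. H ((p i * ip x (f i)) \<odot> f i))"
    unfolding dia_def by (rule semilin_sum[OF H W_subsp]) (auto simp: fW)
  also have "\<dots> = (\<Sum>i<N. dia f (\<lambda>i. cnj (p i)) (H (ip x (f i) \<odot> f i)))"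
    by (intro sum.cong refl)
       (simp add: semilinD(3)[OF H] semilinD(1)[OF H] fW semilinD(3)[OF dia_lin[OF f]] Hf mult.commute)
  also have "\<dots> = dia f (\<lambda>i. cnj (p i)) (\<Sum>i<N. H (ip x (f i) \<odot> f i))"
    by (rule semilin_sum[OF dia_lin[OF f] W_subsp, symmetric]) (auto simp: fW semilinD(1)[OF H])
  also have "(\<Sum>i<N. H (ip x (f i) \<odot> f i)) = H (\<Sum>i<N. ip x (f i) \<odot> f i)"
    by (rule semilin_sum[OF H W_subsp, symmetric]) (auto simp: fW)
  finally show ?thesis unfolding x_eq[symmetric] .
qed

end

section \<open>The rank-one identity and the deformed pairs\<close>

context hankel_pair
begin

lemma H_lin2: "semilin id W (\<lambda>x. H (H x))"
  using semilin_comp[OF H_anti H_anti] by (simp add: comp_def id_def)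

lemma K_anti: "semilin cnj W (\<lambda>x. T (H x))"
  using semilin_comp[OF T_lin H_anti] by simp

lemma K_lin2: "semilin id W (\<lambda>x. T (H (T (H x))))"
  using semilin_comp[OF K_anti K_anti] by (simp add: comp_def id_def)

lemma H2_selfadjoint:
  assumes "x \<in> W" "y \<in> W"
  shows "ip (H (H x)) y = ip x (H (H y))"
  using H_sym[of "H x" y] H_sym[of "H y" x] ip_cnj[of "H y" "H x"] ip_cnj[of "H (H y)" x] assms by simp

lemma K2_selfadjoint:
  assumes "x \<in> W" "y \<in> W"
  shows "ip (T (H (T (H x)))) y = ip x (T (H (T (H y))))"
  using TH_sym[of "T (H x)" y] TH_sym[of "T (H y)" x] ip_cnj[of "T (H y)" "T (H x)"]
    ip_cnj[of "T (H (T (H y)))" x] assms by simp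

text \<open>In the model this is K_u^2 = H_u^2 - (.|u)u. It is \<open>T_defect\<close> read between
  H y and H x, where symmetry turns (H x|e) into (u|x).\<close>

lemma K2_eq:
  assumes "x \<in> W"
  shows "T (H (T (H x))) = H (H x) - ip x u \<odot> u"
proof (rule ip_eqI)
  fix y assume y: "y \<in> W"
  have "ip (T (H (T (H x)))) y = ip (T (H y)) (T (H x))" using assms y by (intro TH_sym) auto
  also have "\<dots> = ip (H y) (H x) - ip (H y) e * cnj (ip (H x) e)" using assms y by (intro T_defect) auto
  also have "ip (H y) (H x) = ip (H (H x)) y" using assms y by (intro H_sym) auto
  also have "ip (H y) e = ip u y" unfolding u_def using y by (intro H_sym) auto
  also have "ip (H x) e = ip u x" unfolding u_def using assms by (intro H_sym) auto
  also have "cnj (ip u x) = ip x u" using assms by (intro ip_cnj[symmetric]) auto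
  finally show "ip (T (H (T (H x)))) y = ip (H (H x) - ip x u \<odot> u) y"
    using assms y by (simp add: ip_diff ip_scl)
qed (use assms in auto)

end

text \<open>A canonical representative for each eigenvalue: all basis vectors of an eigenspace read
  their phase at the same coordinate, and \<open>idx_le\<close> keeps that coordinate below
  \<open>N\<close>.\<close>

definition idx :: "(nat \<Rightarrow> real) \<Rightarrow> nat \<Rightarrow> nat" where
  "idx l i = (LEAST j. l j = l i)"

lemma idx_eq: "l j = l i \<Longrightarrow> idx l j = idx l i"
  unfolding idx_def by simp

lemma l_idx [simp]: "l (idx l i) = l i"
  unfolding idx_def by (rule LeastI_ex) auto

lemma idx_le: "idx l i \<le> i"
  unfolding idx_def by (rule Least_le) auto

text \<open>A product of circles over all naturals, hence compact in the product topology.\<close>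

definition torus :: "(nat \<Rightarrow> complex) set" where "torus = {z. \<forall>j. cmod (z j) = 1}"

locale spectral_hankel_pair = hankel_pair +
  fixes f g :: "nat \<Rightarrow> seq" and lam kap :: "nat \<Rightarrow> real"
  assumes f_on: "on_fam N f" and f_eig: "\<And>i. i < N \<Longrightarrow> H (H (f i)) = of_real (lam i) \<odot> f i"
    and g_on: "on_fam N g" and g_eig: "\<And>i. i < N \<Longrightarrow> T (H (T (H (g i)))) = of_real (kap i) \<odot> g i"
begin

text \<open>Coordinates below \<open>N\<close> belong to the eigenvalues of H^2, those from
  \<open>N\<close> on to the eigenvalues of (TH)^2. The conjugation makes \<open>U1\<close> = exp(-i
  t H^2) and \<open>U2\<close> = exp(i t (TH)^2) when each angle is t times its eigenvalue.\<close>

definition p1 :: "(nat \<Rightarrow> complex) \<Rightarrow> nat \<Rightarrow> complex" where "p1 z i = cnj (z (idx lam i))"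
definition p2 :: "(nat \<Rightarrow> complex) \<Rightarrow> nat \<Rightarrow> complex" where "p2 z i = z (N + idx kap i)"
definition U1 :: "(nat \<Rightarrow> complex) \<Rightarrow> seq \<Rightarrow> seq" where "U1 z = dia f (p1 z)"
definition U2 :: "(nat \<Rightarrow> complex) \<Rightarrow> seq \<Rightarrow> seq" where "U2 z = dia g (p2 z)"
definition T' :: "(nat \<Rightarrow> complex) \<Rightarrow> seq \<Rightarrow> seq" where "T' z x = U1 z (U2 z (T x))"
definition H' :: "(nat \<Rightarrow> complex) \<Rightarrow> seq \<Rightarrow> seq" where "H' z x = U1 z (H x)"

lemma p_eq: "lam j = lam i \<Longrightarrow> p1 z j = p1 z i" "kap j = kap i \<Longrightarrow> p2 z j = p2 z i"
  by (simp_all add: p1_def p2_def idx_eq[of lam j i] idx_eq[of kap j i])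

lemma p_cnj: "p1 (\<lambda>j. cnj (z j)) = (\<lambda>i. cnj (p1 z i))" "p2 (\<lambda>j. cnj (z j)) = (\<lambda>i. cnj (p2 z i))"
  by (simp_all add: p1_def p2_def fun_eq_iff)

lemma p_unimodular:
  assumes "z \<in> torus"
  shows "cmod (p1 z i) = 1" "cmod (p2 z i) = 1"
  using assms by (simp_all add: p1_def p2_def torus_def)

lemma U_lin: "semilin id W (U1 z)" "semilin id W (U2 z)"
  unfolding U1_def U2_def by (rule dia_lin[OF f_on] dia_lin[OF g_on])+

lemma U_in [simp]: "U1 z x \<in> W" "U2 z x \<in> W"
  unfolding U1_def U2_def by (rule dia_in[OF f_on] dia_in[OF g_on])+

lemma T'_lin: "semilin id W (T' z)"
  using semilin_comp[OF U_lin(1) semilin_comp[OF U_lin(2) T_lin]] unfolding T'_def by simp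

lemma U1_adj: "x \<in> W \<Longrightarrow> y \<in> W \<Longrightarrow> ip (U1 z x) y = ip x (U1 (\<lambda>j. cnj (z j)) y)"
  unfolding U1_def p_cnj by (rule dia_adjoint[OF f_on])

lemma U2_adj: "x \<in> W \<Longrightarrow> y \<in> W \<Longrightarrow> ip (U2 z x) y = ip x (U2 (\<lambda>j. cnj (z j)) y)"
  unfolding U2_def p_cnj by (rule dia_adjoint[OF g_on])

lemma H_U1: "x \<in> W \<Longrightarrow> H (U1 z x) = U1 (\<lambda>j. cnj (z j)) (H x)"
  unfolding U1_def p_cnj by (rule antilinear_dia[OF f_on H_anti f_eig]) (auto intro: p_eq(1))

lemma K_U2: "x \<in> W \<Longrightarrow> T (H (U2 z x)) = U2 (\<lambda>j. cnj (z j)) (T (H x))"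
  unfolding U2_def p_cnj by (rule antilinear_dia[OF g_on K_anti g_eig]) (auto intro: p_eq(2))

context
  fixes z assumes z: "z \<in> torus"
begin

lemma U_cancel:
  assumes "x \<in> W"
  shows "U1 z (U1 (\<lambda>j. cnj (z j)) x) = x" "U1 (\<lambda>j. cnj (z j)) (U1 z x) = x"
    "U2 z (U2 (\<lambda>j. cnj (z j)) x) = x" "U2 (\<lambda>j. cnj (z j)) (U2 z x) = x"
  unfolding U1_def U2_def p_cnj
  by (rule dia_cancel[OF f_on assms] dia_cancel[OF g_on assms], simp add: p_unimodular[OF z])+

lemma H'_sym:
  assumes "x \<in> W" "y \<in> W"
  shows "ip (H' z x) y = ip (H' z y) x"
  unfolding H'_def using assms H_sym[of x "U1 (\<lambda>j. cnj (z j)) y"] H_U1[of y "\<lambda>j. cnj (z j)"]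
  by (simp add: U1_adj)

lemma U2K_sym:
  assumes "x \<in> W" "y \<in> W"
  shows "ip (U2 z (T (H x))) y = ip (U2 z (T (H y))) x"
  using assms TH_sym[of x "U2 (\<lambda>j. cnj (z j)) y"] K_U2[of y "\<lambda>j. cnj (z j)"]
  by (simp add: U2_adj)

text \<open>Moving the phase through H exhibits \<open>T' H'\<close> as \<open>U1\<close> times
  \<open>U2 T H\<close> times the adjoint of \<open>U1\<close>. Such a congruence keeps an
  antilinear operator symmetric; this is why \<open>T'\<close> carries the same factor
  \<open>U1\<close> as \<open>H'\<close>.\<close>

lemma T'H':
  assumes "x \<in> W"
  shows "T' z (H' z x) = U1 z (U2 z (T (H (U1 (\<lambda>j. cnj (z j)) x))))"
  unfolding T'_def H'_def using H_U1[OF assms, of "\<lambda>j. cnj (z j)"] by simp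

lemma T'H'_sym:
  assumes "x \<in> W" "y \<in> W"
  shows "ip (T' z (H' z x)) y = ip (T' z (H' z y)) x"
  using assms U2K_sym[of "U1 (\<lambda>j. cnj (z j)) x" "U1 (\<lambda>j. cnj (z j)) y"]
  by (simp add: T'H' U1_adj)

text \<open>The phases are unitary and stand to the left of T, so the defect vector \<open>e\<close>
  does not move.\<close>

lemma T'_defect:
  assumes "x \<in> W" "y \<in> W"
  shows "ip (T' z x) (T' z y) = ip x y - ip x e * cnj (ip y e)"
proof -
  have "ip (T' z x) (T' z y) = ip (U2 z (T x)) (U2 z (T y))"
    unfolding T'_def U1_def by (rule dia_isometry[OF f_on]) (simp_all add: p_unimodular[OF z])
  also have "\<dots> = ip (T x) (T y)"
    unfolding U2_def by (rule dia_isometry[OF g_on]) (simp_all add: p_unimodular[OF z] assms)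
  also have "\<dots> = ip x y - ip x e * cnj (ip y e)" by (rule T_defect[OF assms])
  finally show ?thesis .
qed

lemma H'H': "x \<in> W \<Longrightarrow> H' z (H' z x) = H (H x)"
  unfolding H'_def by (simp add: H_U1 U_cancel)

text \<open>An eigenspace of \<open>T'\<close> for a unimodular eigenvalue is orthogonal to \<open>e\<close>, hence invariant under
  \<open>H'\<close>; an eigenvector of \<open>H\<^sup>2\<close> in it is a common eigenvector of the phases and therefore an
  eigenvector of \<open>T\<close>.\<close>
lemma T'_stable:
  assumes x0: "x0 \<in> W" "T' z x0 = c \<odot> x0" "cmod c = 1"
  shows "x0 = 0"
proof (rule ccontr)
  assume nz: "x0 \<noteq> 0"
  have cc: "cnj c * c = 1" using x0(3) complex_norm_square[of c] by (simp add: mult.commute)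
  define F where "F = {x\<in>W. T' z x = c \<odot> x}"
  have FW: "F \<subseteq> W" by (auto simp: F_def)
  have F: "subsp F"
  proof -
    have "0 \<in> F" using semilinD(3)[OF T'_lin[of z] W0, of 0] by (simp add: F_def)
    moreover have "x + y \<in> F" if "x \<in> F" "y \<in> F" for x y
      using that semilinD(2)[OF T'_lin[of z]] by (simp add: F_def scl_add)
    moreover have "a \<odot> x \<in> F" if "x \<in> F" for a x
      using that semilinD(3)[OF T'_lin[of z]] by (simp add: F_def mult.commute)
    ultimately show ?thesis by (simp add: subsp_def)
  qed
  have orth: "ip x e = 0" if "x \<in> F" for x
  proof -
    have x: "x \<in> W" "T' z x = c \<odot> x" using that by (auto simp: F_def)
    have "(cnj c * c) * ip x x = ip x x - ip x e * cnj (ip x e)"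
      using T'_defect[OF x(1) x(1)] x(1) unfolding x(2) by (simp add: ip_scl ip_scl2 mult_ac)
    then show ?thesis unfolding cc by simp
  qed
  \<comment> \<open>On \<open>F\<close> one has x = \<open>cnj c \<odot> T' z x\<close>. Symmetry of
    \<open>T' H'\<close> then places a \<open>T'\<close> on both sides of the inner product, and
    \<open>T'_defect\<close> removes both because x is orthogonal to \<open>e\<close>.\<close>
  have H'F: "H' z x \<in> F" if xF: "x \<in> F" for x
  proof -
    have x: "x \<in> W" "T' z x = c \<odot> x" using xF by (auto simp: F_def)
    have H'W: "H' z y \<in> W" for y by (simp add: H'_def)
    have x_eq: "x = cnj c \<odot> T' z x" unfolding x(2) using cc by simp
    have "T' z (H' z x) = c \<odot> H' z x"
    proof (rule ip_eqI)
      fix y assume y: "y \<in> W"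
      have "ip (T' z (H' z x)) y = ip (T' z (H' z y)) x" by (rule T'H'_sym[OF x(1) y])
      also have "\<dots> = ip (T' z (H' z y)) (cnj c \<odot> T' z x)" using x_eq by (rule arg_cong)
      also have "\<dots> = c * ip (T' z (H' z y)) (T' z x)"
        using semilinD(1)[OF T'_lin] H'W x(1) by (simp add: ip_scl2)
      also have "\<dots> = c * ip (H' z y) x" using T'_defect[OF H'W[of y] x(1)] orth[OF xF] by simp
      also have "\<dots> = ip (c \<odot> H' z x) y" using H'_sym[OF x(1) y] H'W y by (simp add: ip_scl)
      finally show "ip (T' z (H' z x)) y = ip (c \<odot> H' z x) y" .
    qed (use semilinD(1)[OF T'_lin] H'W in auto)
    then show ?thesis using H'W by (simp add: F_def)
  qed
  have "H (H x) \<in> F" if "x \<in> F" for x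
  proof -
    have "H' z (H' z x) \<in> F" by (intro H'F that)
    then show ?thesis using H'H'[of x] that FW by auto
  qed
  then have "semilin id F (\<lambda>x. H (H x))" by (rule semilin_subset[OF H_lin2 FW])
  moreover have "x0 \<in> F" using x0 by (simp add: F_def)
  ultimately obtain m x where xF: "x \<in> F" and xn: "x \<noteq> 0" and xm: "H (H x) = m \<odot> x"
    using exists_eigenvector[OF F FW _ _ nz] by blast
  have x: "x \<in> W" using xF FW by blast
  obtain i where i: "i < N"
    "\<And>p. (\<forall>j<N. lam j = lam i \<longrightarrow> p j = p i) \<Longrightarrow> dia f p x = p i \<odot> x"
    using eigenvector_phase[OF f_on H_lin2 f_eig x xn xm] by blast
  define zc where "zc = (\<lambda>j. cnj (z j))"
  have U1x: "U1 zc x = p1 zc i \<odot> x" unfolding U1_def using p_eq(1) by (intro i(2)) blast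
  have zc: "zc \<in> torus" using z by (simp add: zc_def torus_def)
  \<comment> \<open>\<open>H' z x\<close> lies in \<open>F\<close>, so it is orthogonal to
    \<open>e\<close>; symmetry and the scalar action of \<open>U1\<close> on x turn this into (x|u)
    = 0. By \<open>K2_eq\<close> x is then also an eigenvector of (TH)^2, so \<open>U2\<close> acts
    on it by a scalar too.\<close>
  have "ip (H' z x) e = 0" by (rule orth[OF H'F[OF xF]])
  then have "ip (U1 z u) x = 0" using H'_sym[OF x e_in] by (simp add: H'_def u_def)
  then have "ip u (U1 zc x) = 0" using x by (simp add: U1_adj zc_def)
  then have "cnj (p1 zc i) * ip u x = 0" unfolding U1x using x by (simp add: ip_scl2)
  then have "ip u x = 0" using p_unimodular(1)[OF zc, of i] by auto
  then have "ip x u = 0" using ip_cnj[of u x] x by simp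
  then have Kx: "T (H (T (H x))) = m \<odot> x" unfolding K2_eq[OF x] xm by simp
  obtain l where l: "l < N"
    "\<And>p. (\<forall>j<N. kap j = kap l \<longrightarrow> p j = p l) \<Longrightarrow> dia g p x = p l \<odot> x"
    using eigenvector_phase[OF g_on K_lin2 g_eig x xn Kx] by blast
  have U2x: "U2 zc x = p2 zc l \<odot> x" unfolding U2_def using p_eq(2) by (intro l(2)) blast
  have "T x = U2 zc (U1 zc (T' z x))" unfolding T'_def zc_def using x by (simp add: U_cancel)
  also have "\<dots> = U2 zc (U1 zc (c \<odot> x))" using xF by (simp add: F_def)
  also have "\<dots> = (c * p1 zc i * p2 zc l) \<odot> x"
    using x semilinD(3)[OF U_lin(1)] semilinD(3)[OF U_lin(2)] by (simp add: U1x U2x mult_ac)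
  finally have "x = 0"
    by (rule T_stable[OF x]) (simp add: norm_mult x0(3) p_unimodular[OF zc])
  then show False using xn by blast
qed

lemma deformed_hankel_pair: "hankel_pair W ip N b (T' z) (H' z) e"
proof unfold_locales
  show "semilin id W (T' z)" by (rule T'_lin)
  show "semilin cnj W (H' z)" using semilin_comp[OF U_lin(1) H_anti] unfolding H'_def by simp
  show "e \<in> W" by simp
  show "\<exists>y\<in>W. H' z y = x" if x: "x \<in> W" for x
  proof -
    obtain y where y: "y \<in> W" "H y = U1 (\<lambda>j. cnj (z j)) x" using H_surj[of "U1 (\<lambda>j. cnj (z j)) x"] by auto
    have "H' z y = x" unfolding H'_def y(2) by (rule U_cancel(1)[OF x])
    then show ?thesis using y(1) by blast
  qed
qed (fact H'_sym T'H'_sym T'_defect T'_stable)+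

text \<open>\<open>K2_eq\<close> conjugated by \<open>U1\<close>: this phase commutes with H^2, so
  only u is replaced by \<open>U1 z u\<close>.\<close>

lemma generator_rank_one:
  assumes "y \<in> W"
  shows "H (H y) - U1 z (T (H (T (H (U1 (\<lambda>j. cnj (z j)) y))))) = ip y (U1 z u) \<odot> U1 z u"
proof -
  define zc where "zc = (\<lambda>j. cnj (z j))"
  have zcc: "(\<lambda>j. cnj (zc j)) = z" by (simp add: zc_def)
  have 1: "U1 z (H (H (U1 zc y))) = H (H y)"
    using H_U1[OF assms, of zc] H_U1[of "H y" z] assms U_cancel(1)[of "H (H y)"] unfolding zcc
    by (simp add: zc_def)
  have 2: "ip (U1 zc y) u = ip y (U1 z u)" using U1_adj[OF assms u_in, of zc] unfolding zcc .
  have "U1 z (T (H (T (H (U1 zc y))))) = U1 z (H (H (U1 zc y)) + (- ip (U1 zc y) u) \<odot> u)"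
    unfolding K2_eq[OF U_in(1)] by simp
  also have "\<dots> = H (H y) + (- ip y (U1 z u)) \<odot> U1 z u"
    using semilinD(2,3)[OF U_lin(1)] by (simp only: 1 2 W_scl u_in H_in U_in id_apply)
  finally show ?thesis unfolding zc_def by simp
qed

end

end

section \<open>Uniform decay over the torus\<close>

lemma compact_fun_Pi:
  assumes "\<And>i. compact (S i)"
  shows "compact {c :: 'i \<Rightarrow> 'a::topological_space. \<forall>i. c i \<in> S i}"
proof -
  have "compactin (product_topology (\<lambda>_. euclidean) UNIV) (PiE UNIV S)"
    using assms by (subst compactin_PiE) (auto simp: compactin_euclidean_iff)
  moreover have "PiE UNIV S = {c. \<forall>i. c i \<in> S i}" by (auto simp: PiE_def)
  ultimately show ?thesis by (simp add: euclidean_product_topology compactin_euclidean_iff)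
qed

lemma compact_torus: "compact torus"
proof -
  have "torus = {z. \<forall>j. z j \<in> sphere 0 1}" by (auto simp: torus_def)
  then show ?thesis using compact_fun_Pi[OF compact_sphere, of "\<lambda>_::nat. 0 :: complex" "\<lambda>_. 1"] by (simp only:)
qed

text \<open>\<open>r\<close> is the 2m-th root of q, with the 2 coming from the square on the right;
  the factor 1 / r^m pays for the k mod m steps outside complete blocks.\<close>

lemma power_mono_div:
  fixes q :: real
  assumes "0 < q" "q < 1" "0 < m"
  shows "\<exists>C r. 0 \<le> C \<and> 0 \<le> r \<and> r < 1 \<and> (\<forall>k. q ^ (k div m) \<le> (C * r ^ k)\<^sup>2)"
proof -
  define r where "r = root (2 * m) q"
  have r: "0 < r" "r < 1" "r ^ (2 * m) = q"
    using assms unfolding r_def by (auto simp: real_root_lt_1_iff)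
  have "q ^ (k div m) \<le> (1 / r ^ m * r ^ k)\<^sup>2" for k
  proof -
    have "q ^ (k div m) * r ^ (2 * m) \<le> q ^ (k div m) * r ^ (2 * (k mod m))"
      using r assms by (intro mult_left_mono power_decreasing) (auto simp: mod_le_divisor less_imp_le)
    also have "\<dots> = r ^ (2 * m * (k div m) + 2 * (k mod m))"
      unfolding r(3)[symmetric] by (simp add: power_add power_mult[symmetric])
    also have "2 * m * (k div m) + 2 * (k mod m) = 2 * k"
      by (metis add_mult_distrib2 mult.assoc mult_div_mod_eq)
    finally show ?thesis using r(1)
      by (simp add: field_simps power_mult power2_eq_square power_mult_distrib)
  qed
  then show ?thesis using r(1,2) by (intro exI[of _ "1 / r ^ m"] exI[of _ r]) auto
qed

context fin_ip
begin

text \<open>The parameter enters \<open>A\<close> through finitely many scalar coefficients, so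
  continuity is stated for matrix coefficients. Expanding the outermost \<open>A\<close> replaces y
  by the vectors \<open>w s\<close>, hence y is generalised in the induction.\<close>

lemma continuous_ip_pow:
  fixes A :: "'z::topological_space \<Rightarrow> seq \<Rightarrow> seq"
  assumes S: "finite S" and a: "\<And>s. s \<in> S \<Longrightarrow> continuous_on UNIV (a s)"
    and w: "\<And>s. s \<in> S \<Longrightarrow> w s \<in> W" and v: "\<And>s. s \<in> S \<Longrightarrow> v s \<in> W"
    and A: "\<And>z x. x \<in> W \<Longrightarrow> A z x = (\<Sum>s\<in>S. (a s z * ip x (w s)) \<odot> v s)"
    and x: "x \<in> W" and y: "y \<in> W"
  shows "continuous_on UNIV (\<lambda>z. ip ((A z ^^ k) x) y)"
  using y
proof (induction k arbitrary: y)
  case 0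
  show ?case by simp
next
  case (Suc k)
  have Ain: "(A z ^^ k) x \<in> W" for z
    by (induction k) (auto simp: x A intro!: W_sum W_scl v)
  have "ip ((A z ^^ Suc k) x) y = (\<Sum>s\<in>S. (a s z * ip ((A z ^^ k) x) (w s)) * ip (v s) y)" for z
  proof -
    have "(A z ^^ Suc k) x = (\<Sum>s\<in>S. (a s z * ip ((A z ^^ k) x) (w s)) \<odot> v s)"
      using A[OF Ain] by simp
    then show ?thesis using Suc.prems by (simp only:) (subst ip_sum, auto intro!: sum.cong simp: v ip_scl)
  qed
  moreover have "continuous_on UNIV (\<lambda>z. \<Sum>s\<in>S. (a s z * ip ((A z ^^ k) x) (w s)) * ip (v s) y)"
    by (intro continuous_on_sum continuous_on_mult continuous_on_const a Suc.IH w)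
  ultimately show ?case by simp
qed

lemma ip_lin_exp:
  assumes "semilin id W B" "e \<in> W"
  shows "ip (B (\<Sum>i<N. c i \<odot> b i)) e = (\<Sum>i<N. c i * ip (B (b i)) e)"
proof -
  have "B (\<Sum>i<N. c i \<odot> b i) = (\<Sum>i<N. B (c i \<odot> b i))"
    by (rule semilin_sum[OF assms(1) W_subsp]) (auto simp: b_in)
  also have "\<dots> = (\<Sum>i<N. c i \<odot> B (b i))"
    by (intro sum.cong refl) (simp add: semilinD(3)[OF assms(1)] b_in)
  finally show ?thesis
    by (simp only:) (subst ip_sum, auto intro!: sum.cong simp: b_in semilinD(1)[OF assms(1)] ip_scl assms)
qed

lemma nsq_comb:
  shows "nsq (\<Sum>i<N. c i \<odot> b i) = (\<Sum>i<N. (cmod (c i))\<^sup>2)"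
proof -
  have W: "(\<Sum>i<N. c i \<odot> b i) \<in> W" by (auto simp: b_in)
  have "ip (\<Sum>i<N. c i \<odot> b i) (b j) = c j" if "j < N" for j
    using that by (subst ip_sum) (auto simp: b_in ip_scl b_on if_distrib[of "\<lambda>x. _ * x"] cong: if_cong)
  then show ?thesis
    using nsq_parseval[OF on_fam_b W proj_b[OF W, symmetric]] by simp
qed

text \<open>Compactness of torus times unit sphere turns observability into a uniform contraction
  of some power.\<close>
lemma uniform_contraction:
  fixes A :: "'z::topological_space \<Rightarrow> seq \<Rightarrow> seq"
  assumes Z: "compact Z" and lin: "\<And>z. semilin id W (A z)" and e: "e \<in> W"
    and cont: "\<And>k x. x \<in> W \<Longrightarrow> continuous_on UNIV (\<lambda>z. ip ((A z ^^ k) x) e)"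
    and defect: "\<And>z x. z \<in> Z \<Longrightarrow> x \<in> W \<Longrightarrow> nsq (A z x) = nsq x - (cmod (ip x e))\<^sup>2"
    and obs: "\<And>z x. z \<in> Z \<Longrightarrow> x \<in> W \<Longrightarrow> (\<And>k. ip ((A z ^^ k) x) e = 0) \<Longrightarrow> x = 0"
  shows "\<exists>q m. 0 < q \<and> q < 1 \<and> 0 < m \<and> (\<forall>z\<in>Z. \<forall>x\<in>W. nsq ((A z ^^ m) x) \<le> q * nsq x)"
proof -
  \<comment> \<open>The unit sphere of \<open>W\<close> in coordinates over \<open>b\<close>;
    bounding every entry by 1 makes \<open>B\<close> a closed part of a compact product.\<close>
  define B where "B = {c :: nat \<Rightarrow> complex. \<forall>i. c i \<in> cball 0 1} \<inter> {c. (\<Sum>i<N. (cmod (c i))\<^sup>2) = 1}"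
  have coord: "continuous_on UNIV (\<lambda>c :: nat \<Rightarrow> complex. c i)" for i
    by (rule continuous_on_product_coordinates)
  have "continuous_on UNIV (\<lambda>c :: nat \<Rightarrow> complex. \<Sum>i<N. (cmod (c i))\<^sup>2)"
    by (intro continuous_on_sum continuous_on_power continuous_on_norm coord)
  then have "closed {c :: nat \<Rightarrow> complex. (\<Sum>i<N. (cmod (c i))\<^sup>2) = 1}"
    by (rule closed_Collect_eq) (rule continuous_on_const)
  then have cB: "compact B" unfolding B_def
    by (rule compact_Int_closed[OF compact_fun_Pi[OF compact_cball]])
  define G where "G j p = (\<Sum>i<N. snd p i * ip ((A (fst p) ^^ j) (b i)) e)" for j p
  have cG: "continuous_on UNIV (G j)" for j
    unfolding G_def
  proof (intro continuous_on_sum continuous_on_mult)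
    show "continuous_on UNIV (\<lambda>p :: 'z \<times> (nat \<Rightarrow> complex). snd p i)" for i
      by (rule continuous_on_compose2[OF coord continuous_on_snd[OF continuous_on_id]]) simp
    show "continuous_on UNIV (\<lambda>p :: 'z \<times> (nat \<Rightarrow> complex). ip ((A (fst p) ^^ j) (b i)) e)" if "i \<in> {..<N}" for i
      using that by (intro continuous_on_compose2[OF cont[OF b_in] continuous_on_fst[OF continuous_on_id]]) auto
  qed
  define x where "x c = (\<Sum>i<N. c i \<odot> b i)" for c
  have xW: "x c \<in> W" for c unfolding x_def by (auto simp: b_in)
  have Gx: "G j (z, c) = ip ((A z ^^ j) (x c)) e" for j z c
    unfolding G_def x_def fst_conv snd_conv by (rule ip_lin_exp[OF semilin_pow[OF lin] e, symmetric])
  have Apow: "(A z ^^ k) y \<in> W" if "y \<in> W" for z k y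
    by (rule semilinD(1)[OF semilin_pow[OF lin] that])
  have pow: "nsq ((A z ^^ k) y) = nsq y - (\<Sum>j<k. (cmod (ip ((A z ^^ j) y) e))\<^sup>2)"
    if "z \<in> Z" "y \<in> W" for z y k
    using that by (induction k) (auto simp: defect Apow)
  have scale: "\<exists>c\<in>B. \<exists>a. y = a \<odot> x c" if y: "y \<in> W" "y \<noteq> 0" for y
  proof -
    have ny: "nsq y > 0" using ip_pos[OF y] by (simp add: nsq_def)
    define c where "c i = (if i < N then ip y (b i) / of_real (sqrt (nsq y)) else 0)" for i
    have sq: "(\<Sum>i<N. (cmod (ip y (b i)))\<^sup>2) = nsq y"
      using nsq_parseval[OF on_fam_b y(1) proj_b[OF y(1), symmetric]] by simp
    have "(\<Sum>i<N. (cmod (c i))\<^sup>2) = (\<Sum>i<N. (cmod (ip y (b i)))\<^sup>2 / nsq y)"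
      using ny by (intro sum.cong) (auto simp: c_def norm_divide power_divide)
    also have "\<dots> = 1" using ny by (simp add: sum_divide_distrib[symmetric] sq)
    finally have c1: "(\<Sum>i<N. (cmod (c i))\<^sup>2) = 1" .
    have "cmod (c i) \<le> 1" for i
    proof (cases "i < N")
      case True
      then have "(cmod (c i))\<^sup>2 \<le> (\<Sum>i<N. (cmod (c i))\<^sup>2)" by (intro member_le_sum) auto
      then show ?thesis using c1 power2_le_imp_le[of "cmod (c i)" 1] by simp
    qed (simp add: c_def)
    then have "c \<in> B" using c1 by (simp add: B_def)
    moreover have "y = of_real (sqrt (nsq y)) \<odot> x c"
    proof -
      have "of_real (sqrt (nsq y)) \<odot> x c = (\<Sum>i<N. ip y (b i) \<odot> b i)"
        unfolding x_def scl_sum using ny by (intro sum.cong refl) (simp add: c_def)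
      then show ?thesis by (rule trans[OF b_exp[OF y(1)] sym])
    qed
    ultimately show ?thesis by blast
  qed
  have nx: "nsq (x c) = 1" if "c \<in> B" for c
    using that nsq_comb[of c] unfolding x_def B_def by simp
  show ?thesis
  proof (cases "Z \<times> B = {}")
    case True
    have "nsq ((A z ^^ 1) y) \<le> 1 / 2 * nsq y" if "z \<in> Z" "y \<in> W" for z y
    proof -
      have y0: "y = 0" using True scale[OF that(2)] that(1) by blast
      show ?thesis using pow[OF that, where k = 1] that nsq_nonneg[OF Apow[OF that(2), where z = z and k = 1]] unfolding y0
        by (simp add: nsq_def)
    qed
    then show ?thesis by (intro exI[of _ "1/2"] exI[of _ 1]) auto
  next
    case False
    have cZB: "compact (Z \<times> B)" by (rule compact_Times[OF Z cB])
    \<comment> \<open>Finite intersection property: if no m served all points, the closed conditions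
      \<open>G j p = 0\<close> would have a common solution, that is, an unobservable unit
      vector.\<close>
    have "\<exists>m. \<forall>p\<in>Z \<times> B. \<exists>j<m. G j p \<noteq> 0"
    proof (rule ccontr)
      assume no: "\<not> ?thesis"
      have "(Z \<times> B) \<inter> (\<Inter>j\<in>UNIV. {p. G j p = 0}) \<noteq> {}"
      proof (rule compact_imp_fip_image[OF cZB])
        show "closed {p. G j p = 0}" for j by (intro closed_Collect_eq cG continuous_on_const)
        fix I :: "nat set" assume I: "finite I" "I \<subseteq> UNIV"
        obtain p where p: "p \<in> Z \<times> B" "\<forall>j<Suc (Max (insert 0 I)). G j p = 0" using no by blast
        have "G j p = 0" if "j \<in> I" for j
          using p(2) I that by (auto simp: less_Suc_eq_le)
        then show "(Z \<times> B) \<inter> (\<Inter>j\<in>I. {p. G j p = 0}) \<noteq> {}" using p(1) by blast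
      qed
      then obtain z c where zc: "z \<in> Z" "c \<in> B" "\<And>j. G j (z, c) = 0" by auto
      have "x c = 0" using obs[OF zc(1) xW] zc(3) unfolding Gx by blast
      then show False using nx[OF zc(2)] by (simp add: nsq_def)
    qed
    then obtain m where m: "\<And>p. p \<in> Z \<times> B \<Longrightarrow> \<exists>j<m. G j p \<noteq> 0" by blast
    have m0: "0 < m" using m False by fastforce
    define \<phi> where "\<phi> p = (\<Sum>j<m. (cmod (G j p))\<^sup>2)" for p
    have "continuous_on (Z \<times> B) \<phi>" unfolding \<phi>_def
      by (intro continuous_on_sum continuous_on_power continuous_on_norm continuous_on_subset[OF cG]) simp
    then obtain p0 where p0: "p0 \<in> Z \<times> B" "\<And>p. p \<in> Z \<times> B \<Longrightarrow> \<phi> p0 \<le> \<phi> p"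
      using continuous_attains_inf[OF cZB False] by blast
    have "\<phi> p0 > 0"
    proof -
      obtain j where "j < m" "G j p0 \<noteq> 0" using m[OF p0(1)] by blast
      then show ?thesis unfolding \<phi>_def by (intro sum_pos2[of _ j]) auto
    qed
    \<comment> \<open>Over m steps a unit vector loses at least \<open>\<phi> p0\<close>; the
      maximum with 1/2 keeps q positive for the root taken in \<open>power_mono_div\<close>.\<close>
    define q where "q = max (1 - \<phi> p0) (1 / 2)"
    have q: "0 < q" "q < 1" using \<open>\<phi> p0 > 0\<close> by (auto simp: q_def)
    have main: "nsq ((A z ^^ m) y) \<le> q * nsq y" if z: "z \<in> Z" and y: "y \<in> W" for z y
    proof (cases "y = 0")
      case True
      show ?thesis using pow[OF z W0, where k = m] nsq_nonneg[OF Apow[OF W0, where z = z and k = m]]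
        sum_nonneg[of "{..<m}" "\<lambda>j. (cmod (ip ((A z ^^ j) 0) e))\<^sup>2"] unfolding True by (simp add: nsq_def)
    next
      case False
      obtain c a where c: "c \<in> B" "y = a \<odot> x c" using scale[OF y False] by blast
      have "nsq ((A z ^^ m) (x c)) = 1 - \<phi> (z, c)"
        using pow[OF z xW[of c], where k = m] nx[OF c(1)] by (simp add: \<phi>_def Gx)
      also have "\<dots> \<le> q" using p0(2)[of "(z, c)"] z c(1) by (auto simp: q_def)
      finally have "(cmod a)\<^sup>2 * nsq ((A z ^^ m) (x c)) \<le> (cmod a)\<^sup>2 * q" by (rule mult_left_mono) simp
      moreover have "nsq ((A z ^^ m) y) = (cmod a)\<^sup>2 * nsq ((A z ^^ m) (x c))"
        unfolding c(2) using semilinD(3)[OF semilin_pow[OF lin] xW] nsq_scl[OF Apow[OF xW]] by simp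
      moreover have "nsq y = (cmod a)\<^sup>2" unfolding c(2) using nsq_scl[OF xW] nx[OF c(1)] by simp
      ultimately show ?thesis by (simp add: mult.commute)
    qed
    then show ?thesis using q m0 by blast
  qed
qed

lemma uniform_decay:
  fixes A :: "'z::topological_space \<Rightarrow> seq \<Rightarrow> seq"
  assumes Z: "compact Z" and lin: "\<And>z. semilin id W (A z)" and e: "e \<in> W"
    and cont: "\<And>k x. x \<in> W \<Longrightarrow> continuous_on UNIV (\<lambda>z. ip ((A z ^^ k) x) e)"
    and defect: "\<And>z x. z \<in> Z \<Longrightarrow> x \<in> W \<Longrightarrow> nsq (A z x) = nsq x - (cmod (ip x e))\<^sup>2"
    and obs: "\<And>z x. z \<in> Z \<Longrightarrow> x \<in> W \<Longrightarrow> (\<And>k. ip ((A z ^^ k) x) e = 0) \<Longrightarrow> x = 0"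
  shows "\<exists>C r. 0 \<le> C \<and> 0 \<le> r \<and> r < 1 \<and>
    (\<forall>z\<in>Z. \<forall>x\<in>W. \<forall>k. nsq ((A z ^^ k) x) \<le> (C * r ^ k)\<^sup>2 * nsq x)"
proof -
  obtain q m where qm: "0 < q" "q < 1" "0 < m"
    and con: "\<And>z x. z \<in> Z \<Longrightarrow> x \<in> W \<Longrightarrow> nsq ((A z ^^ m) x) \<le> q * nsq x"
  proof -
    have "\<exists>q m. 0 < q \<and> q < 1 \<and> 0 < m \<and> (\<forall>z\<in>Z. \<forall>x\<in>W. nsq ((A z ^^ m) x) \<le> q * nsq x)"
      by (rule uniform_contraction) (fact assms)+
    then show ?thesis using that by blast
  qed
  have Apow: "(A z ^^ k) y \<in> W" if "y \<in> W" for z k y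
    by (rule semilinD(1)[OF semilin_pow[OF lin] that])
  have dec: "nsq ((A z ^^ k) x) \<le> nsq x" if "z \<in> Z" "x \<in> W" for z x k
  proof (induction k)
    case (Suc k)
    have "nsq ((A z ^^ Suc k) x) \<le> nsq ((A z ^^ k) x)"
      using defect[OF that(1) Apow[OF that(2)]] by simp
    then show ?case using Suc by (rule order_trans)
  qed simp
  have mult: "nsq ((A z ^^ (m * k)) x) \<le> q ^ k * nsq x" if "z \<in> Z" "x \<in> W" for z x k
  proof (induction k)
    case (Suc k)
    have "(A z ^^ (m * Suc k)) x = (A z ^^ m) ((A z ^^ (m * k)) x)" by (simp add: funpow_add)
    then have "nsq ((A z ^^ (m * Suc k)) x) \<le> q * nsq ((A z ^^ (m * k)) x)"
      using con[OF that(1) Apow[OF that(2)]] by simp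
    also have "\<dots> \<le> q * (q ^ k * nsq x)" using Suc qm by (intro mult_left_mono) auto
    finally show ?case by (simp add: mult.assoc)
  qed simp
  obtain C r where Cr: "0 \<le> C" "0 \<le> r" "r < 1" "\<And>k. q ^ (k div m) \<le> (C * r ^ k)\<^sup>2"
    using power_mono_div[OF qm] by blast
  have "nsq ((A z ^^ k) x) \<le> (C * r ^ k)\<^sup>2 * nsq x" if "z \<in> Z" "x \<in> W" for z x k
  proof -
    have "(A z ^^ k) x = (A z ^^ (k mod m)) ((A z ^^ (m * (k div m))) x)"
      by (metis comp_apply funpow_add mod_mult_div_eq)
    then have "nsq ((A z ^^ k) x) \<le> nsq ((A z ^^ (m * (k div m))) x)"
      using dec[OF that(1) Apow[OF that(2)]] by simp
    also have "\<dots> \<le> q ^ (k div m) * nsq x" by (rule mult[OF that])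
    also have "\<dots> \<le> (C * r ^ k)\<^sup>2 * nsq x" using Cr(4) that by (intro mult_right_mono) auto
    finally show ?thesis .
  qed
  then show ?thesis using Cr(1-3) by blast
qed

end

context spectral_hankel_pair
begin

text \<open>The adjoint of T applied to \<open>g l\<close>. With it \<open>U1 U2 T\<close> becomes a
  finite sum of fixed rank-one operators weighted by phases, the form that
  \<open>continuous_ip_pow\<close> and \<open>phase_family\<close> expect.\<close>

definition w :: "nat \<Rightarrow> seq" where
  "w l = (SOME a. a \<in> W \<and> (\<forall>x\<in>W. ip (T x) (g l) = ip x a))"

lemma w:
  assumes "l < N"
  shows "w l \<in> W" "x \<in> W \<Longrightarrow> ip (T x) (g l) = ip x (w l)"
proof -
  have "\<exists>a. a \<in> W \<and> (\<forall>x\<in>W. ip (T x) (g l) = ip x a)"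
    using Tpow_adjoint[OF on_famD[OF g_on assms], where k = 1] by auto
  from someI_ex[OF this] show "w l \<in> W" "x \<in> W \<Longrightarrow> ip (T x) (g l) = ip x (w l)"
    unfolding w_def[symmetric] by blast+
qed

lemma dia_rank_one_sum:
  assumes x: "x \<in> W"
  shows "dia f p (dia g q (T x)) =
    (\<Sum>s\<in>{..<N} \<times> {..<N}. (p (fst s) * q (snd s) * ip (g (snd s)) (f (fst s)) * ip x (w (snd s))) \<odot> f (fst s))"
proof -
  have fW: "\<And>i. i < N \<Longrightarrow> f i \<in> W" and gW: "\<And>i. i < N \<Longrightarrow> g i \<in> W"
    using f_on g_on by (auto intro: on_famD)
  have "p i * ip (dia g q (T x)) (f i) = (\<Sum>l<N. p i * q l * ip (g l) (f i) * ip x (w l))"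
    if i: "i < N" for i
    unfolding dia_def
    by (subst ip_sum) (auto intro!: sum.cong simp: gW fW i ip_scl w x sum_distrib_left)
  then have "dia f p (dia g q (T x)) = (\<Sum>i<N. (\<Sum>l<N. p i * q l * ip (g l) (f i) * ip x (w l)) \<odot> f i)"
    unfolding dia_def[of f] by (intro sum.cong) auto
  also have "\<dots> = (\<Sum>i<N. \<Sum>l<N. (p i * q l * ip (g l) (f i) * ip x (w l)) \<odot> f i)"
    by (simp add: seqvs.scale_sum_left)
  finally show ?thesis by (simp add: sum.cartesian_product case_prod_unfold)
qed

lemma T'_uniform_decay:
  "\<exists>C r. 0 \<le> C \<and> 0 \<le> r \<and> r < 1 \<and> (\<forall>z\<in>torus. decaying_hankel_pair W ip N b (T' z) (H' z) e C r)"
proof -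
  have cont: "continuous_on UNIV (\<lambda>z. ip ((T' z ^^ k) x) e)" if "x \<in> W" for k x
  proof (rule continuous_ip_pow[OF _ _ _ _ _ that e_in])
    show "finite ({..<N} \<times> {..<N})" by simp
    show "continuous_on UNIV (\<lambda>z. p1 z (fst s) * p2 z (snd s) * ip (g (snd s)) (f (fst s)))" for s
      unfolding p1_def p2_def
      by (intro continuous_on_mult continuous_on_const continuous_on_cnj continuous_on_product_coordinates)
    show "T' z x = (\<Sum>s\<in>{..<N} \<times> {..<N}. (p1 z (fst s) * p2 z (snd s) * ip (g (snd s)) (f (fst s)) * ip x (w (snd s))) \<odot> f (fst s))"
      if "x \<in> W" for z x
      unfolding T'_def U1_def U2_def by (rule dia_rank_one_sum[OF that])
    show "w (snd s) \<in> W" if "s \<in> {..<N} \<times> {..<N}" for s using w(1) that by auto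
    show "f (fst s) \<in> W" if "s \<in> {..<N} \<times> {..<N}" for s using on_famD[OF f_on] that by auto
  qed
  have "\<exists>C r. 0 \<le> C \<and> 0 \<le> r \<and> r < 1 \<and>
    (\<forall>z\<in>torus. \<forall>x\<in>W. \<forall>k. nsq ((T' z ^^ k) x) \<le> (C * r ^ k)\<^sup>2 * nsq x)"
  proof (rule uniform_decay[OF compact_torus T'_lin e_in cont])
    fix z x assume z: "z \<in> torus" and x: "x \<in> W"
    interpret D: hankel_pair W ip N b "T' z" "H' z" e by (rule deformed_hankel_pair[OF z])
    show "nsq (T' z x) = nsq x - (cmod (ip x e))\<^sup>2" by (rule D.nsq_T[OF x])
    show "x = 0" if "\<And>k. ip ((T' z ^^ k) x) e = 0"
      using D.observable[OF x] that unfolding D.J_def by blast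
  qed
  then show ?thesis
    unfolding decaying_hankel_pair_def decaying_hankel_pair_axioms_def
    using deformed_hankel_pair by blast
qed

end

section \<open>Smooth families\<close>

definition dot :: "nat \<Rightarrow> (nat \<Rightarrow> real) \<Rightarrow> (nat \<Rightarrow> real) \<Rightarrow> real" where
  "dot n m \<theta> = (\<Sum>j<n. m j * \<theta> j)"

lemma dot_line: "dot n m (\<lambda>j. \<theta> j + t * h j) = dot n m \<theta> + t * dot n m h"
  by (simp add: dot_def sum.distrib[symmetric] sum_distrib_left algebra_simps)

lemma cis_line_derivative:
  "((\<lambda>t. cis (dot n m (\<lambda>j. \<theta> j + t * h j))) has_vector_derivative
     \<i> * of_real (dot n m h) * cis (dot n m (\<lambda>j. \<theta> j + t * h j))) (at t)"
proof -
  have "((\<lambda>z. exp (\<i> * (of_real (dot n m \<theta>) + z * of_real (dot n m h)))) has_field_derivative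
      \<i> * of_real (dot n m h) * exp (\<i> * (of_real (dot n m \<theta>) + of_real t * of_real (dot n m h))))
      (at (of_real t))"
    by (auto intro!: derivative_eq_intros)
  from has_vector_derivative_real_field[OF this] show ?thesis
    by (simp add: dot_line cis_conv_exp)
qed

lemma norm_diff_le_of_derivative:
  fixes F :: "real \<Rightarrow> complex"
  assumes "\<And>t. t \<in> closed_segment 0 x \<Longrightarrow> (F has_vector_derivative F' t) (at t)"
    and "\<And>t. t \<in> closed_segment 0 x \<Longrightarrow> norm (F' t) \<le> B"
  shows "norm (F x - F 0) \<le> B * \<bar>x\<bar>"
proof -
  have "norm (F x - F 0) \<le> B * norm (x - 0)"
  proof (rule differentiable_bound[OF convex_closed_segment[of 0 x]])
    fix t assume t: "t \<in> closed_segment 0 x"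
    show "(F has_derivative (\<lambda>y. y *\<^sub>R F' t)) (at t within closed_segment 0 x)"
      using assms(1)[OF t] unfolding has_vector_derivative_def by (rule has_derivative_at_withinI)
    show "onorm (\<lambda>y. y *\<^sub>R F' t) \<le> B"
      using assms(2)[OF t] by (intro onorm_le) (simp add: mult.commute[of B] mult_left_mono)
  qed auto
  then show ?thesis by simp
qed

lemma geo_mono:
  assumes "geo K q x" "K \<le> K'" "0 \<le> q" "q \<le> q'"
  shows "geo K' q' x"
  unfolding geo_def
proof
  fix k
  have "cmod (x k) \<le> K * q ^ k" using assms(1) by (simp add: geo_def)
  also have "\<dots> \<le> K' * q' ^ k"
    using assms geo_nonneg[OF assms(1)] by (intro mult_mono power_mono) auto
  finally show "cmod (x k) \<le> K' * q' ^ k" .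
qed

text \<open>The left side is what the convolution of two geometric sequences produces. With p = sqrt
  q one factor p^k absorbs k, and the division by q compensates for the exponent k - 1.\<close>

lemma geo_conv_bound:
  assumes "0 < q" "q < 1"
  shows "\<exists>M p. 0 \<le> p \<and> p < 1 \<and> 0 \<le> M \<and> (\<forall>k. real k * q ^ (k - 1) \<le> M * p ^ k)"
proof -
  define p where "p = sqrt q"
  have p: "0 < p" "p < 1" "q = p * p" using assms by (auto simp: p_def)
  have "(\<lambda>k. of_nat k * p ^ k) \<longlonglongrightarrow> 0" using p by (intro powser_times_n_limit_0) auto
  then have "Bseq (\<lambda>k. of_nat k * p ^ k)" by (intro convergent_imp_Bseq convergentI)
  then obtain M where "\<forall>k. norm (of_nat k * p ^ k) \<le> M" by (rule BseqE)
  then have M: "real k * p ^ k \<le> M" for k using p by (auto simp: abs_mult)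
  have "real k * q ^ (k - 1) \<le> (M / q) * p ^ k" for k
  proof (cases k)
    case 0
    then show ?thesis using M[of 0] assms p by simp
  next
    case (Suc j)
    have "real k * q ^ (k - 1) = real k * p ^ k * p ^ k / q"
      using p unfolding Suc p(3) by (simp add: power_mult_distrib)
    also have "\<dots> \<le> M * p ^ k / q"
      using M[of k] p assms by (intro divide_right_mono mult_right_mono) auto
    finally show ?thesis by simp
  qed
  moreover have "0 \<le> M" using M[of 0] by simp
  ultimately show ?thesis using p assms by (intro exI[of _ "M / q"] exI[of _ p]) auto
qed

definition uniformly_geo :: "((nat \<Rightarrow> real) \<Rightarrow> seq) \<Rightarrow> bool" where
  "uniformly_geo F \<longleftrightarrow> (\<exists>K q. 0 \<le> q \<and> q < 1 \<and> (\<forall>\<theta>. geo K q (F \<theta>)))"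

lemma uniformly_geo_common:
  fixes n :: nat
  assumes "\<And>j. j < n \<Longrightarrow> uniformly_geo (D j)"
  shows "\<exists>K q. 0 \<le> K \<and> 0 < q \<and> q < 1 \<and> (\<forall>j<n. \<forall>\<theta>. geo K q (D j \<theta>))"
  using assms
proof (induction n)
  case 0
  show ?case by (intro exI[of _ 0] exI[of _ "1/2"]) auto
next
  case (Suc n)
  then obtain K q where Kq: "0 \<le> K" "0 < q" "q < 1" "\<And>j \<theta>. j < n \<Longrightarrow> geo K q (D j \<theta>)" by auto
  obtain K' q' where Kq': "0 \<le> q'" "q' < 1" "\<And>\<theta>. geo K' q' (D n \<theta>)"
    using Suc.prems[of n] by (auto simp: uniformly_geo_def)
  have "geo (max K K') (max q q') (D j \<theta>)" if "j < Suc n" for j \<theta>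
  proof (cases "j = n")
    case True
    show ?thesis unfolding True by (rule geo_mono[OF Kq'(3)]) (use Kq' in auto)
  next
    case False
    show ?thesis by (rule geo_mono[OF Kq(4)]) (use False that Kq in auto)
  qed
  then show ?case using Kq Kq' by (intro exI[of _ "max K K'"] exI[of _ "max q q'"]) auto
qed

text \<open>What differentiation needs of \<open>T'\<close>: angles occur only in characters
  multiplying fixed rank-one operators, so derivatives keep this form, and all matrix coefficients
  of powers decay uniformly in the angles.\<close>

locale phase_family = fin_ip +
  fixes S :: "'s set" and a :: "'s \<Rightarrow> complex" and m :: "'s \<Rightarrow> nat \<Rightarrow> real" and w v :: "'s \<Rightarrow> seq"
    and n :: nat and A :: "(nat \<Rightarrow> real) \<Rightarrow> seq \<Rightarrow> seq"
  assumes fin_S: "finite S" and w_in: "\<And>s. s \<in> S \<Longrightarrow> w s \<in> W" and v_in: "\<And>s. s \<in> S \<Longrightarrow> v s \<in> W"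
    and A_eq: "\<And>\<theta> x. x \<in> W \<Longrightarrow> A \<theta> x = (\<Sum>s\<in>S. (a s * cis (dot n (m s) \<theta>) * ip x (w s)) \<odot> v s)"
    and A_decay: "\<And>x y. x \<in> W \<Longrightarrow> y \<in> W \<Longrightarrow> uniformly_geo (\<lambda>\<theta> k. ip ((A \<theta> ^^ k) x) y)"
begin

lemma Apow_in: "x \<in> W \<Longrightarrow> (A \<theta> ^^ k) x \<in> W"
  by (induction k) (auto simp: A_eq intro!: W_sum W_scl v_in)

lemma ip_A:
  assumes "x \<in> W" "y \<in> W"
  shows "ip (A \<theta> x) y = (\<Sum>s\<in>S. a s * cis (dot n (m s) \<theta>) * ip x (w s) * ip (v s) y)"
  unfolding A_eq[OF assms(1)] by (subst ip_sum) (auto intro!: sum.cong simp: v_in ip_scl assms)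

text \<open>Leibniz' rule: the derivative of A^k is the sum of the A^i A' A^(k-1-i). As A' is a sum
  of rank-one operators, every summand factors into two matrix coefficients of powers with total
  exponent k - 1.\<close>

lemma Apow_derivative:
  fixes \<theta> h :: "nat \<Rightarrow> real" and t :: real
  assumes x: "x \<in> W" and y: "y \<in> W"
  defines "L \<equiv> (\<lambda>t j. \<theta> j + t * h j)"
  shows "((\<lambda>t. ip ((A (L t) ^^ k) x) y) has_vector_derivative
    (\<Sum>i<k. \<Sum>s\<in>S. \<i> * of_real (dot n (m s) h) * (a s * cis (dot n (m s) (L t)))
        * ip ((A (L t) ^^ (k - 1 - i)) x) (w s) * ip ((A (L t) ^^ i) (v s)) y)) (at t)"
  using y
proof (induction k arbitrary: y)
  case 0
  show ?case by simp
next
  case (Suc k)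
  let ?D = "\<lambda>k y. \<Sum>i<k. \<Sum>s\<in>S. \<i> * of_real (dot n (m s) h) * (a s * cis (dot n (m s) (L t)))
        * ip ((A (L t) ^^ (k - 1 - i)) x) (w s) * ip ((A (L t) ^^ i) (v s)) y"
  define c where "c s t = a s * cis (dot n (m s) (L t))" for s t
  have c': "(c s has_vector_derivative \<i> * of_real (dot n (m s) h) * c s t) (at t)" for s
    using has_vector_derivative_mult[OF has_vector_derivative_const[of "a s" "at t"]
        cis_line_derivative[of n "m s" \<theta> h t]]
    unfolding c_def L_def by (simp add: mult_ac)
  have eq: "ip ((A (L t) ^^ Suc k) x) y = (\<Sum>s\<in>S. c s t * ip ((A (L t) ^^ k) x) (w s) * ip (v s) y)" for t
    using ip_A[OF Apow_in[OF x] Suc.prems] by (simp add: c_def)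
  have "((\<lambda>t. \<Sum>s\<in>S. c s t * ip ((A (L t) ^^ k) x) (w s) * ip (v s) y) has_vector_derivative
      (\<Sum>s\<in>S. (c s t * ?D k (w s) + \<i> * of_real (dot n (m s) h) * c s t * ip ((A (L t) ^^ k) x) (w s)) * ip (v s) y)) (at t)"
    by (intro has_vector_derivative_sum has_vector_derivative_mult_left has_vector_derivative_mult c' Suc.IH w_in)
  also have "(\<Sum>s\<in>S. (c s t * ?D k (w s) + \<i> * of_real (dot n (m s) h) * c s t * ip ((A (L t) ^^ k) x) (w s)) * ip (v s) y)
      = (\<Sum>s\<in>S. c s t * ?D k (w s) * ip (v s) y)
        + (\<Sum>s\<in>S. \<i> * of_real (dot n (m s) h) * c s t * ip ((A (L t) ^^ k) x) (w s) * ip (v s) y)"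
    by (simp add: sum.distrib distrib_right)
  also have "(\<Sum>s\<in>S. c s t * ?D k (w s) * ip (v s) y)
      = (\<Sum>s\<in>S. \<Sum>i<k. \<Sum>s'\<in>S. (\<i> * of_real (dot n (m s') h) * c s' t
        * ip ((A (L t) ^^ (k - 1 - i)) x) (w s')) * (c s t * ip ((A (L t) ^^ i) (v s')) (w s) * ip (v s) y))"
    unfolding sum_distrib_left sum_distrib_right c_def by (simp add: mult_ac)
  also have "\<dots> = (\<Sum>i<k. \<Sum>s'\<in>S. \<Sum>s\<in>S. (\<i> * of_real (dot n (m s') h) * c s' t
        * ip ((A (L t) ^^ (k - 1 - i)) x) (w s')) * (c s t * ip ((A (L t) ^^ i) (v s')) (w s) * ip (v s) y))"
    by (rule trans[OF sum.swap sum.cong[OF refl sum.swap]])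
  also have "\<dots> = (\<Sum>i<k. \<Sum>s'\<in>S. (\<i> * of_real (dot n (m s') h) * c s' t
        * ip ((A (L t) ^^ (k - 1 - i)) x) (w s')) * ip ((A (L t) ^^ Suc i) (v s')) y)"
    unfolding sum_distrib_left[symmetric]
    using ip_A[OF Apow_in[OF v_in] Suc.prems] by (intro sum.cong refl) (simp add: c_def)
  finally have "((\<lambda>t. \<Sum>s\<in>S. c s t * ip ((A (L t) ^^ k) x) (w s) * ip (v s) y) has_vector_derivative ?D (Suc k) y) (at t)"
    unfolding sum.lessThan_Suc_shift by (simp add: c_def add.commute)
  then show ?case unfolding eq .
qed

text \<open>A class that is stable under directional derivatives and uniformly geometric, hence a
  witness for \<open>smooth_L2\<close>. The constructors \<open>phase\<close> and
  \<open>conv\<close> are what \<open>Apow_derivative\<close> produces; in \<open>conv\<close> the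
  two indices add up to k - 1.\<close>

inductive smooth_fam :: "((nat \<Rightarrow> real) \<Rightarrow> seq) \<Rightarrow> bool" where
  base: "x \<in> W \<Longrightarrow> y \<in> W \<Longrightarrow> smooth_fam (\<lambda>\<theta> k. ip ((A \<theta> ^^ k) x) y)"
| zero: "smooth_fam (\<lambda>\<theta> k. 0)"
| add: "smooth_fam F \<Longrightarrow> smooth_fam G \<Longrightarrow> smooth_fam (\<lambda>\<theta> k. F \<theta> k + G \<theta> k)"
| phase: "smooth_fam F \<Longrightarrow> smooth_fam (\<lambda>\<theta> k. c * cis (dot n \<mu> \<theta>) * F \<theta> k)"
| conv: "smooth_fam F \<Longrightarrow> smooth_fam G \<Longrightarrow> smooth_fam (\<lambda>\<theta> k. \<Sum>i<k. F \<theta> (k - 1 - i) * G \<theta> i)"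

lemma smooth_fam_sum:
  assumes "finite I" "\<And>i. i \<in> I \<Longrightarrow> smooth_fam (F i)"
  shows "smooth_fam (\<lambda>\<theta> k. \<Sum>i\<in>I. F i \<theta> k)"
  using assms by (induction I rule: finite_induct) (auto intro: zero add)

lemma smooth_fam_local:
  assumes "smooth_fam F" "\<forall>j<n. \<theta> j = \<theta>' j"
  shows "F \<theta> = F \<theta>'"
proof -
  have d: "dot n \<mu> \<theta> = dot n \<mu> \<theta>'" for \<mu> using assms(2) by (simp add: dot_def)
  show ?thesis using assms(1)
  proof induction
    case (base x y)
    have "(A \<theta> ^^ k) x = (A \<theta>' ^^ k) x" for k
      using base(1) Apow_in[OF base(1)] by (induction k) (simp_all add: A_eq d)
    then show ?case by simp
  qed (simp_all add: d fun_eq_iff)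
qed

lemma smooth_fam_geo: "smooth_fam F \<Longrightarrow> uniformly_geo F"
proof (induction rule: smooth_fam.induct)
  case (base x y)
  then show ?case by (rule A_decay)
next
  case zero
  show ?case unfolding uniformly_geo_def by (intro exI[of _ 0] exI[of _ 0]) (simp add: geo_def)
next
  case (add F G)
  \<comment> \<open>Packing both families into one lets \<open>uniformly_geo_common\<close> supply
    common constants.\<close>
  define D where "D j = (if j = 0 then F else G)" for j :: nat
  obtain K q where Kq: "0 < q" "q < 1" "\<And>j \<theta>. j < 2 \<Longrightarrow> geo K q (D j \<theta>)"
    using uniformly_geo_common[of 2 D] add.IH unfolding D_def by (smt (verit))
  have "cmod (F \<theta> k + G \<theta> k) \<le> (K + K) * q ^ k" for \<theta> k
  proof -
    have "cmod (F \<theta> k) \<le> K * q ^ k" "cmod (G \<theta> k) \<le> K * q ^ k"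
      using Kq(3)[of 0 \<theta>] Kq(3)[of 1 \<theta>] by (auto simp: D_def geo_def)
    then show ?thesis using norm_triangle_ineq[of "F \<theta> k" "G \<theta> k"] unfolding distrib_right by linarith
  qed
  then show ?case using Kq unfolding uniformly_geo_def geo_def
    by (intro exI[of _ "K + K"] exI[of _ q]) auto
next
  case (phase F c \<mu>)
  then obtain K q where Kq: "0 \<le> q" "q < 1" "\<And>\<theta>. geo K q (F \<theta>)" by (auto simp: uniformly_geo_def)
  have "cmod (c * cis (dot n \<mu> \<theta>) * F \<theta> k) \<le> (cmod c * K) * q ^ k" for \<theta> k
    using Kq(3)[of \<theta>] unfolding geo_def by (simp add: norm_mult mult.assoc mult_left_mono)
  then show ?case using Kq(1,2) unfolding uniformly_geo_def geo_def by blast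
next
  case (conv F G)
  define D where "D j = (if j = 0 then F else G)" for j :: nat
  obtain K q where Kq: "0 \<le> K" "0 < q" "q < 1" "\<And>j \<theta>. j < 2 \<Longrightarrow> geo K q (D j \<theta>)"
    using uniformly_geo_common[of 2 D] conv.IH unfolding D_def by (smt (verit))
  \<comment> \<open>The convolution has k terms of size q^(k-1); the factor k is absorbed by passing
    from the rate q to a rate p still below 1.\<close>
  obtain M p where Mp: "0 \<le> p" "p < 1" "0 \<le> M" "\<And>k. real k * q ^ (k - 1) \<le> M * p ^ k"
    using geo_conv_bound[OF Kq(2,3)] by blast
  have "cmod (\<Sum>i<k. F \<theta> (k - 1 - i) * G \<theta> i) \<le> (K * K * M) * p ^ k" for \<theta> k
  proof -
    have "cmod (\<Sum>i<k. F \<theta> (k - 1 - i) * G \<theta> i) \<le> (\<Sum>i<k. K * K * q ^ (k - 1))"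
    proof (rule sum_norm_le)
      fix i assume i: "i \<in> {..<k}"
      have "cmod (F \<theta> (k - 1 - i) * G \<theta> i) \<le> (K * q ^ (k - 1 - i)) * (K * q ^ i)"
        unfolding norm_mult using Kq(1,2) Kq(4)[of 0 \<theta>] Kq(4)[of 1 \<theta>]
        by (intro mult_mono) (auto simp: D_def geo_def)
      also have "\<dots> = K * K * q ^ ((k - 1 - i) + i)" by (simp add: power_add)
      also have "(k - 1 - i) + i = k - 1" using i by auto
      finally show "cmod (F \<theta> (k - 1 - i) * G \<theta> i) \<le> K * K * q ^ (k - 1)" .
    qed
    also have "\<dots> = K * K * (real k * q ^ (k - 1))" by simp
    also have "\<dots> \<le> K * K * (M * p ^ k)" using Mp(4) by (intro mult_left_mono) auto
    finally show ?thesis by (simp add: mult.assoc)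
  qed
  then show ?case using Mp(1,2) unfolding uniformly_geo_def geo_def by blast
qed

lemma smooth_fam_derivative:
  "smooth_fam F \<Longrightarrow> \<exists>D. smooth_fam D \<and> (\<forall>\<theta> k t. ((\<lambda>t. F (\<lambda>j. \<theta> j + t * h j) k) has_vector_derivative
     D (\<lambda>j. \<theta> j + t * h j) k) (at t))"
proof (induction rule: smooth_fam.induct)
  case (base x y)
  \<comment> \<open>The expression of \<open>Apow_derivative\<close> with its sums swapped, so that
    it reads as a finite sum of \<open>phase\<close> applied to \<open>conv\<close>.\<close>
  define D where "D = (\<lambda>\<theta> k. \<Sum>s\<in>S. (\<i> * of_real (dot n (m s) h) * a s) * cis (dot n (m s) \<theta>) *
     (\<Sum>i<k. ip ((A \<theta> ^^ (k - 1 - i)) x) (w s) * ip ((A \<theta> ^^ i) (v s)) y))"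
  have "smooth_fam D" unfolding D_def
    by (intro smooth_fam_sum fin_S phase conv[where F = "\<lambda>\<theta> k. ip ((A \<theta> ^^ k) x) (w _)"
      and G = "\<lambda>\<theta> k. ip ((A \<theta> ^^ k) (v _)) y"] smooth_fam.base base w_in v_in)
  moreover have D_eq: "(\<Sum>i<k. \<Sum>s\<in>S. \<i> * of_real (dot n (m s) h) * (a s * cis (dot n (m s) \<theta>))
        * ip ((A \<theta> ^^ (k - 1 - i)) x) (w s) * ip ((A \<theta> ^^ i) (v s)) y) = D \<theta> k" for \<theta> k
    unfolding D_def by (subst sum.swap) (simp add: sum_distrib_left mult_ac)
  moreover have "((\<lambda>t. ip ((A (\<lambda>j. \<theta> j + t * h j) ^^ k) x) y) has_vector_derivative
      D (\<lambda>j. \<theta> j + t * h j) k) (at t)" for \<theta> k t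
    using Apow_derivative[OF base, where \<theta> = \<theta> and h = h and k = k and t = t] unfolding D_eq .
  ultimately show ?case by blast
next
  case zero
  show ?case by (rule exI[of _ "\<lambda>_ _. 0"]) (auto intro: smooth_fam.zero)
next
  case (add F G)
  then obtain D E where "smooth_fam D" "smooth_fam E"
    and "\<And>\<theta> k t. ((\<lambda>t. F (\<lambda>j. \<theta> j + t * h j) k) has_vector_derivative D (\<lambda>j. \<theta> j + t * h j) k) (at t)"
    and "\<And>\<theta> k t. ((\<lambda>t. G (\<lambda>j. \<theta> j + t * h j) k) has_vector_derivative E (\<lambda>j. \<theta> j + t * h j) k) (at t)"
    by blast
  then show ?case
    by (intro exI[of _ "\<lambda>\<theta> k. D \<theta> k + E \<theta> k"]) (auto intro!: smooth_fam.add has_vector_derivative_add)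
next
  case (phase F c \<mu>)
  then obtain D where D: "smooth_fam D"
    "\<And>\<theta> k t. ((\<lambda>t. F (\<lambda>j. \<theta> j + t * h j) k) has_vector_derivative D (\<lambda>j. \<theta> j + t * h j) k) (at t)"
    by blast
  define E where "E = (\<lambda>\<theta> k. c * cis (dot n \<mu> \<theta>) * D \<theta> k + (c * (\<i> * of_real (dot n \<mu> h))) * cis (dot n \<mu> \<theta>) * F \<theta> k)"
  have "smooth_fam E" unfolding E_def by (intro smooth_fam.add smooth_fam.phase D(1) phase(1))
  moreover have "((\<lambda>t. c * cis (dot n \<mu> (\<lambda>j. \<theta> j + t * h j)) * F (\<lambda>j. \<theta> j + t * h j) k) has_vector_derivative
      E (\<lambda>j. \<theta> j + t * h j) k) (at t)" for \<theta> k t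
    using has_vector_derivative_mult[OF has_vector_derivative_mult[OF has_vector_derivative_const[of c "at t"]
        cis_line_derivative[of n \<mu> \<theta> h t]] D(2)[of \<theta> k t]]
    unfolding E_def by (simp add: mult_ac)
  ultimately show ?case by blast
next
  case (conv F G)
  then obtain D E where D: "smooth_fam D" "smooth_fam E"
    "\<And>\<theta> k t. ((\<lambda>t. F (\<lambda>j. \<theta> j + t * h j) k) has_vector_derivative D (\<lambda>j. \<theta> j + t * h j) k) (at t)"
    "\<And>\<theta> k t. ((\<lambda>t. G (\<lambda>j. \<theta> j + t * h j) k) has_vector_derivative E (\<lambda>j. \<theta> j + t * h j) k) (at t)"
    by blast
  define P where "P = (\<lambda>\<theta> k. (\<Sum>i<k. F \<theta> (k - 1 - i) * E \<theta> i) + (\<Sum>i<k. D \<theta> (k - 1 - i) * G \<theta> i))"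
  have "smooth_fam P" unfolding P_def by (intro smooth_fam.add smooth_fam.conv conv(1,2) D(1,2))
  moreover have "((\<lambda>t. \<Sum>i<k. F (\<lambda>j. \<theta> j + t * h j) (k - 1 - i) * G (\<lambda>j. \<theta> j + t * h j) i)
      has_vector_derivative P (\<lambda>j. \<theta> j + t * h j) k) (at t)" for \<theta> k t
    unfolding P_def sum.distrib[symmetric]
    by (intro has_vector_derivative_sum has_vector_derivative_mult D)
  ultimately show ?case by blast
qed

section \<open>From coefficientwise derivatives to smoothness in L2\<close>

definition unit_dir :: "nat \<Rightarrow> nat \<Rightarrow> real" where "unit_dir j = (\<lambda>i. if i = j then 1 else 0)"

lemma fun_upd_line: "(\<lambda>i. \<theta> i + t * unit_dir j i) = \<theta>(j := \<theta> j + t)"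
  by (auto simp: unit_dir_def)

lemma smooth_fam_partial:
  assumes "smooth_fam F"
  shows "\<exists>D. smooth_fam D \<and> (\<forall>\<theta> k t. ((\<lambda>t. F (\<theta>(j := \<theta> j + t)) k) has_vector_derivative
     D (\<theta>(j := \<theta> j + t)) k) (at t))"
  using smooth_fam_derivative[OF assms, of "unit_dir j"] unfolding fun_upd_line .

lemma smooth_fam_lipschitz:
  assumes F: "smooth_fam F"
  shows "\<exists>K q. 0 \<le> K \<and> 0 < q \<and> q < 1 \<and>
    (\<forall>\<theta> \<theta>' k. cmod (F \<theta>' k - F \<theta> k) \<le> K * (\<Sum>j<n. \<bar>\<theta>' j - \<theta> j\<bar>) * q ^ k)"
proof -
  obtain D where D: "\<And>j. smooth_fam (D j)"
    "\<And>j \<theta> k t. ((\<lambda>t. F (\<theta>(j := \<theta> j + t)) k) has_vector_derivative D j (\<theta>(j := \<theta> j + t)) k) (at t)"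
    using smooth_fam_partial[OF F] by metis
  obtain K q where Kq: "0 \<le> K" "0 < q" "q < 1" "\<And>j \<theta>. j < n \<Longrightarrow> geo K q (D j \<theta>)"
    using uniformly_geo_common[of n D] smooth_fam_geo[OF D(1)] by blast
  have "cmod (F \<theta>' k - F \<theta> k) \<le> K * (\<Sum>j<n. \<bar>\<theta>' j - \<theta> j\<bar>) * q ^ k" for \<theta> \<theta>' k
  proof -
    \<comment> \<open>Passes from \<theta> to \<theta>' one coordinate at a time, using only partial
      derivatives; \<open>\<psi> n\<close> and \<theta>' agree below n, which suffices by
      \<open>smooth_fam_local\<close>.\<close>
    define \<psi> where "\<psi> l = (\<lambda>j. if j < l then \<theta>' j else \<theta> j)" for l :: nat
    have "cmod (F (\<psi> l) k - F \<theta> k) \<le> K * (\<Sum>j<l. \<bar>\<theta>' j - \<theta> j\<bar>) * q ^ k" if "l \<le> n" for l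
      using that
    proof (induction l)
      case 0
      show ?case by (simp add: \<psi>_def)
    next
      case (Suc l)
      have e: "\<psi> (Suc l) = (\<psi> l)(l := \<psi> l l + (\<theta>' l - \<theta> l))" "(\<psi> l)(l := \<psi> l l + 0) = \<psi> l"
        by (auto simp: \<psi>_def less_Suc_eq)
      have "norm (F ((\<psi> l)(l := \<psi> l l + (\<theta>' l - \<theta> l))) k - F ((\<psi> l)(l := \<psi> l l + 0)) k) \<le> (K * q ^ k) * \<bar>\<theta>' l - \<theta> l\<bar>"
        by (rule norm_diff_le_of_derivative[OF D(2)]) (use Kq(4)[of l] Suc.prems in \<open>simp add: geo_def\<close>)
      then have "cmod (F (\<psi> (Suc l)) k - F (\<psi> l) k) \<le> (K * q ^ k) * \<bar>\<theta>' l - \<theta> l\<bar>" unfolding e .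
      then show ?case
        using Suc norm_triangle_ineq[of "F (\<psi> (Suc l)) k - F (\<psi> l) k" "F (\<psi> l) k - F \<theta> k"]
        by (simp add: algebra_simps)
    qed
    from this[of n] have "cmod (F (\<psi> n) k - F \<theta> k) \<le> K * (\<Sum>j<n. \<bar>\<theta>' j - \<theta> j\<bar>) * q ^ k" by simp
    moreover have "F (\<psi> n) = F \<theta>'" by (rule smooth_fam_local[OF F]) (simp add: \<psi>_def)
    ultimately show ?thesis by simp
  qed
  then show ?thesis using Kq(1-3) by blast
qed

lemma l2_sq_small:
  assumes "0 \<le> q" "q < 1"
  shows "\<exists>M\<ge>0. \<forall>K x. geo K q x \<longrightarrow> l2_sq x \<le> ennreal (K\<^sup>2 * M)"
  using geo_hs_bound[OF assms, of 0] unfolding l2_eq_hs0 .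

lemma l2_sq_eventually_small:
  assumes q: "0 \<le> q" "q < 1" and "0 \<le> K" "0 < \<epsilon>"
  shows "\<exists>\<delta>>0. \<forall>x \<eta>. 0 \<le> \<eta> \<and> \<eta> < \<delta> \<and> geo (K * \<eta>) q x \<longrightarrow> l2_sq x < ennreal \<epsilon>"
proof -
  obtain M where M: "0 \<le> M" "\<And>K x. geo K q x \<Longrightarrow> l2_sq x \<le> ennreal (K\<^sup>2 * M)"
    using l2_sq_small[OF q] by blast
  \<comment> \<open>The added 1 keeps the quotient meaningful when K^2 M vanishes.\<close>
  define \<delta> where "\<delta> = sqrt (\<epsilon> / (K\<^sup>2 * M + 1))"
  have pos: "0 < K\<^sup>2 * M + 1" using M(1) by (simp add: add_nonneg_pos)
  have "l2_sq x < ennreal \<epsilon>" if x: "0 \<le> \<eta>" "\<eta> < \<delta>" "geo (K * \<eta>) q x" for x \<eta>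
  proof -
    have "\<eta>\<^sup>2 < \<delta>\<^sup>2" using x by (intro power_strict_mono) auto
    then have "\<eta>\<^sup>2 * (K\<^sup>2 * M + 1) < \<epsilon>" using pos assms(4) by (simp add: \<delta>_def field_simps)
    moreover have "(K * \<eta>)\<^sup>2 * M \<le> \<eta>\<^sup>2 * (K\<^sup>2 * M + 1)"
      by (simp add: power_mult_distrib algebra_simps)
    ultimately have "(K * \<eta>)\<^sup>2 * M < \<epsilon>" by linarith
    then have "ennreal ((K * \<eta>)\<^sup>2 * M) < ennreal \<epsilon>" using M(1) by (simp add: ennreal_less_iff)
    with M(2)[OF x(3)] show ?thesis by (rule le_less_trans)
  qed
  moreover have "\<delta> > 0" using pos assms(4) by (simp add: \<delta>_def)
  ultimately show ?thesis by blast
qed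

lemma smooth_fam_cont:
  assumes F: "smooth_fam F"
  shows "cont_L2 n F"
  unfolding cont_L2_def
proof (intro allI impI)
  fix \<theta> :: "nat \<Rightarrow> real" and \<epsilon> :: real assume \<epsilon>: "0 < \<epsilon>"
  obtain K q where Kq: "0 \<le> K" "0 < q" "q < 1"
    "\<And>\<theta> \<theta>' k. cmod (F \<theta>' k - F \<theta> k) \<le> K * (\<Sum>j<n. \<bar>\<theta>' j - \<theta> j\<bar>) * q ^ k"
    using smooth_fam_lipschitz[OF F] by blast
  obtain \<delta> where \<delta>: "0 < \<delta>" "\<And>x \<eta>. 0 \<le> \<eta> \<Longrightarrow> \<eta> < \<delta> \<Longrightarrow> geo (K * \<eta>) q x \<Longrightarrow> l2_sq x < ennreal \<epsilon>"
    using l2_sq_eventually_small[of q K \<epsilon>] Kq(1-3) \<epsilon> by auto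
  have "l2_sq (\<lambda>k. F \<theta>' k - F \<theta> k) < ennreal \<epsilon>" if "\<forall>j<n. \<bar>\<theta>' j - \<theta> j\<bar> < \<delta> / real (n + 1)" for \<theta>'
  proof (rule \<delta>(2)[of "\<Sum>j<n. \<bar>\<theta>' j - \<theta> j\<bar>"])
    have "(\<Sum>j<n. \<bar>\<theta>' j - \<theta> j\<bar>) \<le> (\<Sum>j<n. \<delta> / real (n + 1))"
      using that by (intro sum_mono) (auto simp: less_imp_le)
    also have "\<dots> < \<delta>" using \<delta>(1) by (simp add: field_simps)
    finally show "(\<Sum>j<n. \<bar>\<theta>' j - \<theta> j\<bar>) < \<delta>" .
  qed (use Kq(4) in \<open>auto simp: geo_def intro: sum_nonneg\<close>)
  then show "\<exists>\<delta>>0. \<forall>\<theta>'. (\<forall>j<n. \<bar>\<theta>' j - \<theta> j\<bar> < \<delta>) \<longrightarrow> l2_sq (\<lambda>k. F \<theta>' k - F \<theta> k) < ennreal \<epsilon>"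
    using \<delta>(1) by (intro exI[of _ "\<delta> / real (n + 1)"]) auto
qed

lemma smooth_fam_has_partial:
  assumes F: "smooth_fam F" and j: "j < n"
  shows "\<exists>D. smooth_fam D \<and> has_partial_L2 j F D"
proof -
  obtain D where D: "smooth_fam D"
    "\<And>\<theta> k t. ((\<lambda>t. F (\<theta>(j := \<theta> j + t)) k) has_vector_derivative D (\<theta>(j := \<theta> j + t)) k) (at t)"
    using smooth_fam_partial[OF F] by metis
  obtain K q where Kq: "0 \<le> K" "0 < q" "q < 1"
    "\<And>\<theta> \<theta>' k. cmod (D \<theta>' k - D \<theta> k) \<le> K * (\<Sum>j<n. \<bar>\<theta>' j - \<theta> j\<bar>) * q ^ k"
    using smooth_fam_lipschitz[OF D(1)] by blast
  have lip: "cmod (D (\<theta>(j := \<theta> j + t)) k - D \<theta> k) \<le> K * \<bar>t\<bar> * q ^ k" for \<theta> t k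
  proof -
    have "(\<Sum>i<n. \<bar>(\<theta>(j := \<theta> j + t)) i - \<theta> i\<bar>) = (\<Sum>i<n. if i = j then \<bar>t\<bar> else 0)"
      by (intro sum.cong) auto
    then show ?thesis using Kq(4)[of "\<theta>(j := \<theta> j + t)" k \<theta>] j by simp
  qed
  have est: "cmod ((F (\<theta>(j := \<theta> j + h)) k - F \<theta> k) / complex_of_real h - D \<theta> k) \<le> K * \<bar>h\<bar> * q ^ k"
    if h: "h \<noteq> 0" for \<theta> h k
  proof -
    \<comment> \<open>After subtracting the linear part the derivative is \<open>D\<close> at the
      moved point minus \<open>D \<theta>\<close>, of order |h| by the Lipschitz bound. The mean
      value estimate gives order |h|^2, and one power survives the division by h.\<close>
    define G where "G t = F (\<theta>(j := \<theta> j + t)) k - of_real t * D \<theta> k" for t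
    have B: "norm (G h - G 0) \<le> (K * \<bar>h\<bar> * q ^ k) * \<bar>h\<bar>"
    proof (rule norm_diff_le_of_derivative)
      fix t assume t: "t \<in> closed_segment 0 h"
      have "((\<lambda>t. complex_of_real t * D \<theta> k) has_vector_derivative D \<theta> k) (at t)"
        by (auto intro!: derivative_eq_intros)
      then show "(G has_vector_derivative (D (\<theta>(j := \<theta> j + t)) k - D \<theta> k)) (at t)"
        unfolding G_def by (intro has_vector_derivative_diff D(2))
      have "\<bar>t\<bar> \<le> \<bar>h\<bar>" using t by (auto simp: closed_segment_eq_real_ivl split: if_splits)
      then show "norm (D (\<theta>(j := \<theta> j + t)) k - D \<theta> k) \<le> K * \<bar>h\<bar> * q ^ k"
        using lip[of \<theta> t k] Kq(1,2)
        by (meson mult_left_mono mult_right_mono order_trans zero_le_power less_imp_le)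
    qed
    have "(F (\<theta>(j := \<theta> j + h)) k - F \<theta> k) / complex_of_real h - D \<theta> k = (G h - G 0) / of_real h"
      using h by (simp add: G_def field_simps)
    from this have "cmod ((F (\<theta>(j := \<theta> j + h)) k - F \<theta> k) / complex_of_real h - D \<theta> k) = norm (G h - G 0) / \<bar>h\<bar>"
      by (simp only: norm_divide norm_of_real)
    with B show ?thesis using h by (simp only:) (simp add: field_simps)
  qed
  have "has_partial_L2 j F D" unfolding has_partial_L2_def
  proof (intro allI impI)
    fix \<theta> :: "nat \<Rightarrow> real" and \<epsilon> :: real assume \<epsilon>: "0 < \<epsilon>"
    obtain \<delta> where \<delta>: "0 < \<delta>" "\<And>x \<eta>. 0 \<le> \<eta> \<Longrightarrow> \<eta> < \<delta> \<Longrightarrow> geo (K * \<eta>) q x \<Longrightarrow> l2_sq x < ennreal \<epsilon>"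
      using l2_sq_eventually_small[of q K \<epsilon>] Kq(1-3) \<epsilon> by auto
    show "\<exists>\<delta>>0. \<forall>h. h \<noteq> 0 \<and> \<bar>h\<bar> < \<delta> \<longrightarrow>
        l2_sq (\<lambda>k. (F (\<theta>(j := \<theta> j + h)) k - F \<theta> k) / complex_of_real h - D \<theta> k) < ennreal \<epsilon>"
    proof (intro exI[of _ \<delta>] conjI allI impI \<delta>(1))
      fix h :: real assume h: "h \<noteq> 0 \<and> \<bar>h\<bar> < \<delta>"
      show "l2_sq (\<lambda>k. (F (\<theta>(j := \<theta> j + h)) k - F \<theta> k) / complex_of_real h - D \<theta> k) < ennreal \<epsilon>"
        by (rule \<delta>(2)[of "\<bar>h\<bar>"]) (use h est in \<open>auto simp: geo_def\<close>)
    qed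
  qed
  then show ?thesis using D(1) by blast
qed

lemma smooth_fam_smooth:
  assumes "smooth_fam F"
  shows "smooth_L2 n F"
  unfolding smooth_L2_def
  using assms smooth_fam_cont smooth_fam_has_partial by (intro exI[of _ "Collect smooth_fam"]) blast

end

section \<open>The torus of solutions\<close>

context fin_ip
begin

lemma ip_lin_dia:
  assumes f: "on_fam N f" and B: "semilin id W B" and y: "y \<in> W"
  shows "ip (B (dia f p x)) y = (\<Sum>i<N. p i * ip x (f i) * ip (B (f i)) y)"
proof -
  have fW: "\<And>i. i < N \<Longrightarrow> f i \<in> W" using f by (rule on_famD)
  have "B (dia f p x) = (\<Sum>i<N. B ((p i * ip x (f i)) \<odot> f i))"
    unfolding dia_def by (rule semilin_sum[OF B W_subsp]) (auto simp: fW)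
  also have "\<dots> = (\<Sum>i<N. (p i * ip x (f i)) \<odot> B (f i))"
    by (intro sum.cong refl) (simp add: semilinD(3)[OF B] fW)
  finally have "ip (B (dia f p x)) y = ip (\<Sum>i<N. (p i * ip x (f i)) \<odot> B (f i)) y" by (rule arg_cong)
  also have "\<dots> = (\<Sum>i<N. p i * ip x (f i) * ip (B (f i)) y)"
    by (subst ip_sum) (auto intro!: sum.cong simp: fW ip_scl y semilinD(1)[OF B])
  finally show ?thesis .
qed

end

context spectral_hankel_pair
begin

definition circ :: "(nat \<Rightarrow> real) \<Rightarrow> nat \<Rightarrow> complex" where "circ \<theta> j = cis (\<theta> j)"

text \<open>Since \<open>H' z e = U1 z u\<close>, this is \<open>J\<close> applied to the symbol of
  the deformed pair, so its ranks and decay come from the abstract theory.\<close>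

definition \<Phi> :: "(nat \<Rightarrow> real) \<Rightarrow> seq" where
  "\<Phi> \<theta> = (\<lambda>k. ip ((T' (circ \<theta>) ^^ k) (U1 (circ \<theta>) u)) e)"

text \<open>An eigenspace reads its angle at its representative index, and there the frequency is
  the eigenvalue itself (\<open>\<omega>_idx\<close>).\<close>

definition \<omega> :: "nat \<Rightarrow> real" where "\<omega> j = (if j < N then lam j else kap (j - N))"

definition \<mu> :: "nat \<Rightarrow> nat \<Rightarrow> real" where "\<mu> i j = (if j = idx lam i then -1 else 0)"

text \<open>Exponents of the character by which \<open>T'\<close> weights the pair s; paired with
  \<open>\<omega>\<close> they give kap - lam.\<close>

definition mode :: "nat \<times> nat \<Rightarrow> nat \<Rightarrow> real" where
  "mode s j = (if j = N + idx kap (snd s) then 1 else 0) - (if j = idx lam (fst s) then 1 else 0)"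

lemma circ_torus: "circ \<theta> \<in> torus"
  by (simp add: torus_def circ_def)

lemma idx_bounds: "i < N \<Longrightarrow> idx lam i < N" "i < N \<Longrightarrow> idx kap i < N"
  using idx_le[of lam i] idx_le[of kap i] by auto

lemma dot_\<mu>: "i < N \<Longrightarrow> dot (2 * N) (\<mu> i) \<theta> = - \<theta> (idx lam i)"
  using idx_bounds(1)[of i]
  by (simp add: dot_def \<mu>_def if_distrib[of "\<lambda>x. x * _"] cong: if_cong)

lemma dot_mode:
  assumes "s \<in> {..<N} \<times> {..<N}"
  shows "dot (2 * N) (mode s) \<theta> = \<theta> (N + idx kap (snd s)) - \<theta> (idx lam (fst s))"
  using assms idx_bounds(1)[of "fst s"] idx_bounds(2)[of "snd s"]
  by (auto simp: dot_def mode_def left_diff_distrib sum_subtractf if_distrib[of "\<lambda>x. x * _"] cong: if_cong)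

lemma \<omega>_idx: "i < N \<Longrightarrow> \<omega> (idx lam i) = lam i" "i < N \<Longrightarrow> \<omega> (N + idx kap i) = kap i"
  using idx_bounds by (auto simp: \<omega>_def)

lemma p1_circ: "i < N \<Longrightarrow> p1 (circ \<theta>) i = cis (dot (2 * N) (\<mu> i) \<theta>)"
  by (simp add: p1_def circ_def dot_\<mu> cis_cnj)

lemma p12_circ:
  "s \<in> {..<N} \<times> {..<N} \<Longrightarrow> p1 (circ \<theta>) (fst s) * p2 (circ \<theta>) (snd s) = cis (dot (2 * N) (mode s) \<theta>)"
  by (simp add: p1_def p2_def circ_def dot_mode cis_cnj cis_mult)

definition coupling :: "nat \<times> nat \<Rightarrow> complex" where "coupling s = ip (g (snd s)) (f (fst s))"

lemma T'_phase_family: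
  "phase_family W ip N b ({..<N} \<times> {..<N}) coupling mode (\<lambda>s. w (snd s)) (\<lambda>s. f (fst s)) (2 * N) (\<lambda>\<theta>. T' (circ \<theta>))"
proof unfold_locales
  show "finite ({..<N} \<times> {..<N})" by simp
  show "w (snd s) \<in> W" if "s \<in> {..<N} \<times> {..<N}" for s using w(1) that by auto
  show "f (fst s) \<in> W" if "s \<in> {..<N} \<times> {..<N}" for s using on_famD[OF f_on] that by auto
  show "T' (circ \<theta>) x = (\<Sum>s\<in>{..<N} \<times> {..<N}. (coupling s * cis (dot (2 * N) (mode s) \<theta>) * ip x (w (snd s))) \<odot> f (fst s))"
    if "x \<in> W" for \<theta> x
    unfolding T'_def U1_def U2_def dia_rank_one_sum[OF that]
  proof (intro sum.cong refl)
    fix s :: "nat \<times> nat" assume s: "s \<in> {..<N} \<times> {..<N}"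
    show "(p1 (circ \<theta>) (fst s) * p2 (circ \<theta>) (snd s) * ip (g (snd s)) (f (fst s)) * ip x (w (snd s))) \<odot> f (fst s)
        = (coupling s * cis (dot (2 * N) (mode s) \<theta>) * ip x (w (snd s))) \<odot> f (fst s)"
      unfolding coupling_def p12_circ[OF s] by (simp only: mult_ac)
  qed
  show "uniformly_geo (\<lambda>\<theta> k. ip ((T' (circ \<theta>) ^^ k) x) y)" if xy: "x \<in> W" "y \<in> W" for x y
  proof -
    obtain C r where Cr: "0 \<le> r" "r < 1"
      "\<And>z. z \<in> torus \<Longrightarrow> decaying_hankel_pair W ip N b (T' z) (H' z) e C r"
      using T'_uniform_decay by blast
    have "geo (C * sqrt (nsq x * nsq y)) r (\<lambda>k. ip ((T' (circ \<theta>) ^^ k) x) y)" for \<theta>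
      by (rule decaying_hankel_pair.ip_Tpow_geo[OF Cr(3)[OF circ_torus] xy])
    then show ?thesis using Cr(1,2) unfolding uniformly_geo_def by blast
  qed
qed

interpretation P: phase_family W ip N b "{..<N} \<times> {..<N}" coupling mode "\<lambda>s. w (snd s)" "\<lambda>s. f (fst s)"
    "2 * N" "\<lambda>\<theta>. T' (circ \<theta>)"
  by (rule T'_phase_family)

lemma T'pow_lin: "semilin id W (T' z ^^ k)"
  by (rule semilin_pow[OF T'_lin])

lemma \<Phi>_exp: "\<Phi> \<theta> k = (\<Sum>i<N. p1 (circ \<theta>) i * ip u (f i) * ip ((T' (circ \<theta>) ^^ k) (f i)) e)"
  unfolding \<Phi>_def U1_def by (rule ip_lin_dia[OF f_on T'pow_lin e_in])

lemma \<Phi>_smooth_fam: "P.smooth_fam \<Phi>"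
proof -
  have "P.smooth_fam (\<lambda>\<theta> k. \<Sum>i<N. ip u (f i) * cis (dot (2 * N) (\<mu> i) \<theta>) * ip ((T' (circ \<theta>) ^^ k) (f i)) e)"
    using on_famD[OF f_on]
    by (intro P.smooth_fam_sum P.smooth_fam.phase P.smooth_fam.base) auto
  moreover have "(\<lambda>\<theta> k. \<Sum>i<N. ip u (f i) * cis (dot (2 * N) (\<mu> i) \<theta>) * ip ((T' (circ \<theta>) ^^ k) (f i)) e) = \<Phi>"
    unfolding fun_eq_iff \<Phi>_exp by (auto intro!: sum.cong simp: p1_circ)
  ultimately show ?thesis by (simp only:)
qed

lemma \<Phi>_smooth: "smooth_L2 (2 * N) \<Phi>"
  by (rule P.smooth_fam_smooth[OF \<Phi>_smooth_fam])

lemma \<Phi>_geo: "uniformly_geo \<Phi>"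
  by (rule P.smooth_fam_geo[OF \<Phi>_smooth_fam])

lemma \<Phi>_torus_map: "torus_map (2 * N) \<Phi>"
  unfolding torus_map_def
proof (intro conjI allI impI)
  show "\<Phi> \<theta> = \<Phi> \<theta>'" if "\<forall>j<2 * N. \<theta> j = \<theta>' j" for \<theta> \<theta>'
    by (rule P.smooth_fam_local[OF \<Phi>_smooth_fam that])
  show "\<Phi> (\<theta>(j := \<theta> j + 2 * pi)) = \<Phi> \<theta>" for \<theta> j
  proof -
    have "circ (\<theta>(j := \<theta> j + 2 * pi)) = circ \<theta>"
      by (auto simp: circ_def fun_eq_iff cis_mult[symmetric])
    then show ?thesis unfolding \<Phi>_def by simp
  qed
qed

lemma \<Phi>_in_V:
  assumes "N = (d + 1) div 2" "has_dim (T ` W) (d div 2)"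
  shows "\<Phi> \<theta> \<in> V d"
proof -
  let ?z = "circ \<theta>"
  obtain C r where D: "decaying_hankel_pair W ip N b (T' ?z) (H' ?z) e C r"
    using T'_uniform_decay circ_torus by blast
  interpret D: decaying_hankel_pair W ip N b "T' ?z" "H' ?z" e C r by (rule D)
  have TW: "x \<in> W" if "x \<in> T ` W" for x using that by auto
  have "has_dim ((\<lambda>x. U1 ?z (U2 ?z x)) ` (T ` W)) (d div 2)"
  proof (rule has_dim_image[OF subsp_image[OF W_subsp T_lin surj_id] _ _ _ assms(2)])
    show "U1 ?z (U2 ?z (x + y)) = U1 ?z (U2 ?z x) + U1 ?z (U2 ?z y)" if "x \<in> T ` W" "y \<in> T ` W" for x y
      using that[THEN TW] by (simp add: semilinD(2)[OF U_lin(1)] semilinD(2)[OF U_lin(2)])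
    show "U1 ?z (U2 ?z (c \<odot> x)) = c \<odot> U1 ?z (U2 ?z x)" if "x \<in> T ` W" for c x
      using TW[OF that] by (simp add: semilinD(3)[OF U_lin(1)] semilinD(3)[OF U_lin(2)])
    show "x = 0" if "x \<in> T ` W" "U1 ?z (U2 ?z x) = 0" for x
    proof -
      have "ip x x = ip (U1 ?z (U2 ?z x)) (U1 ?z (U2 ?z x))"
        using TW[OF that(1)] dia_isometry[OF f_on, of "U2 ?z x" "U2 ?z x" "p1 ?z"]
          dia_isometry[OF g_on, of x x "p2 ?z"] p_unimodular[OF circ_torus[of \<theta>]]
        by (simp add: U1_def[symmetric] U2_def[symmetric])
      also have "\<dots> = 0" unfolding that(2) by simp
      finally show ?thesis using nsq_eq_0_iff[OF TW[OF that(1)]] by (simp add: nsq_def)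
    qed
  qed
  moreover have "(\<lambda>x. U1 ?z (U2 ?z x)) ` (T ` W) = T' ?z ` W" unfolding T'_def by (simp only: image_image)
  ultimately have "has_dim (T' ?z ` W) (d div 2)" by simp
  then have "D.J D.u \<in> V d" by (rule D.J_u_in_V[OF assms(1)])
  moreover have "D.J D.u = \<Phi> \<theta>" unfolding D.J_def D.u_def \<Phi>_def H'_def u_def ..
  ultimately show ?thesis by simp
qed

text \<open>The derivative of \<open>T'\<close> in the direction \<open>\<omega>\<close>. The
  factors kap - lam turn the sum into i (U1 (TH)^2 U2 T - H^2 T'); writing U2 T as the adjoint of U1
  applied to \<open>T'\<close> leads to \<open>generator_rank_one\<close>.\<close>

lemma generator_sum:
  assumes x: "x \<in> W"
  shows "(\<Sum>s\<in>{..<N} \<times> {..<N}. (\<i> * of_real (dot (2 * N) (mode s) \<omega>) * (coupling s * cis (dot (2 * N) (mode s) \<theta>))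
      * ip x (w (snd s))) \<odot> f (fst s))
    = (- \<i> * ip (T' (circ \<theta>) x) (U1 (circ \<theta>) u)) \<odot> U1 (circ \<theta>) u"
proof -
  let ?z = "circ \<theta>" and ?S = "{..<N} \<times> {..<N}"
  define y where "y = T' ?z x"
  have yW: "y \<in> W" unfolding y_def T'_def by simp
  define pl qk where "pl i = of_real (lam i) * p1 ?z i" and "qk i = of_real (kap i) * p2 ?z i" for i
  have coeff: "\<i> * of_real (dot (2 * N) (mode s) \<omega>) * (coupling s * cis (dot (2 * N) (mode s) \<theta>)) * ip x (w (snd s))
      = \<i> * (p1 ?z (fst s) * qk (snd s) * ip (g (snd s)) (f (fst s)) * ip x (w (snd s)))
      + (- \<i>) * (pl (fst s) * p2 ?z (snd s) * ip (g (snd s)) (f (fst s)) * ip x (w (snd s)))"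
    if "s \<in> ?S" for s
  proof -
    have "dot (2 * N) (mode s) \<omega> = kap (snd s) - lam (fst s)" using that by (auto simp: dot_mode \<omega>_idx)
    then show ?thesis
      unfolding p12_circ[OF that, symmetric] coupling_def pl_def qk_def by (simp only:) (simp add: algebra_simps)
  qed
  have "(\<Sum>s\<in>?S. (\<i> * of_real (dot (2 * N) (mode s) \<omega>) * (coupling s * cis (dot (2 * N) (mode s) \<theta>))
      * ip x (w (snd s))) \<odot> f (fst s))
    = (\<Sum>s\<in>?S. \<i> \<odot> ((p1 ?z (fst s) * qk (snd s) * ip (g (snd s)) (f (fst s)) * ip x (w (snd s))) \<odot> f (fst s))
      + (- \<i>) \<odot> ((pl (fst s) * p2 ?z (snd s) * ip (g (snd s)) (f (fst s)) * ip x (w (snd s))) \<odot> f (fst s)))"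
    by (intro sum.cong refl, subst coeff) (simp_all only: scl_add_left scl_simps)
  also have "\<dots> = \<i> \<odot> dia f (p1 ?z) (dia g qk (T x)) + (- \<i>) \<odot> dia f pl (dia g (p2 ?z) (T x))"
    unfolding dia_rank_one_sum[OF x] sum.distrib scl_sum ..
  also have "dia g qk (T x) = T (H (T (H (U2 ?z (T x)))))"
  proof -
    have "T (H (T (H (U2 ?z (T x))))) = dia g (\<lambda>i. of_real (kap i)) (U2 ?z (T x))"
      by (rule eigenbasis_apply[OF g_on K_lin2 g_eig U_in(2)])
    also have "\<dots> = dia g qk (T x)" unfolding U2_def qk_def using x by (intro dia_comp[OF g_on]) simp
    finally show ?thesis by (rule sym)
  qed
  also have "dia f pl (dia g (p2 ?z) (T x)) = H (H y)"
  proof -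
    have "H (H y) = dia f (\<lambda>i. of_real (lam i)) y" by (rule eigenbasis_apply[OF f_on H_lin2 f_eig yW])
    also have "\<dots> = dia f pl (dia g (p2 ?z) (T x))"
      unfolding y_def T'_def U1_def U2_def pl_def by (intro dia_comp[OF f_on] dia_in[OF g_on])
    finally show ?thesis by (rule sym)
  qed
  also have "dia f (p1 ?z) (T (H (T (H (U2 ?z (T x)))))) = U1 ?z (T (H (T (H (U1 (\<lambda>j. cnj (?z j)) y)))))"
    unfolding y_def T'_def unfolding U_cancel(2)[OF circ_torus U_in(2)] unfolding U1_def ..
  also have "U1 ?z (T (H (T (H (U1 (\<lambda>j. cnj (?z j)) y))))) = H (H y) - ip y (U1 ?z u) \<odot> U1 ?z u"
    using generator_rank_one[OF circ_torus[of \<theta>] yW] by (simp add: algebra_simps)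
  also have "\<i> \<odot> (H (H y) - ip y (U1 ?z u) \<odot> U1 ?z u) + (- \<i>) \<odot> H (H y)
      = (- \<i> * ip y (U1 ?z u)) \<odot> U1 ?z u"
    by (simp add: fun_eq_iff algebra_simps)
  finally show ?thesis unfolding y_def .
qed

text \<open>Put v = U1 u. Differentiating v inside (T'^k v|e) contributes -i H^2 v, and H^2 is also
  the square of \<open>H'\<close>. Differentiating the factors \<open>T'\<close> contributes -i
  times the sum over j < k of (T'^(k-j) v|v) (T'^j v|e). Together these are -i times
  \<open>szego_nl_Ju\<close> for the deformed pair.\<close>

lemma \<Phi>_flow:
  "((\<lambda>t. \<Phi> (\<lambda>j. \<omega> j * t) k) has_vector_derivative - \<i> * szego_nl (\<Phi> (\<lambda>j. \<omega> j * t)) k) (at t)"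
proof -
  \<comment> \<open>The summand 0 gives the ray through the origin the affine form \<theta> + t h of
    the derivative lemmas.\<close>
  define L where "L t = (\<lambda>j. 0 + t * \<omega> j)" for t
  define z where "z = circ (L t)"
  have z: "z \<in> torus" unfolding z_def by (rule circ_torus)
  obtain C r where D: "decaying_hankel_pair W ip N b (T' z) (H' z) e C r"
    using T'_uniform_decay z by blast
  interpret D: decaying_hankel_pair W ip N b "T' z" "H' z" e C r by (rule D)
  have Du: "D.u = U1 z u" unfolding D.u_def H'_def u_def ..
  have \<Phi>_J: "\<Phi> (L t) = D.J (U1 z u)" unfolding \<Phi>_def D.J_def unfolding z_def ..
  have fW: "\<And>i. i < N \<Longrightarrow> f i \<in> W" using f_on by (rule on_famD)
  let ?S = "{..<N} \<times> {..<N}"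
  let ?c = "\<lambda>s. \<i> * of_real (dot (2 * N) (mode s) \<omega>) * (coupling s * cis (dot (2 * N) (mode s) (L t)))"
  let ?D = "\<lambda>x. \<Sum>j<k. \<Sum>s\<in>?S. ?c s * ip ((T' z ^^ (k - 1 - j)) x) (w (snd s)) * ip ((T' z ^^ j) (f (fst s))) e"
  have "((\<lambda>t. \<Sum>i<N. ip u (f i) * (cis (dot (2 * N) (\<mu> i) (L t)) * ip ((T' (circ (L t)) ^^ k) (f i)) e))
      has_vector_derivative
      (\<Sum>i<N. ip u (f i) * (cis (dot (2 * N) (\<mu> i) (L t)) * ?D (f i)
        + \<i> * of_real (dot (2 * N) (\<mu> i) \<omega>) * cis (dot (2 * N) (\<mu> i) (L t)) * ip ((T' z ^^ k) (f i)) e))) (at t)"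
    unfolding L_def z_def
    by (intro has_vector_derivative_sum has_vector_derivative_mult_right has_vector_derivative_mult
        cis_line_derivative P.Apow_derivative fW e_in) auto
  moreover have "(\<lambda>t. \<Sum>i<N. ip u (f i) * (cis (dot (2 * N) (\<mu> i) (L t)) * ip ((T' (circ (L t)) ^^ k) (f i)) e))
      = (\<lambda>t. \<Phi> (L t) k)"
    unfolding \<Phi>_exp by (intro ext sum.cong refl) (simp add: p1_circ mult_ac)
  moreover have "(\<Sum>i<N. ip u (f i) * (cis (dot (2 * N) (\<mu> i) (L t)) * ?D (f i)
        + \<i> * of_real (dot (2 * N) (\<mu> i) \<omega>) * cis (dot (2 * N) (\<mu> i) (L t)) * ip ((T' z ^^ k) (f i)) e))
      = - \<i> * szego_nl (\<Phi> (L t)) k"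
  proof -
    have "(\<Sum>i<N. ip u (f i) * (cis (dot (2 * N) (\<mu> i) (L t)) * ?D (f i)
        + \<i> * of_real (dot (2 * N) (\<mu> i) \<omega>) * cis (dot (2 * N) (\<mu> i) (L t)) * ip ((T' z ^^ k) (f i)) e))
      = (\<Sum>i<N. p1 z i * ip u (f i) * ?D (f i))
        + (\<Sum>i<N. - \<i> * ((of_real (lam i) * p1 z i) * ip u (f i) * ip ((T' z ^^ k) (f i)) e))"
      unfolding sum.distrib[symmetric]
    proof (intro sum.cong refl)
      fix i assume "i \<in> {..<N}"
      then have i: "i < N" by simp
      show "ip u (f i) * (cis (dot (2 * N) (\<mu> i) (L t)) * ?D (f i)
        + \<i> * of_real (dot (2 * N) (\<mu> i) \<omega>) * cis (dot (2 * N) (\<mu> i) (L t)) * ip ((T' z ^^ k) (f i)) e)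
        = p1 z i * ip u (f i) * ?D (f i)
        + (- \<i> * ((of_real (lam i) * p1 z i) * ip u (f i) * ip ((T' z ^^ k) (f i)) e))"
        unfolding p1_circ[OF i, of "L t", folded z_def, symmetric] dot_\<mu>[OF i, of \<omega>] \<omega>_idx(1)[OF i]
        by (simp add: algebra_simps)
    qed
    also have "(\<Sum>i<N. - \<i> * ((of_real (lam i) * p1 z i) * ip u (f i) * ip ((T' z ^^ k) (f i)) e))
        = - \<i> * ip ((T' z ^^ k) (dia f (\<lambda>i. of_real (lam i) * p1 z i) u)) e"
      unfolding ip_lin_dia[OF f_on T'pow_lin e_in] sum_distrib_left ..
    also have "dia f (\<lambda>i. of_real (lam i) * p1 z i) u = dia f (\<lambda>i. of_real (lam i)) (U1 z u)"
      unfolding U1_def by (rule dia_comp[OF f_on u_in, symmetric])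
    also have "\<dots> = H (H (U1 z u))" by (rule eigenbasis_apply[OF f_on H_lin2 f_eig U_in(1), symmetric])
    also have "\<dots> = H' z (H' z (U1 z u))" by (rule H'H'[OF z U_in(1), symmetric])
    also have "(\<Sum>i<N. p1 z i * ip u (f i) * ?D (f i))
        = (\<Sum>j<k. \<Sum>s\<in>?S. ?c s * (\<Sum>i<N. p1 z i * ip u (f i) * ip ((T' z ^^ (k - 1 - j)) (f i)) (w (snd s)))
            * ip ((T' z ^^ j) (f (fst s))) e)"
    proof -
      have "(\<Sum>i<N. p1 z i * ip u (f i) * ?D (f i))
        = (\<Sum>i<N. \<Sum>j<k. \<Sum>s\<in>?S. ?c s * (p1 z i * ip u (f i) * ip ((T' z ^^ (k - 1 - j)) (f i)) (w (snd s)))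
            * ip ((T' z ^^ j) (f (fst s))) e)"
        unfolding sum_distrib_left by (intro sum.cong refl) (simp only: mult_ac)
      also have "\<dots> = (\<Sum>j<k. \<Sum>s\<in>?S. \<Sum>i<N. ?c s * (p1 z i * ip u (f i) * ip ((T' z ^^ (k - 1 - j)) (f i)) (w (snd s)))
            * ip ((T' z ^^ j) (f (fst s))) e)"
        by (rule trans[OF sum.swap sum.cong[OF refl sum.swap]])
      finally show ?thesis unfolding sum_distrib_left[symmetric] sum_distrib_right[symmetric] .
    qed
    also have "\<dots> = (\<Sum>j<k. \<Sum>s\<in>?S. ?c s * ip ((T' z ^^ (k - 1 - j)) (U1 z u)) (w (snd s)) * ip ((T' z ^^ j) (f (fst s))) e)"
    proof (intro sum.cong refl)
      fix j s assume s: "s \<in> ?S"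
      have "ip ((T' z ^^ (k - 1 - j)) (U1 z u)) (w (snd s))
          = (\<Sum>i<N. p1 z i * ip u (f i) * ip ((T' z ^^ (k - 1 - j)) (f i)) (w (snd s)))"
        unfolding U1_def using s w(1) by (intro ip_lin_dia[OF f_on T'pow_lin]) auto
      then show "?c s * (\<Sum>i<N. p1 z i * ip u (f i) * ip ((T' z ^^ (k - 1 - j)) (f i)) (w (snd s)))
            * ip ((T' z ^^ j) (f (fst s))) e
          = ?c s * ip ((T' z ^^ (k - 1 - j)) (U1 z u)) (w (snd s)) * ip ((T' z ^^ j) (f (fst s))) e"
        by (simp only:)
    qed
    \<comment> \<open>Linearity pulls the sum over s inside T'^j, where \<open>generator_sum\<close>
      collapses it; the \<open>T'\<close> appearing there raises the exponent k - 1 - j to k -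
      j.\<close>
    also have "\<dots> = (\<Sum>j<k. - \<i> * (ip ((T' z ^^ (k - j)) (U1 z u)) (U1 z u) * ip ((T' z ^^ j) (U1 z u)) e))"
    proof (intro sum.cong refl)
      fix j assume j: "j \<in> {..<k}"
      define x where "x = (T' z ^^ (k - 1 - j)) (U1 z u)"
      have xW: "x \<in> W" unfolding x_def by (rule semilinD(1)[OF T'pow_lin U_in(1)])
      have sW: "f (fst s) \<in> W" if "s \<in> ?S" for s using that fW by auto
      have "(\<Sum>s\<in>?S. ?c s * ip x (w (snd s)) * ip ((T' z ^^ j) (f (fst s))) e)
          = ip ((T' z ^^ j) (\<Sum>s\<in>?S. (?c s * ip x (w (snd s))) \<odot> f (fst s))) e"
      proof -
        have "(T' z ^^ j) (\<Sum>s\<in>?S. (?c s * ip x (w (snd s))) \<odot> f (fst s))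
            = (\<Sum>s\<in>?S. (T' z ^^ j) ((?c s * ip x (w (snd s))) \<odot> f (fst s)))"
          by (rule semilin_sum[OF T'pow_lin W_subsp]) (auto intro!: W_scl sW)
        also have "\<dots> = (\<Sum>s\<in>?S. (?c s * ip x (w (snd s))) \<odot> (T' z ^^ j) (f (fst s)))"
          by (intro sum.cong refl, subst semilinD(3)[OF T'pow_lin]) (use sW in auto)
        finally have "ip ((T' z ^^ j) (\<Sum>s\<in>?S. (?c s * ip x (w (snd s))) \<odot> f (fst s))) e
            = ip (\<Sum>s\<in>?S. (?c s * ip x (w (snd s))) \<odot> (T' z ^^ j) (f (fst s))) e" by (rule arg_cong)
        also have "\<dots> = (\<Sum>s\<in>?S. ip ((?c s * ip x (w (snd s))) \<odot> (T' z ^^ j) (f (fst s))) e)"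
          by (rule ip_sum) (auto intro!: W_scl semilinD(1)[OF T'pow_lin] sW)
        also have "\<dots> = (\<Sum>s\<in>?S. ?c s * ip x (w (snd s)) * ip ((T' z ^^ j) (f (fst s))) e)"
          by (intro sum.cong refl ip_scl semilinD(1)[OF T'pow_lin] sW e_in)
        finally show ?thesis by (rule sym)
      qed
      also have "(\<Sum>s\<in>?S. (?c s * ip x (w (snd s))) \<odot> f (fst s)) = (- \<i> * ip (T' z x) (U1 z u)) \<odot> U1 z u"
        using generator_sum[OF xW, of "L t"] unfolding z_def .
      also have "ip ((T' z ^^ j) ((- \<i> * ip (T' z x) (U1 z u)) \<odot> U1 z u)) e
          = (- \<i> * ip (T' z x) (U1 z u)) * ip ((T' z ^^ j) (U1 z u)) e"
        unfolding semilinD(3)[OF T'pow_lin U_in(1)] id_apply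
        by (intro ip_scl semilinD(1)[OF T'pow_lin] U_in e_in)
      also have "T' z x = (T' z ^^ (k - j)) (U1 z u)"
      proof -
        have "k - j = Suc (k - 1 - j)" using j by auto
        then show ?thesis unfolding x_def by simp
      qed
      finally show "(\<Sum>s\<in>?S. ?c s * ip ((T' z ^^ (k - 1 - j)) (U1 z u)) (w (snd s)) * ip ((T' z ^^ j) (f (fst s))) e)
          = - \<i> * (ip ((T' z ^^ (k - j)) (U1 z u)) (U1 z u) * ip ((T' z ^^ j) (U1 z u)) e)"
        unfolding x_def by (simp add: mult.assoc)
    qed
    finally show ?thesis
      unfolding \<Phi>_J D.szego_nl_Ju[unfolded Du] unfolding D.J_def
      by (simp add: sum_distrib_left distrib_left mult_ac)
  qed
  ultimately have "((\<lambda>t. \<Phi> (L t) k) has_vector_derivative - \<i> * szego_nl (\<Phi> (L t)) k) (at t)" by (simp only:)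
  moreover have "L t = (\<lambda>j. \<omega> j * t)" for t by (simp add: L_def mult.commute)
  ultimately show ?thesis by (simp only:)
qed

lemma \<Phi>_0: "\<Phi> (\<lambda>j. \<omega> j * 0) = J u"
proof -
  have z: "circ (\<lambda>j. \<omega> j * 0) = (\<lambda>j. 1)" by (simp add: circ_def fun_eq_iff)
  have U1: "U1 (\<lambda>j. 1) x = x" if "x \<in> W" for x
    unfolding U1_def using that by (intro dia_one[OF f_on]) (simp_all add: p1_def)
  have U2: "U2 (\<lambda>j. 1) x = x" if "x \<in> W" for x
    unfolding U2_def using that by (intro dia_one[OF g_on]) (simp_all add: p2_def)
  have T': "(T' (\<lambda>j. 1) ^^ k) x = (T ^^ k) x" if "x \<in> W" for k x
    using that by (induction k) (simp_all add: T'_def U1 U2)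
  show ?thesis unfolding \<Phi>_def z J_def by (simp add: U1 T')
qed

end

section \<open>Hankel operators with symbol in \<open>H\<^sup>1\<^sup>/\<^sup>2\<close>\<close>

lemma suminf_cauchy_schwarz:
  fixes a b :: "nat \<Rightarrow> real"
  assumes "summable (\<lambda>k. (a k)\<^sup>2)" "summable (\<lambda>k. (b k)\<^sup>2)"
  shows "summable (\<lambda>k. \<bar>a k * b k\<bar>)"
    and "(\<Sum>k. \<bar>a k * b k\<bar>)\<^sup>2 \<le> (\<Sum>k. (a k)\<^sup>2) * (\<Sum>k. (b k)\<^sup>2)"
proof -
  show s: "summable (\<lambda>k. \<bar>a k * b k\<bar>)"
  proof (rule summable_comparison_test'[OF summable_add[OF assms]])
    fix k
    have "2 * \<bar>a k\<bar> * \<bar>b k\<bar> \<le> \<bar>a k\<bar>\<^sup>2 + \<bar>b k\<bar>\<^sup>2" by (rule sum_squares_bound)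
    then have "\<bar>a k\<bar> * \<bar>b k\<bar> \<le> (a k)\<^sup>2 + (b k)\<^sup>2"
      using mult_nonneg_nonneg[of "\<bar>a k\<bar>" "\<bar>b k\<bar>"] unfolding power2_abs by linarith
    then show "norm \<bar>a k * b k\<bar> \<le> (a k)\<^sup>2 + (b k)\<^sup>2" by (simp add: abs_mult)
  qed
  have "(\<Sum>k<n. \<bar>a k * b k\<bar>)\<^sup>2 \<le> (\<Sum>k. (a k)\<^sup>2) * (\<Sum>k. (b k)\<^sup>2)" for n
  proof -
    have "(\<Sum>k<n. \<bar>a k\<bar> * \<bar>b k\<bar>)\<^sup>2 \<le> (\<Sum>k<n. \<bar>a k\<bar>\<^sup>2) * (\<Sum>k<n. \<bar>b k\<bar>\<^sup>2)"
      by (rule Cauchy_Schwarz_ineq_sum)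
    also have "\<dots> \<le> (\<Sum>k. (a k)\<^sup>2) * (\<Sum>k. (b k)\<^sup>2)"
      using assms by (intro mult_mono) (auto intro!: sum_le_suminf sum_nonneg suminf_nonneg)
    finally show ?thesis by (simp add: abs_mult)
  qed
  moreover have "(\<lambda>n. (\<Sum>k<n. \<bar>a k * b k\<bar>)\<^sup>2) \<longlonglongrightarrow> (\<Sum>k. \<bar>a k * b k\<bar>)\<^sup>2"
    by (intro tendsto_power summable_LIMSEQ s)
  ultimately show "(\<Sum>k. \<bar>a k * b k\<bar>)\<^sup>2 \<le> (\<Sum>k. (a k)\<^sup>2) * (\<Sum>k. (b k)\<^sup>2)"
    by (intro LIMSEQ_le_const2) auto
qed

definition L2 :: "seq set" where "L2 = {h. summable (\<lambda>k. (cmod (h k))\<^sup>2)}"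

lemma L2_eq: "{h. in_L2plus h} = L2"
  by (simp add: L2_def l2_sq_finite_iff)

definition lip :: "seq \<Rightarrow> seq \<Rightarrow> complex" where "lip x y = (\<Sum>k. x k * cnj (y k))"

lemma L2_summable_norm: "x \<in> L2 \<Longrightarrow> y \<in> L2 \<Longrightarrow> summable (\<lambda>k. cmod (x k) * cmod (y k))"
  using suminf_cauchy_schwarz(1)[of "\<lambda>k. cmod (x k)" "\<lambda>k. cmod (y k)"] by (simp add: L2_def abs_mult)

lemma L2_summable: "x \<in> L2 \<Longrightarrow> y \<in> L2 \<Longrightarrow> summable (\<lambda>k. x k * cnj (y k))"
  by (rule summable_norm_cancel) (simp add: norm_mult L2_summable_norm)

lemma L2_subsp: "subsp L2"
  unfolding subsp_def
proof (intro conjI ballI allI)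
  show "0 \<in> L2" by (simp add: L2_def)
  show "x + y \<in> L2" if "x \<in> L2" "y \<in> L2" for x y
  proof -
    have "summable (\<lambda>k. 2 * ((cmod (x k))\<^sup>2 + (cmod (y k))\<^sup>2))"
      using that by (intro summable_mult summable_add) (auto simp: L2_def)
    then have "summable (\<lambda>k. (cmod (x k + y k))\<^sup>2)"
    proof (rule summable_comparison_test')
      fix k
      have "(cmod (x k + y k))\<^sup>2 \<le> (cmod (x k) + cmod (y k))\<^sup>2"
        by (intro power_mono norm_triangle_ineq) simp
      also have "\<dots> \<le> 2 * ((cmod (x k))\<^sup>2 + (cmod (y k))\<^sup>2)"
        using sum_squares_bound[of "cmod (x k)" "cmod (y k)"] by (simp add: power2_sum)
      finally show "norm ((cmod (x k + y k))\<^sup>2) \<le> 2 * ((cmod (x k))\<^sup>2 + (cmod (y k))\<^sup>2)" by simp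
    qed
    then show ?thesis by (simp add: L2_def)
  qed
  show "c \<odot> x \<in> L2" if "x \<in> L2" for c x
    using that summable_mult[of "\<lambda>k. (cmod (x k))\<^sup>2" "(cmod c)\<^sup>2"]
    by (simp add: L2_def norm_mult power_mult_distrib)
qed

lemma lip_add: "x \<in> L2 \<Longrightarrow> y \<in> L2 \<Longrightarrow> z \<in> L2 \<Longrightarrow> lip (x + y) z = lip x z + lip y z"
  unfolding lip_def by (simp add: distrib_right suminf_add L2_summable)

lemma lip_scl: "x \<in> L2 \<Longrightarrow> z \<in> L2 \<Longrightarrow> lip (c \<odot> x) z = c * lip x z"
  unfolding lip_def by (simp add: mult.assoc suminf_mult L2_summable)

lemma lip_cnj: "x \<in> L2 \<Longrightarrow> y \<in> L2 \<Longrightarrow> lip y x = cnj (lip x y)"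
  using sums_unique[OF sums_cnj[THEN iffD2, OF summable_sums[OF L2_summable[of x y]]]]
  unfolding lip_def by (simp add: mult.commute)

lemma lip_pos:
  assumes "x \<in> L2" "x \<noteq> 0"
  shows "0 < Re (lip x x)"
proof -
  obtain k where k: "x k \<noteq> 0" using assms(2) by (auto simp: fun_eq_iff)
  have s: "summable (\<lambda>k. (cmod (x k))\<^sup>2)" using assms(1) by (simp add: L2_def)
  have "lip x x = of_real (\<Sum>k. (cmod (x k))\<^sup>2)"
    unfolding lip_def by (simp add: complex_norm_square[symmetric] suminf_of_real[OF s] del: of_real_power flip: of_real_power)
  moreover have "0 < (\<Sum>k. (cmod (x k))\<^sup>2)" by (rule suminf_pos2[OF s, of k]) (use k in auto)
  ultimately show ?thesis by simp
qed

lemma lip_sum: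
  assumes "finite I" "\<And>i. i \<in> I \<Longrightarrow> f i \<in> L2" "z \<in> L2"
  shows "lip (\<Sum>i\<in>I. f i) z = (\<Sum>i\<in>I. lip (f i) z)"
  using assms(1,2)
proof (induction I rule: finite_induct)
  case empty
  show ?case by (simp add: lip_def)
next
  case (insert i I)
  have "lip (f i + (\<Sum>i\<in>I. f i)) z = lip (f i) z + lip (\<Sum>i\<in>I. f i) z"
    using insert.prems by (intro lip_add subsp_sum[OF L2_subsp] assms(3)) auto
  then show ?case using insert by (simp only: sum.insert[OF insert.hyps]) simp
qed

definition ortho :: "nat \<Rightarrow> (nat \<Rightarrow> seq) \<Rightarrow> bool" where
  "ortho m c \<longleftrightarrow> (\<forall>i<m. c i \<in> L2) \<and> (\<forall>i<m. \<forall>j<m. lip (c i) (c j) = (if i = j then 1 else 0))"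

lemma ortho_residual:
  assumes c: "ortho m c" and x: "x \<in> L2" and j: "j < m"
  shows "lip (x - (\<Sum>i<m. lip x (c i) \<odot> c i)) (c j) = 0"
proof -
  have cL: "\<And>i. i < m \<Longrightarrow> c i \<in> L2" using c by (auto simp: ortho_def)
  have S: "(\<Sum>i<m. lip x (c i) \<odot> c i) \<in> L2" by (intro subsp_sum[OF L2_subsp] subspD(3)[OF L2_subsp]) (simp add: cL)
  have "lip (\<Sum>i<m. lip x (c i) \<odot> c i) (c j) = (\<Sum>i<m. lip x (c i) * lip (c i) (c j))"
    by (subst lip_sum) (auto intro!: sum.cong subspD(3)[OF L2_subsp] simp: cL j lip_scl)
  also have "\<dots> = (\<Sum>i<m. if i = j then lip x (c i) else 0)"
    using c j by (intro sum.cong) (auto simp: ortho_def)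
  also have "\<dots> = lip x (c j)" using j by simp
  finally show ?thesis
    using lip_add[OF x subspD(3)[OF L2_subsp S] cL[OF j], of "-1"] lip_scl[OF S cL[OF j], of "-1"]
    unfolding diff_eq_scl[of x] by simp
qed

text \<open>Expansions in both directions are carried along: that of c over b keeps the new vectors
  in the subspace, that of b over c later yields \<open>b_exp\<close>.\<close>

lemma gram_schmidt:
  assumes b: "\<And>i. i < N \<Longrightarrow> b i \<in> L2"
    and ind: "\<And>d. (\<Sum>i<N. d i \<odot> b i) = 0 \<Longrightarrow> (\<forall>i<N. d i = 0)"
  shows "m \<le> N \<Longrightarrow> \<exists>c. ortho m c \<and> (\<forall>j<m. \<exists>d. c j = (\<Sum>i<m. d i \<odot> b i)) \<and>
    (\<forall>i<m. b i = (\<Sum>j<m. lip (b i) (c j) \<odot> c j))"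
proof (induction m)
  case 0
  show ?case by (simp add: ortho_def)
next
  case (Suc m)
  from Suc.IH[OF Suc_leD[OF Suc.prems]] obtain c where c: "ortho m c" "\<And>j. j < m \<Longrightarrow> \<exists>d. c j = (\<Sum>i<m. d i \<odot> b i)"
    "\<And>i. i < m \<Longrightarrow> b i = (\<Sum>j<m. lip (b i) (c j) \<odot> c j)" by metis
  have cL: "\<And>i. i < m \<Longrightarrow> c i \<in> L2" using c(1) by (auto simp: ortho_def)
  have mN: "m < N" using Suc.prems by simp
  obtain D where D: "\<And>j. j < m \<Longrightarrow> c j = (\<Sum>i<m. D j i \<odot> b i)" using c(2) by metis
  define P where "P = (\<Sum>j<m. lip (b m) (c j) \<odot> c j)"
  define e where "e i = (\<Sum>j<m. lip (b m) (c j) * D j i)" for i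
  have P_b: "P = (\<Sum>i<m. e i \<odot> b i)"
  proof -
    have "P = (\<Sum>j<m. \<Sum>i<m. (lip (b m) (c j) * D j i) \<odot> b i)"
      unfolding P_def by (intro sum.cong refl, subst D) (simp_all add: scl_sum)
    also have "\<dots> = (\<Sum>i<m. e i \<odot> b i)"
      by (subst sum.swap) (simp add: e_def seqvs.scale_sum_left)
    finally show ?thesis .
  qed
  define x where "x = b m - P"
  have PL: "P \<in> L2" unfolding P_def by (intro subsp_sum[OF L2_subsp] subspD(3)[OF L2_subsp]) (simp add: cL)
  have xL: "x \<in> L2" unfolding x_def by (intro subspD(4)[OF L2_subsp] b mN PL)
  have x_b: "x = (\<Sum>i<Suc m. (if i = m then 1 else - e i) \<odot> b i)"
    unfolding x_def P_b by (simp add: fun_eq_iff sum_seq_apply sum_negf)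
  have "x \<noteq> 0"
  proof
    assume "x = 0"
    then have x0: "(\<Sum>i<Suc m. (if i = m then 1 else - e i) \<odot> b i) = 0" unfolding x_b .
    \<comment> \<open>\<open>ind\<close> concerns all N vectors, so the relation is padded with
      zeros; its coefficient 1 at m is the contradiction.\<close>
    have "(\<Sum>i<N. (if i = m then 1 else if i < m then - e i else 0) \<odot> b i)
        = (\<Sum>i<Suc m. (if i = m then 1 else if i < m then - e i else 0) \<odot> b i)"
      using mN by (intro sum.mono_neutral_right) auto
    also have "\<dots> = (\<Sum>i<Suc m. (if i = m then 1 else - e i) \<odot> b i)" by (intro sum.cong) auto
    finally have "(\<Sum>i<N. (if i = m then 1 else if i < m then - e i else 0) \<odot> b i) = 0" unfolding x0 .
    from ind[OF this] show False using mN by auto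
  qed
  then have nx: "0 < Re (lip x x)" by (rule lip_pos[OF xL])
  have lxx: "lip x x = of_real (Re (lip x x))" using lip_cnj[OF xL xL] by (simp add: complex_eq_iff)
  define s where "s = sqrt (Re (lip x x))"
  have s: "0 < s" "s * s = Re (lip x x)" using nx by (auto simp: s_def)
  define y where "y = of_real (1 / s) \<odot> x"
  have yL: "y \<in> L2" unfolding y_def by (rule subspD(3)[OF L2_subsp xL])
  have xc: "lip x (c j) = 0" if "j < m" for j
    unfolding x_def P_def by (rule ortho_residual[OF c(1) b[OF mN] that])
  have yc: "lip y (c j) = 0" "lip (c j) y = 0" if "j < m" for j
    using xc[OF that] lip_scl[OF xL cL[OF that]] lip_cnj[OF yL cL[OF that]] by (simp_all add: y_def)
  have xy: "lip x y = of_real s"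
  proof -
    have "lip y x = of_real (1 / s) * of_real (s * s)" unfolding y_def lip_scl[OF xL xL] s(2) lxx[symmetric] ..
    also have "\<dots> = of_real s" using s(1) by simp
    finally show ?thesis using lip_cnj[OF yL xL] by simp
  qed
  have yy: "lip y y = 1"
  proof -
    have "lip y y = of_real (1 / s) * lip x y" using lip_scl[OF xL yL, of "of_real (1 / s)"] by (simp add: y_def)
    then show ?thesis unfolding xy using s(1) by simp
  qed
  define c' where "c' = c(m := y)"
  have c'j: "c' j = c j" if "j < m" for j using that by (simp add: c'_def)
  have c'm: "c' m = y" by (simp add: c'_def)
  have on: "ortho (Suc m) c'"
    using c(1) yL yc yy unfolding ortho_def c'_def by (auto simp: less_Suc_eq)
  moreover have "\<exists>d. c' j = (\<Sum>i<Suc m. d i \<odot> b i)" if "j < Suc m" for j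
  proof (cases "j = m")
    case True
    have "y = (\<Sum>i<Suc m. (of_real (1 / s) * (if i = m then 1 else - e i)) \<odot> b i)"
      unfolding y_def x_b scl_sum scl_simps(4) ..
    then show ?thesis unfolding True c'm by (intro exI)
  next
    case False
    then have j: "j < m" using that by simp
    have "c j = (\<Sum>i<Suc m. (if i < m then D j i else 0) \<odot> b i)" unfolding D[OF j] by simp
    then show ?thesis unfolding c'j[OF j] by (intro exI)
  qed
  moreover have "b i = (\<Sum>j<Suc m. lip (b i) (c' j) \<odot> c' j)" if "i < Suc m" for i
  proof -
    have split: "(\<Sum>j<Suc m. lip (b i) (c' j) \<odot> c' j) = (\<Sum>j<m. lip (b i) (c j) \<odot> c j) + lip (b i) y \<odot> y"
      by (simp add: c'j c'm)
    show ?thesis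
    proof (cases "i = m")
      case True
      have "lip (b m) y = lip x y + lip P y"
        using lip_add[OF xL PL yL] by (simp add: x_def)
      also have "lip P y = (\<Sum>j<m. lip (b m) (c j) * lip (c j) y)"
        unfolding P_def by (subst lip_sum) (auto intro!: sum.cong subspD(3)[OF L2_subsp] simp: cL yL lip_scl)
      also have "\<dots> = 0" by (simp add: yc)
      finally have l: "lip (b m) y = of_real s" unfolding xy by simp
      have l': "lip (b m) y \<odot> y = x" unfolding l unfolding y_def using s(1) by simp
      show ?thesis unfolding split unfolding True P_def[symmetric] l' by (simp add: x_def)
    next
      case False
      then have i: "i < m" using that by simp
      have "lip (b i) y = (\<Sum>j<m. lip (b i) (c j) * lip (c j) y)"
      proof -
        have "lip (b i) y = lip (\<Sum>j<m. lip (b i) (c j) \<odot> c j) y" by (rule arg_cong[OF c(3)[OF i]])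
        also have "\<dots> = (\<Sum>j<m. lip (b i) (c j) * lip (c j) y)"
          by (subst lip_sum) (auto intro!: sum.cong subspD(3)[OF L2_subsp] simp: cL yL lip_scl)
        finally show ?thesis .
      qed
      also have "\<dots> = 0" by (simp add: yc)
      finally show ?thesis unfolding split using c(3)[OF i] by simp
    qed
  qed
  ultimately show ?case by blast
qed

lemma fin_ip_of_has_dim:
  assumes W: "subsp W" "W \<subseteq> L2" and "has_dim W N"
  shows "\<exists>c. fin_ip W lip N c"
proof -
  note comb = linear_combination_eq[where I = "{..<N}"]
  obtain b where ind: "\<And>c. (\<forall>k. (\<Sum>i<N. c i * b i k) = 0) \<Longrightarrow> (\<forall>i<N. c i = 0)"
    and W_eq0: "W = {(\<lambda>k. \<Sum>i<N. c i * b i k) | c. True}"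
    using assms(3) unfolding has_dim_def by blast
  have W_eq: "W = {(\<Sum>i<N. c i \<odot> b i) | c. True}" using W_eq0 unfolding comb .
  have bW: "b i \<in> W" if "i < N" for i
    unfolding W_eq using that
    by (intro CollectI exI[of _ "\<lambda>j. if j = i then 1 else 0"])
       (simp add: fun_eq_iff sum_seq_apply if_distrib[of "\<lambda>c. c * _"] cong: if_cong)
  have ind': "\<forall>i<N. d i = 0" if z: "(\<Sum>i<N. d i \<odot> b i) = 0" for d
  proof (rule ind)
    show "\<forall>k. (\<Sum>i<N. d i * b i k) = 0" using fun_cong[OF z[folded comb]] by simp
  qed
  have bL: "\<And>i. i < N \<Longrightarrow> b i \<in> L2" using bW W(2) by blast
  obtain c where c: "ortho N c" "\<And>j. j < N \<Longrightarrow> \<exists>d. c j = (\<Sum>i<N. d i \<odot> b i)"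
    "\<And>i. i < N \<Longrightarrow> b i = (\<Sum>j<N. lip (b i) (c j) \<odot> c j)"
  proof -
    have "\<exists>c. ortho N c \<and> (\<forall>j<N. \<exists>d. c j = (\<Sum>i<N. d i \<odot> b i)) \<and>
      (\<forall>i<N. b i = (\<Sum>j<N. lip (b i) (c j) \<odot> c j))"
      by (rule gram_schmidt[OF bL ind' order_refl])
    then show ?thesis using that by metis
  qed
  have cL: "\<And>i. i < N \<Longrightarrow> c i \<in> L2" using c(1) by (auto simp: ortho_def)
  have exp: "x = (\<Sum>j<N. lip x (c j) \<odot> c j)" if "x \<in> W" for x
  proof -
    obtain d where x: "x = (\<Sum>i<N. d i \<odot> b i)" using \<open>x \<in> W\<close> unfolding W_eq by blast
    have "x = (\<Sum>i<N. d i \<odot> (\<Sum>j<N. lip (b i) (c j) \<odot> c j))"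
      unfolding x by (intro sum.cong refl arg_cong[of _ _ "\<lambda>y. _ \<odot> y"] c(3)) simp
    also have "\<dots> = (\<Sum>j<N. (\<Sum>i<N. d i * lip (b i) (c j)) \<odot> c j)"
      unfolding scl_sum scl_simps(4) by (subst sum.swap) (simp add: seqvs.scale_sum_left)
    also have "\<dots> = (\<Sum>j<N. lip x (c j) \<odot> c j)"
    proof (intro sum.cong refl)
      fix j assume "j \<in> {..<N}"
      then have "lip x (c j) = (\<Sum>i<N. d i * lip (b i) (c j))"
        unfolding x by (subst lip_sum) (auto intro!: sum.cong subspD(3)[OF L2_subsp] simp: bL cL lip_scl)
      then show "(\<Sum>i<N. d i * lip (b i) (c j)) \<odot> c j = lip x (c j) \<odot> c j" by simp
    qed
    finally show ?thesis .
  qed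
  have "fin_ip W lip N c"
  proof unfold_locales
    show "subsp W" by (rule W(1))
    show "lip (x + y) z = lip x z + lip y z" if "x \<in> W" "y \<in> W" "z \<in> W" for x y z
      using that W(2) by (intro lip_add) auto
    show "lip (a \<odot> x) z = a * lip x z" if "x \<in> W" "z \<in> W" for a x z
      using that W(2) by (intro lip_scl) auto
    show "lip y x = cnj (lip x y)" if "x \<in> W" "y \<in> W" for x y
      using that W(2) by (intro lip_cnj) auto
    show "0 < Re (lip x x)" if "x \<in> W" "x \<noteq> 0" for x
      using that W(2) by (intro lip_pos) auto
    show "c i \<in> W" if "i < N" for i unfolding W_eq using c(2)[OF that] by blast
    show "lip (c i) (c j) = (if i = j then 1 else 0)" if "i < N" "j < N" for i j
      using c(1) that by (auto simp: ortho_def)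
    show "x = (\<Sum>i<N. lip x (c i) \<odot> c i)" if "x \<in> W" for x by (rule exp[OF that])
  qed
  then show ?thesis by blast
qed

section \<open>Half-order weights and the Hankel operator on l2\<close>

lemma half_weight_bounds:
  "1 + real k \<le> 2 * (1 + (real k)\<^sup>2) powr (1/2)" "(1 + (real k)\<^sup>2) powr (1/2) \<le> 1 + real k"
proof -
  have sq: "(1 + (real k)\<^sup>2) powr (1/2) = sqrt (1 + (real k)\<^sup>2)"
    by (rule powr_half_sqrt) (simp add: add_nonneg_nonneg)
  have "1 \<le> sqrt (1 + (real k)\<^sup>2)" "real k \<le> sqrt (1 + (real k)\<^sup>2)"
    by (rule real_le_rsqrt, simp)+
  then show "1 + real k \<le> 2 * (1 + (real k)\<^sup>2) powr (1/2)" unfolding sq by linarith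
  show "(1 + (real k)\<^sup>2) powr (1/2) \<le> 1 + real k"
    unfolding sq by (rule real_le_lsqrt) (auto simp: power2_sum)
qed

text \<open>The weight 1 + k is equivalent to the Sobolev weight and has a combinatorial meaning: it
  is the number of entries on an antidiagonal of the Hankel matrix.\<close>

lemma in_Hs_half_iff: "in_Hs_plus (1/2) u \<longleftrightarrow> summable (\<lambda>k. (1 + real k) * (cmod (u k))\<^sup>2)"
  unfolding in_Hs_plus_iff
proof
  show "summable (\<lambda>k. (1 + real k) * (cmod (u k))\<^sup>2)" if "summable (\<lambda>k. (1 + (real k)\<^sup>2) powr (1/2) * (cmod (u k))\<^sup>2)"
    using summable_mult[OF that, of 2]
    by (rule summable_comparison_test') (use half_weight_bounds(1) in \<open>simp add: mult.assoc[symmetric] mult_right_mono\<close>)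
  show "summable (\<lambda>k. (1 + (real k)\<^sup>2) powr (1/2) * (cmod (u k))\<^sup>2)" if "summable (\<lambda>k. (1 + real k) * (cmod (u k))\<^sup>2)"
    using that by (rule summable_comparison_test') (use half_weight_bounds(2) in \<open>simp add: mult_right_mono\<close>)
qed

definition Hhalf :: "seq set" where "Hhalf = {u. summable (\<lambda>k. (1 + real k) * (cmod (u k))\<^sup>2)}"

lemma Hhalf_L2: "u \<in> Hhalf \<Longrightarrow> u \<in> L2"
proof -
  assume "u \<in> Hhalf"
  then have "summable (\<lambda>k. (1 + real k) * (cmod (u k))\<^sup>2)" by (simp add: Hhalf_def)
  then have "summable (\<lambda>k. (cmod (u k))\<^sup>2)"
    by (rule summable_comparison_test') (simp add: distrib_right)
  then show "u \<in> L2" by (simp add: L2_def)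
qed

lemma L2_shift:
  assumes "u \<in> L2"
  shows "(\<lambda>j. u (k + j)) \<in> L2"
  using assms summable_iff_shift[of "\<lambda>j. (cmod (u j))\<^sup>2" k] by (simp add: L2_def add.commute)

lemma Hhalf_Suc: "u \<in> Hhalf \<Longrightarrow> (\<lambda>k. u (Suc k)) \<in> Hhalf"
proof -
  assume "u \<in> Hhalf"
  then have "summable (\<lambda>k. (1 + real (Suc k)) * (cmod (u (Suc k)))\<^sup>2)"
    unfolding Hhalf_def using summable_Suc_iff[of "\<lambda>k. (1 + real k) * (cmod (u k))\<^sup>2"] by simp
  then have "summable (\<lambda>k. (1 + real k) * (cmod (u (Suc k)))\<^sup>2)"
    by (rule summable_comparison_test') (simp add: mult_right_mono)
  then show ?thesis by (simp add: Hhalf_def)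
qed

text \<open>Each |u_n|^2 lies in the n + 1 tails that start at some k <= n. The sum of all tails is
  the squared Hilbert-Schmidt norm of the Hankel operator.\<close>

lemma tails_summable:
  assumes u: "u \<in> Hhalf"
  shows "summable (\<lambda>k. \<Sum>j. (cmod (u (k + j)))\<^sup>2)"
proof (rule summableI_nonneg_bounded)
  let ?a = "\<lambda>n. (cmod (u n))\<^sup>2"
  have sa: "summable ?a" using Hhalf_L2[OF u] by (simp add: L2_def)
  have sk: "summable (\<lambda>j. ?a (k + j))" for k
    using L2_shift[OF Hhalf_L2[OF u], of k] by (simp add: L2_def)
  show "0 \<le> (\<Sum>j. ?a (k + j))" for k by (rule suminf_nonneg[OF sk]) simp
  have cut: "summable (\<lambda>n. if k \<le> n then ?a n else 0)" for k
    by (rule summable_comparison_test'[OF sa]) simp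
  have tail: "(\<Sum>j. ?a (k + j)) = (\<Sum>n. if k \<le> n then ?a n else 0)" for k
    using suminf_split_initial_segment[OF cut[of k], of k] by (simp add: add.commute)
  show "(\<Sum>k<K. \<Sum>j. ?a (k + j)) \<le> (\<Sum>n. (1 + real n) * ?a n)" for K
  proof -
    have "(\<Sum>k<K. \<Sum>j. ?a (k + j)) = (\<Sum>n. \<Sum>k<K. if k \<le> n then ?a n else 0)"
      unfolding tail by (rule suminf_sum[symmetric]) (rule cut)
    also have "\<dots> \<le> (\<Sum>n. (1 + real n) * ?a n)"
    proof (rule suminf_le)
      fix n
      have "(\<Sum>k<K. if k \<le> n then ?a n else 0) = (\<Sum>k\<in>{..<K} \<inter> {..n}. ?a n)"
        by (subst sum.inter_restrict) auto
      also have "\<dots> = real (card ({..<K} \<inter> {..n})) * ?a n" by simp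
      also have "\<dots> \<le> (1 + real n) * ?a n"
        using card_mono[of "{..n}" "{..<K} \<inter> {..n}"] by (intro mult_right_mono) auto
      finally show "(\<Sum>k<K. if k \<le> n then ?a n else 0) \<le> (1 + real n) * ?a n" .
    qed (use u in \<open>auto simp: Hhalf_def intro!: summable_sum cut\<close>)
    finally show ?thesis .
  qed
qed

text \<open>The absolute values stand inside the sum because this form also justifies the
  interchange of summations in \<open>hankel_symmetric\<close>.\<close>

lemma hankel_abs_L2:
  assumes u: "u \<in> Hhalf" and h: "h \<in> L2"
  shows "summable (\<lambda>k. (\<Sum>j. cmod (u (k + j)) * cmod (h j))\<^sup>2)"
proof -
  have s: "summable (\<lambda>k. (\<Sum>j. (cmod (u (k + j)))\<^sup>2) * (\<Sum>j. (cmod (h j))\<^sup>2))"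
    by (intro summable_mult2 tails_summable u)
  then show ?thesis
  proof (rule summable_comparison_test')
    fix k
    show "norm ((\<Sum>j. cmod (u (k + j)) * cmod (h j))\<^sup>2) \<le> (\<Sum>j. (cmod (u (k + j)))\<^sup>2) * (\<Sum>j. (cmod (h j))\<^sup>2)"
      using suminf_cauchy_schwarz(2)[of "\<lambda>j. cmod (u (k + j))" "\<lambda>j. cmod (h j)"]
        L2_shift[OF Hhalf_L2[OF u], of k] h by (simp add: L2_def abs_mult)
  qed
qed

lemma hankel_summable:
  assumes "u \<in> Hhalf" "h \<in> L2"
  shows "summable (\<lambda>j. u (k + j) * cnj (h j))"
  by (rule L2_summable[OF L2_shift[OF Hhalf_L2[OF assms(1)]] assms(2)])

lemma hankel_lip: "hankel u h k = lip (\<lambda>j. u (k + j)) h"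
  by (simp add: hankel_def lip_def)

lemma hankel_in_L2:
  assumes u: "u \<in> Hhalf" and h: "h \<in> L2"
  shows "hankel u h \<in> L2"
proof -
  have "cmod (hankel u h k) \<le> (\<Sum>j. cmod (u (k + j)) * cmod (h j))" for k
    unfolding hankel_def
    using summable_norm[of "\<lambda>j. u (k + j) * cnj (h j)"] L2_summable_norm[OF L2_shift[OF Hhalf_L2[OF u]] h]
    by (simp add: norm_mult)
  then have le: "norm ((cmod (hankel u h k))\<^sup>2) \<le> (\<Sum>j. cmod (u (k + j)) * cmod (h j))\<^sup>2" for k
    by (simp add: power_mono)
  have "summable (\<lambda>k. (cmod (hankel u h k))\<^sup>2)"
    by (rule summable_comparison_test'[OF hankel_abs_L2[OF assms]]) (rule le)
  then show ?thesis by (simp add: L2_def)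
qed

lemma hankel_symmetric:
  assumes u: "u \<in> Hhalf" and x: "x \<in> L2" and y: "y \<in> L2"
  shows "lip (hankel u x) y = lip (hankel u y) x"
proof -
  define F where "F k j = u (k + j) * cnj (x j) * cnj (y k)" for k j
  have nF: "norm (F k j) = cmod (u (k + j)) * cmod (x j) * cmod (y k)" for k j
    by (simp add: F_def norm_mult)
  have s1: "summable (\<lambda>j. cmod (u (k + j)) * cmod (x j))" for k
    by (rule L2_summable_norm[OF L2_shift[OF Hhalf_L2[OF u]] x])
  have 1: "summable (\<lambda>j. norm (F k j))" for k unfolding nF by (intro summable_mult2 s1)
  have eq: "(\<Sum>j. norm (F k j)) = (\<Sum>j. cmod (u (k + j)) * cmod (x j)) * cmod (y k)" for k
    unfolding nF by (rule suminf_mult2[OF s1, symmetric])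
  have "summable (\<lambda>k. \<bar>(\<Sum>j. cmod (u (k + j)) * cmod (x j)) * cmod (y k)\<bar>)"
    by (rule suminf_cauchy_schwarz(1)) (use hankel_abs_L2[OF u x] y in \<open>auto simp: L2_def\<close>)
  then have 2: "summable (\<lambda>k. \<Sum>j. norm (F k j))"
    unfolding eq by (rule summable_rabs_cancel)
  have "lip (hankel u x) y = (\<Sum>k. \<Sum>j. F k j)"
    unfolding lip_def hankel_def F_def by (intro suminf_cong suminf_mult2 hankel_summable[OF u x])
  also have "\<dots> = (\<Sum>j. \<Sum>k. F k j)" by (rule suminf_swap(1)[OF 1 2])
  also have "\<dots> = lip (hankel u y) x"
    unfolding lip_def hankel_def
  proof (intro suminf_cong)
    fix j
    have "(\<Sum>k. F k j) = (\<Sum>k. u (j + k) * cnj (y k) * cnj (x j))"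
      unfolding F_def by (simp add: add.commute mult.commute mult.left_commute)
    also have "\<dots> = (\<Sum>k. u (j + k) * cnj (y k)) * cnj (x j)"
      by (rule suminf_mult2[OF hankel_summable[OF u y], symmetric])
    finally show "(\<Sum>k. F k j) = (\<Sum>k. u (j + k) * cnj (y k)) * cnj (x j)" .
  qed
  finally show ?thesis .
qed

lemma hankel_semilin: "u \<in> Hhalf \<Longrightarrow> semilin cnj L2 (hankel u)"
  unfolding semilin_def
proof (intro conjI ballI allI)
  assume u: "u \<in> Hhalf"
  have uL: "(\<lambda>j. u (k + j)) \<in> L2" for k by (rule L2_shift[OF Hhalf_L2[OF u]])
  fix x assume x: "x \<in> L2"
  show "hankel u x \<in> L2" by (rule hankel_in_L2[OF u x])
  show "hankel u (x + y) = hankel u x + hankel u y" if y: "y \<in> L2" for y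
  proof
    fix k
    have "hankel u (x + y) k = hankel u x k + hankel u y k"
      unfolding hankel_lip
      using lip_cnj[OF subspD(2)[OF L2_subsp x y] uL[of k]] lip_add[OF x y uL[of k]]
        lip_cnj[OF x uL[of k]] lip_cnj[OF y uL[of k]] by (simp only: complex_cnj_add)
    then show "hankel u (x + y) k = (hankel u x + hankel u y) k" by (rule trans[OF _ plus_fun_apply[symmetric]])
  qed
  show "hankel u (c \<odot> x) = cnj c \<odot> hankel u x" for c
  proof
    fix k
    have "hankel u (c \<odot> x) k = cnj c * hankel u x k"
      unfolding hankel_lip
      using lip_cnj[OF subspD(3)[OF L2_subsp x, of c] uL[of k]] lip_scl[OF x uL[of k], of c]
        lip_cnj[OF x uL[of k]] by (simp only: complex_cnj_mult)
    then show "hankel u (c \<odot> x) k = (cnj c \<odot> hankel u x) k" by (rule trans[OF _ scl_apply[symmetric]])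
  qed
qed

definition delta :: "nat \<Rightarrow> seq" where "delta k = (\<lambda>j. if j = k then 1 else 0)"

lemma delta_L2: "delta k \<in> L2"
  unfolding L2_def delta_def mem_Collect_eq by (rule summable_finite[of "{k}"]) auto

lemma hankel_delta: "hankel u (delta k) = (\<lambda>j. u (k + j))"
proof
  fix n
  have "(\<lambda>j. u (n + j) * cnj (delta k j)) sums (\<Sum>j\<in>{k}. u (n + j) * cnj (delta k j))"
    by (rule sums_finite) (auto simp: delta_def)
  then show "hankel u (delta k) n = u (k + n)"
    unfolding hankel_def by (simp add: sums_iff delta_def add.commute)
qed

definition lshift :: "seq \<Rightarrow> seq" where "lshift x = (\<lambda>k. x (Suc k))"

lemma shift_L2: "h \<in> L2 \<Longrightarrow> shift h \<in> L2"
  unfolding L2_def using summable_Suc_iff[of "\<lambda>k. (cmod (shift h k))\<^sup>2"] by (simp add: shift_def)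

text \<open>K_u is the backward shift after H_u, and that composition is the Hankel operator of the
  shifted symbol; the second reading gives the symmetry of TH.\<close>

lemma hankelK_lshift:
  assumes "u \<in> Hhalf" "h \<in> L2"
  shows "hankelK u h = lshift (hankel u h)" "hankel (\<lambda>k. u (Suc k)) h = lshift (hankel u h)"
proof -
  show "hankelK u h = lshift (hankel u h)"
  proof
    fix k
    have "hankelK u h k = (\<Sum>j. u (k + Suc j) * cnj (shift h (Suc j)))"
      unfolding hankelK_def hankel_def
      by (subst suminf_split_head[OF hankel_summable[OF assms(1) shift_L2[OF assms(2)]]]) (simp add: shift_def)
    then show "hankelK u h k = lshift (hankel u h) k" by (simp add: lshift_def hankel_def shift_def)
  qed
  show "hankel (\<lambda>k. u (Suc k)) h = lshift (hankel u h)" by (simp add: lshift_def hankel_def fun_eq_iff)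
qed

lemma lshift_L2: "x \<in> L2 \<Longrightarrow> lshift x \<in> L2"
  using L2_shift[of x 1] by (simp add: lshift_def)

lemma lshift_semilin: "semilin id L2 lshift"
  unfolding semilin_def by (auto simp: lshift_L2) (auto simp: lshift_def fun_eq_iff)

lemma lip_lshift:
  assumes "x \<in> L2" "y \<in> L2"
  shows "lip (lshift x) (lshift y) = lip x y - x 0 * cnj (y 0)"
  using suminf_split_head[OF L2_summable[OF assms]] unfolding lip_def lshift_def by simp

text \<open>A unimodular eigenvalue makes |x_k| constant in k, which square summability allows only
  for x = 0.\<close>

lemma lshift_stable:
  assumes "x \<in> L2" "lshift x = c \<odot> x" "cmod c = 1"
  shows "x = 0"
proof -
  have "cmod (x (Suc k)) = cmod (x k)" for k
    using fun_cong[OF assms(2), of k] assms(3) by (simp add: lshift_def norm_mult)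
  then have e: "cmod (x k) = cmod (x 0)" for k by (induction k) auto
  have "(\<lambda>k. (cmod (x k))\<^sup>2) \<longlonglongrightarrow> 0" using assms(1) unfolding L2_def by (intro summable_LIMSEQ_zero) simp
  moreover have "(\<lambda>k. (cmod (x k))\<^sup>2) = (\<lambda>k. (cmod (x 0))\<^sup>2)"
    by (intro ext arg_cong[where f = "\<lambda>c. c\<^sup>2"] e)
  ultimately have "(\<lambda>k :: nat. (cmod (x 0))\<^sup>2) \<longlonglongrightarrow> 0" by (simp only:)
  then have "(cmod (x 0))\<^sup>2 = 0" by (rule LIMSEQ_const_iff[THEN iffD1])
  then have x0: "cmod (x 0) = 0" by simp
  show ?thesis
  proof
    fix k
    have "cmod (x k) = 0" by (rule trans[OF e x0])
    then show "x k = 0 k" by simp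
  qed
qed

lemma V_spectral_hankel_pair:
  assumes "u0 \<in> V d"
  shows "\<exists>W b H T e f g lam kap.
    spectral_hankel_pair W lip ((d + 1) div 2) b T H e f g lam kap \<and> has_dim (T ` W) (d div 2) \<and>
    hankel_pair.J lip T e (hankel_pair.u H e) = u0"
proof -
  define N where "N = (d + 1) div 2"
  define H where "H = hankel u0"
  define W where "W = H ` L2"
  have u: "u0 \<in> Hhalf" using assms unfolding V_def in_Hs_half_iff Hhalf_def by blast
  have Hs: "semilin cnj L2 H" unfolding H_def by (rule hankel_semilin[OF u])
  have H_L2: "\<And>x. x \<in> L2 \<Longrightarrow> H x \<in> L2" by (rule semilinD(1)[OF Hs])
  have WL: "W \<subseteq> L2" unfolding W_def using H_L2 by blast
  have Wd: "has_dim W N" using assms unfolding V_def op_rank_eq_def L2_eq W_def H_def N_def by blast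
  have Ws: "subsp W" unfolding W_def by (rule subsp_image[OF L2_subsp Hs surjI[of cnj cnj, OF complex_cnj_cnj]])
  have KW: "hankelK u0 ` L2 = lshift ` W"
    unfolding W_def H_def image_image using hankelK_lshift(1)[OF u] by (rule image_cong[OF refl])
  have Kd: "has_dim (lshift ` W) (d div 2)"
    using assms unfolding V_def op_rank_eq_def L2_eq mem_Collect_eq KW by blast
  obtain b where "fin_ip W lip N b" using fin_ip_of_has_dim[OF Ws WL Wd] by blast
  then interpret fin_ip W lip N b .
  have bL: "\<And>i. i < N \<Longrightarrow> b i \<in> L2" using b_in WL by blast
  \<comment> \<open>The rows of the Hankel matrix are the values H (delta k) and hence lie in
    \<open>W\<close>; a vector orthogonal to \<open>W\<close> is killed row by row.\<close>
  have kernel: "H h = 0" if h: "h \<in> L2" and orth: "\<And>i. i < N \<Longrightarrow> lip h (b i) = 0" for h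
  proof
    fix k
    have "(\<lambda>j. u0 (k + j)) \<in> W" unfolding W_def H_def hankel_delta[symmetric] by (rule imageI[OF delta_L2])
    then have wk: "(\<lambda>j. u0 (k + j)) = (\<Sum>i<N. lip (\<lambda>j. u0 (k + j)) (b i) \<odot> b i)" by (rule b_exp)
    have "H h k = lip (\<lambda>j. u0 (k + j)) h" unfolding H_def by (rule hankel_lip)
    also have "\<dots> = lip (\<Sum>i<N. lip (\<lambda>j. u0 (k + j)) (b i) \<odot> b i) h" using wk by (rule arg_cong)
    also have "\<dots> = (\<Sum>i<N. lip (\<lambda>j. u0 (k + j)) (b i) * lip (b i) h)"
      by (subst lip_sum) (auto intro!: sum.cong subspD(3)[OF L2_subsp] simp: bL h lip_scl)
    also have "\<dots> = 0" using orth lip_cnj[OF h bL] by simp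
    finally show "H h k = 0 k" by simp
  qed
  have b_ortho: "ortho N b" unfolding ortho_def using bL b_on by auto
  have H_eqI: "H x = H y" if x: "x \<in> L2" and y: "y \<in> L2" and "\<And>i. i < N \<Longrightarrow> lip (x - y) (b i) = 0" for x y
  proof -
    have "H (x - y) = 0" using that by (intro kernel subspD(4)[OF L2_subsp])
    moreover have "H (x - y) = H x - H y"
      unfolding diff_eq_scl[of x y] diff_eq_scl[of "H x"]
        semilinD(2)[OF Hs x subspD(3)[OF L2_subsp y]] semilinD(3)[OF Hs y] by simp
    ultimately show ?thesis by simp
  qed
  \<comment> \<open>The Riesz representer on \<open>W\<close> of the zeroth coefficient, that is,
    the projection of \<open>delta 0\<close>, the constant function 1.\<close>
  define e where "e = (\<Sum>i<N. cnj (b i 0) \<odot> b i)"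
  have eW: "e \<in> W" unfolding e_def by (intro W_sum W_scl) (simp add: b_in)
  have ev: "lip x e = x 0" if x: "x \<in> W" for x
  proof -
    have "lip x e = (\<Sum>i<N. b i 0 * lip x (b i))"
      unfolding e_def by (subst ip_sum2) (auto intro!: sum.cong simp: b_in x ip_scl2)
    also have "\<dots> = (\<Sum>i<N. lip x (b i) \<odot> b i) 0" by (simp add: sum_seq_apply mult.commute)
    also have "\<dots> = x 0" using b_exp[OF x] by (rule fun_cong[OF sym])
    finally show ?thesis .
  qed
  have TH: "lshift (H h) \<in> W" if h: "h \<in> L2" for h
  proof -
    have "lshift (H h) = H (shift h)"
      using hankelK_lshift(1)[OF u h] unfolding H_def hankelK_def by (rule sym)
    then show ?thesis unfolding W_def using shift_L2[OF h] by simp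
  qed
  have "hankel_pair W lip N b lshift H e"
  proof unfold_locales
    show "semilin id W lshift"
      by (rule semilin_subset[OF lshift_semilin WL]) (use TH in \<open>auto simp: W_def\<close>)
    show "semilin cnj W H"
      by (rule semilin_subset[OF Hs WL]) (use WL in \<open>auto simp: W_def\<close>)
    show "e \<in> W" by (rule eW)
    show "\<exists>y\<in>W. H y = x" if xW: "x \<in> W" for x
    proof -
      obtain h where h: "h \<in> L2" "x = H h" using xW unfolding W_def by blast
      \<comment> \<open>h and its projection p to \<open>W\<close> differ by a vector orthogonal to
        \<open>W\<close>, so they have the same image; H is already onto when restricted to
        \<open>W\<close>.\<close>
      define p where "p = (\<Sum>i<N. lip h (b i) \<odot> b i)"
      have pW: "p \<in> W" unfolding p_def by (intro W_sum W_scl) (simp add: b_in)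
      have "H h = H p"
      proof (rule H_eqI[OF h(1)])
        show "p \<in> L2" using pW WL by blast
        show "lip (h - p) (b i) = 0" if "i < N" for i
          unfolding p_def by (rule ortho_residual[OF b_ortho h(1) that])
      qed
      then show ?thesis using pW h(2) by metis
    qed
    show "lip (H x) y = lip (H y) x" if "x \<in> W" "y \<in> W" for x y
      unfolding H_def using that WL by (intro hankel_symmetric[OF u]) auto
    show "lip (lshift (H x)) y = lip (lshift (H y)) x" if "x \<in> W" "y \<in> W" for x y
    proof -
      have xy: "x \<in> L2" "y \<in> L2" using that WL by auto
      show ?thesis unfolding H_def hankelK_lshift(2)[OF u xy(1), symmetric] hankelK_lshift(2)[OF u xy(2), symmetric]
        by (rule hankel_symmetric[OF Hhalf_Suc[OF u] xy])
    qed
    show "lip (lshift x) (lshift y) = lip x y - lip x e * cnj (lip y e)" if "x \<in> W" "y \<in> W" for x y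
      unfolding ev[OF that(1)] ev[OF that(2)] using that WL by (intro lip_lshift) auto
    show "x = 0" if "x \<in> W" "lshift x = c \<odot> x" "cmod c = 1" for x c
      using that WL by (intro lshift_stable[of x c]) auto
  qed
  then interpret hankel_pair W lip N b lshift H e .
  have u_eq: "H e = u0"
  proof -
    have eL: "e \<in> L2" using eW WL by blast
    \<comment> \<open>\<open>e - delta 0\<close> is orthogonal to \<open>W\<close>, and H (delta 0)
      is the symbol.\<close>
    have "H e = H (delta 0)"
    proof (rule H_eqI[OF eL delta_L2])
      fix i assume i: "i < N"
      have "lip (delta 0) (b i) = cnj (b i 0)"
      proof -
        have "(\<lambda>k. delta 0 k * cnj (b i k)) sums (\<Sum>k\<in>{0}. delta 0 k * cnj (b i k))"
          by (rule sums_finite) (auto simp: delta_def)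
        then show ?thesis unfolding lip_def by (simp add: sums_iff delta_def)
      qed
      moreover have "lip e (b i) = cnj (b i 0)" using lip_cnj[OF bL[OF i] eL] ev[OF b_in[OF i]] by simp
      ultimately show "lip (e - delta 0) (b i) = 0"
        unfolding diff_eq_scl[of e]
        using lip_add[OF eL subspD(3)[OF L2_subsp delta_L2] bL[OF i], of "-1" 0] lip_scl[OF delta_L2 bL[OF i], of "-1" 0]
        by simp
    qed
    also have "\<dots> = u0" unfolding H_def hankel_delta by simp
    finally show ?thesis .
  qed
  have "J u = u0"
  proof
    fix k
    have "(lshift ^^ k) x j = x (k + j)" for x j by (induction k arbitrary: j) (simp_all add: lshift_def)
    then show "J u k = u0 k"
      unfolding J_def using ev[OF Tpow_in[OF u_in, of k]] u_eq by (simp add: u_def)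
  qed
  obtain f lam where f: "on_fam N f" "\<And>i. i < N \<Longrightarrow> H (H (f i)) = complex_of_real (lam i) \<odot> f i"
    using selfadjoint_eigenbasis[OF H_lin2 H2_selfadjoint] by blast
  obtain g kap where g: "on_fam N g" "\<And>i. i < N \<Longrightarrow> lshift (H (lshift (H (g i)))) = complex_of_real (kap i) \<odot> g i"
    using selfadjoint_eigenbasis[OF K_lin2 K2_selfadjoint] by blast
  have "spectral_hankel_pair W lip N b lshift H e f g lam kap"
    by unfold_locales (fact f g)+
  then show ?thesis using Kd \<open>J u = u0\<close> unfolding N_def by blast
qed

section \<open>Weak-strong uniqueness\<close>

definition ws :: "(nat \<Rightarrow> real) \<Rightarrow> seq \<Rightarrow> real" where
  "ws p x = (\<Sum>k. p k * (cmod (x k))\<^sup>2)"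

definition wfin :: "(nat \<Rightarrow> real) \<Rightarrow> seq \<Rightarrow> bool" where
  "wfin p x \<longleftrightarrow> summable (\<lambda>k. p k * (cmod (x k))\<^sup>2)"

text \<open>Fourier coefficients of the product of two functions with nonnegative
  frequencies.\<close>

definition cp :: "seq \<Rightarrow> seq \<Rightarrow> seq" where
  "cp x y = (\<lambda>n. \<Sum>i\<le>n. x i * y (n - i))"

text \<open>With the weights \<open>one\<close>, \<open>sqwt\<close> and \<open>wt\<close>,
  \<open>ws\<close> is a squared norm equivalent to that of L2, H^(1/4) and H^(1/2). High
  frequencies of an H^(1/2) function are small in the middle one.\<close>

abbreviation one :: "nat \<Rightarrow> real" where "one \<equiv> \<lambda>_. 1"
abbreviation wt :: "nat \<Rightarrow> real" where "wt \<equiv> \<lambda>k. 1 + real k"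
abbreviation sqwt :: "nat \<Rightarrow> real" where "sqwt \<equiv> \<lambda>k. sqrt (1 + real k)"

lemma cp_commute: "cp x y = cp y x"
proof
  fix n
  have "(\<Sum>i\<le>n. x i * y (n - i)) = (\<Sum>i\<le>n. x (n - i) * y (n - (n - i)))"
    by (rule sum.nat_diff_reindex[symmetric, of _ "Suc n", simplified lessThan_Suc_atMost, simplified])
  also have "\<dots> = (\<Sum>i\<le>n. y i * x (n - i))" by (intro sum.cong) (auto simp: mult.commute)
  finally show "cp x y n = cp y x n" by (simp add: cp_def)
qed

lemma cp_add_left: "cp (x + y) z = cp x z + cp y z"
  by (simp add: cp_def fun_eq_iff distrib_right sum.distrib)

lemma cp_add_right: "cp z (x + y) = cp z x + cp z y"
  by (simp add: cp_def fun_eq_iff distrib_left sum.distrib)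

lemma cmod_cp_le: "cmod (cp x y n) \<le> (\<Sum>i\<le>n. cmod (x i) * cmod (y (n - i)))"
  unfolding cp_def by (rule sum_norm_le) (simp add: norm_mult)

lemma ws_nonneg: "wfin p x \<Longrightarrow> (\<And>k. 0 \<le> p k) \<Longrightarrow> 0 \<le> ws p x"
  unfolding ws_def wfin_def by (rule suminf_nonneg) auto

text \<open>With \<open>p\<^sub>k = q\<^sub>k = 1 + k\<close> this is a discrete form of the embedding of \<open>H\<^sup>1\<^sup>/\<^sup>2\<close> into \<open>L\<^sup>4\<close>.\<close>
lemma cp_weighted:
  assumes p: "\<And>k. 0 < p k" and q: "\<And>k. 0 < q k" and C: "0 \<le> C" "\<And>n. (\<Sum>i\<le>n. 1 / (p i * q (n - i))) \<le> C"
    and x: "wfin p x" and y: "wfin q y"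
  shows "wfin one (cp x y)" "ws one (cp x y) \<le> C * (ws p x * ws q y)"
proof -
  define \<alpha> where "\<alpha> k = p k * (cmod (x k))\<^sup>2" for k
  define \<beta> where "\<beta> k = q k * (cmod (y k))\<^sup>2" for k
  have nn: "0 \<le> \<alpha> k" "0 \<le> \<beta> k" for k using p[of k] q[of k] by (simp_all add: \<alpha>_def \<beta>_def)
  have s: "summable (\<lambda>k. norm (\<alpha> k))" "summable (\<lambda>k. norm (\<beta> k))"
    using x y nn by (simp_all add: wfin_def \<alpha>_def[symmetric] \<beta>_def[symmetric])
  have prod: "summable (\<lambda>n. \<Sum>i\<le>n. \<alpha> i * \<beta> (n - i))" "(\<Sum>n. \<Sum>i\<le>n. \<alpha> i * \<beta> (n - i)) = ws p x * ws q y"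
    using summable_Cauchy_product[OF s] Cauchy_product[OF s] by (simp_all add: ws_def \<alpha>_def \<beta>_def)
  have le: "(cmod (cp x y n))\<^sup>2 \<le> C * (\<Sum>i\<le>n. \<alpha> i * \<beta> (n - i))" for n
  proof -
    define s where "s i = sqrt (p i * q (n - i))" for i
    have s: "0 < s i" "(s i)\<^sup>2 = p i * q (n - i)" for i using p[of i] q[of "n - i"] by (simp_all add: s_def)
    have "(cmod (cp x y n))\<^sup>2 \<le> (\<Sum>i\<le>n. cmod (x i) * cmod (y (n - i)))\<^sup>2"
      by (intro power_mono cmod_cp_le) simp
    also have "(\<Sum>i\<le>n. cmod (x i) * cmod (y (n - i))) = (\<Sum>i\<le>n. (1 / s i) * (s i * (cmod (x i) * cmod (y (n - i)))))"
    proof (intro sum.cong refl)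
      fix i
      show "cmod (x i) * cmod (y (n - i)) = (1 / s i) * (s i * (cmod (x i) * cmod (y (n - i))))"
        using s(1)[of i] by simp
    qed
    also have "\<dots>\<^sup>2 \<le> (\<Sum>i\<le>n. (1 / s i)\<^sup>2) * (\<Sum>i\<le>n. (s i * (cmod (x i) * cmod (y (n - i))))\<^sup>2)"
      by (rule Cauchy_Schwarz_ineq_sum)
    also have "\<dots> = (\<Sum>i\<le>n. 1 / (p i * q (n - i))) * (\<Sum>i\<le>n. \<alpha> i * \<beta> (n - i))"
      by (simp add: power_mult_distrib power_divide s(2) \<alpha>_def \<beta>_def mult_ac)
    also have "\<dots> \<le> C * (\<Sum>i\<le>n. \<alpha> i * \<beta> (n - i))"
      using nn by (intro mult_right_mono C(2) sum_nonneg) simp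
    finally show ?thesis .
  qed
  have sC: "summable (\<lambda>n. C * (\<Sum>i\<le>n. \<alpha> i * \<beta> (n - i)))" by (intro summable_mult prod(1))
  have sx: "summable (\<lambda>n. (cmod (cp x y n))\<^sup>2)"
    by (rule summable_comparison_test'[OF sC]) (use le in simp)
  then show "wfin one (cp x y)" by (simp add: wfin_def)
  have "ws one (cp x y) \<le> (\<Sum>n. C * (\<Sum>i\<le>n. \<alpha> i * \<beta> (n - i)))"
    unfolding ws_def using sx sC le by (intro suminf_le) simp_all
  then show "ws one (cp x y) \<le> C * (ws p x * ws q y)"
    by (simp add: suminf_mult[OF prod(1)] prod(2))
qed

lemma cp_wt:
  assumes "wfin wt x" "wfin wt y"
  shows "wfin one (cp x y)" "ws one (cp x y) \<le> ws wt x * ws wt y"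
proof -
  have b: "(\<Sum>i\<le>n. 1 / ((1 + real i) * (1 + real (n - i)))) \<le> 1" for n
  proof -
    \<comment> \<open>Each of the n + 1 terms is at most 1 / (1 + n), whence the constant 1.\<close>
    have "(\<Sum>i\<le>n. 1 / ((1 + real i) * (1 + real (n - i)))) \<le> (\<Sum>i\<le>n. 1 / (1 + real n))"
    proof (intro sum_mono divide_left_mono)
      fix i assume "i \<in> {..n}"
      then have "real n = real i + real (n - i)" by simp
      moreover have "1 + real i + real (n - i) \<le> (1 + real i) * (1 + real (n - i))"
        by (simp add: algebra_simps)
      ultimately show "1 + real n \<le> (1 + real i) * (1 + real (n - i))" by linarith
      have "0 < (1 + real i) * (1 + real (n - i))" by (intro mult_pos_pos) auto
      then show "0 < (1 + real i) * (1 + real (n - i)) * (1 + real n)" by (intro mult_pos_pos) auto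
    qed simp
    then show ?thesis by simp
  qed
  show "wfin one (cp x y)" "ws one (cp x y) \<le> ws wt x * ws wt y"
    using cp_weighted[OF _ _ _ b assms] by (simp_all add: add_pos_nonneg)
qed

text \<open>Says that H^(1/4) times H^(1/2) still lies in L2. With s and t the inverse square roots
  of 1 + i and 1 + j, the inequality s t^2 <= s^3 + t^3 reduces the sum to the convergent series of
  (1 + i)^(-3/2).\<close>

lemma cp_sqwt_constant: "\<exists>C\<ge>0. \<forall>n. (\<Sum>i\<le>n. 1 / (sqrt (1 + real i) * (1 + real (n - i)))) \<le> C"
proof -
  define a where "a i = (1 + real i) powr (-3/2)" for i :: nat
  have "summable (\<lambda>i. real i powr (-3/2))" by (simp add: summable_real_powr_iff)
  then have "summable (\<lambda>i. real (Suc i) powr (-3/2))" by (subst summable_Suc_iff)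
  then have sa: "summable a" by (simp add: a_def[abs_def] add.commute)
  have a0: "0 \<le> a i" for i by (simp add: a_def)
  have le: "1 / (sqrt (1 + real i) * (1 + real j)) \<le> a i + a j" for i j
  proof -
    define s t where "s = 1 / sqrt (1 + real i)" and "t = 1 / sqrt (1 + real j)"
    have st: "0 < s" "0 < t" by (simp_all add: s_def t_def add_pos_nonneg)
    have a3: "a k = (1 / sqrt (1 + real k)) ^ 3" for k
    proof -
      have "a k = 1 / ((1 + real k) powr (1 / 2)) powr 3"
        by (simp add: a_def powr_powr powr_minus_divide[symmetric])
      then show ?thesis by (simp add: powr_half_sqrt power_divide powr_numeral add_nonneg_nonneg)
    qed
    have "1 / (sqrt (1 + real i) * (1 + real j)) = s * t\<^sup>2"
      by (simp add: s_def t_def power_divide)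
    also have "\<dots> \<le> s ^ 3 + t ^ 3"
    proof (cases "s \<le> t")
      case True
      then have "s * t\<^sup>2 \<le> t * t\<^sup>2" using st by (intro mult_right_mono) auto
      also have "\<dots> = t ^ 3" by (simp add: power3_eq_cube power2_eq_square)
      finally show ?thesis using st by (simp add: add_increasing)
    next
      case False
      then have "s * t\<^sup>2 \<le> s * s\<^sup>2" using st by (intro mult_left_mono power_mono) auto
      also have "\<dots> = s ^ 3" by (simp add: power3_eq_cube power2_eq_square)
      finally show ?thesis using st by (simp add: add_increasing2)
    qed
    finally show ?thesis by (simp add: a3 s_def t_def)
  qed
  have "(\<Sum>i\<le>n. 1 / (sqrt (1 + real i) * (1 + real (n - i)))) \<le> suminf a + suminf a" for n
  proof -
    have "(\<Sum>i\<le>n. 1 / (sqrt (1 + real i) * (1 + real (n - i)))) \<le> (\<Sum>i\<le>n. a i + a (n - i))"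
      by (intro sum_mono le)
    also have "\<dots> = (\<Sum>i\<le>n. a i) + (\<Sum>i\<le>n. a i)"
      using sum.nat_diff_reindex[of a "Suc n"] by (simp add: sum.distrib lessThan_Suc_atMost)
    also have "\<dots> \<le> suminf a + suminf a" using sa a0 by (intro add_mono sum_le_suminf) auto
    finally show ?thesis .
  qed
  moreover have "0 \<le> suminf a + suminf a" using suminf_nonneg[OF sa a0] by simp
  ultimately show ?thesis by blast
qed

text \<open>Young's inequality for l1 and l2, from Cauchy-Schwarz after splitting |x_i| into two
  square roots.\<close>

lemma cp_l1:
  assumes x: "summable (\<lambda>k. cmod (x k))" and y: "wfin one y"
  shows "wfin one (cp x y)" "ws one (cp x y) \<le> (\<Sum>k. cmod (x k))\<^sup>2 * ws one y"
proof -
  define X where "X = (\<Sum>k. cmod (x k))"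
  have sy: "summable (\<lambda>k. norm ((cmod (y k))\<^sup>2))" using y by (simp add: wfin_def)
  have sx: "summable (\<lambda>k. norm (cmod (x k)))" using x by simp
  have prod: "summable (\<lambda>n. \<Sum>i\<le>n. cmod (x i) * (cmod (y (n - i)))\<^sup>2)"
    "(\<Sum>n. \<Sum>i\<le>n. cmod (x i) * (cmod (y (n - i)))\<^sup>2) = X * ws one y"
    using summable_Cauchy_product[OF sx sy] Cauchy_product[OF sx sy] by (simp_all add: ws_def X_def)
  have X0: "0 \<le> X" unfolding X_def by (intro suminf_nonneg x) simp
  have le: "(cmod (cp x y n))\<^sup>2 \<le> X * (\<Sum>i\<le>n. cmod (x i) * (cmod (y (n - i)))\<^sup>2)" for n
  proof -
    have "(cmod (cp x y n))\<^sup>2 \<le> (\<Sum>i\<le>n. cmod (x i) * cmod (y (n - i)))\<^sup>2"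
      by (intro power_mono cmod_cp_le) simp
    also have "(\<Sum>i\<le>n. cmod (x i) * cmod (y (n - i)))
        = (\<Sum>i\<le>n. sqrt (cmod (x i)) * (sqrt (cmod (x i)) * cmod (y (n - i))))"
      by (simp add: mult.assoc[symmetric])
    also have "\<dots>\<^sup>2 \<le> (\<Sum>i\<le>n. (sqrt (cmod (x i)))\<^sup>2) * (\<Sum>i\<le>n. (sqrt (cmod (x i)) * cmod (y (n - i)))\<^sup>2)"
      by (rule Cauchy_Schwarz_ineq_sum)
    also have "\<dots> = (\<Sum>i\<le>n. cmod (x i)) * (\<Sum>i\<le>n. cmod (x i) * (cmod (y (n - i)))\<^sup>2)"
      by (simp add: power_mult_distrib)
    also have "\<dots> \<le> X * (\<Sum>i\<le>n. cmod (x i) * (cmod (y (n - i)))\<^sup>2)"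
      unfolding X_def using x by (intro mult_right_mono sum_le_suminf sum_nonneg) auto
    finally show ?thesis .
  qed
  have sC: "summable (\<lambda>n. X * (\<Sum>i\<le>n. cmod (x i) * (cmod (y (n - i)))\<^sup>2))" by (intro summable_mult prod(1))
  have s: "summable (\<lambda>n. (cmod (cp x y n))\<^sup>2)"
    by (rule summable_comparison_test'[OF sC]) (use le in simp)
  then show "wfin one (cp x y)" by (simp add: wfin_def)
  have "ws one (cp x y) \<le> (\<Sum>n. X * (\<Sum>i\<le>n. cmod (x i) * (cmod (y (n - i)))\<^sup>2))"
    unfolding ws_def using s sC le by (intro suminf_le) simp_all
  also have "\<dots> = X * (X * ws one y)" by (simp only: suminf_mult[OF prod(1)] prod(2))
  finally show "ws one (cp x y) \<le> (\<Sum>k. cmod (x k))\<^sup>2 * ws one y"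
    by (simp add: X_def[symmetric] power2_eq_square mult.assoc)
qed

section \<open>Energy estimate for the low frequencies of a difference\<close>

lemma wfin_one_iff: "wfin one x \<longleftrightarrow> x \<in> L2"
  by (simp add: wfin_def L2_def)

lemma wfin_wt_iff: "wfin wt x \<longleftrightarrow> x \<in> Hhalf"
  by (simp add: wfin_def Hhalf_def)

lemma wfin_wt_one: "wfin wt x \<Longrightarrow> wfin one x"
  using Hhalf_L2 by (simp add: wfin_one_iff wfin_wt_iff)

lemma cmod_lip_le:
  assumes "wfin one x" "wfin one y"
  shows "cmod (lip x y) \<le> sqrt (ws one x) * sqrt (ws one y)"
proof -
  have xy: "summable (\<lambda>k. (cmod (x k))\<^sup>2)" "summable (\<lambda>k. (cmod (y k))\<^sup>2)"
    using assms by (simp_all add: wfin_def)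
  note cs = suminf_cauchy_schwarz[OF xy]
  have "cmod (lip x y) \<le> (\<Sum>k. \<bar>cmod (x k) * cmod (y k)\<bar>)"
    unfolding lip_def using summable_norm[of "\<lambda>k. x k * cnj (y k)"] cs(1) by (simp add: norm_mult abs_mult)
  also have "\<dots> \<le> sqrt (ws one x * ws one y)"
    unfolding ws_def using cs(2) by (intro real_le_rsqrt) simp
  finally show ?thesis by (simp add: real_sqrt_mult)
qed

lemma ws_add:
  assumes p: "\<And>k. 0 \<le> p k" and "wfin p x" "wfin p y"
  shows "wfin p (x + y)" "ws p (x + y) \<le> 2 * (ws p x + ws p y)"
proof -
  have s: "summable (\<lambda>k. 2 * (p k * (cmod (x k))\<^sup>2 + p k * (cmod (y k))\<^sup>2))"
    using assms(2,3) unfolding wfin_def by (intro summable_mult summable_add)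
  have le: "p k * (cmod (x k + y k))\<^sup>2 \<le> 2 * (p k * (cmod (x k))\<^sup>2 + p k * (cmod (y k))\<^sup>2)" for k
  proof -
    have "(cmod (x k + y k))\<^sup>2 \<le> (cmod (x k) + cmod (y k))\<^sup>2"
      by (intro power_mono norm_triangle_ineq) simp
    also have "\<dots> \<le> 2 * ((cmod (x k))\<^sup>2 + (cmod (y k))\<^sup>2)"
      using sum_squares_bound[of "cmod (x k)" "cmod (y k)"] by (simp add: power2_sum)
    finally have "p k * (cmod (x k + y k))\<^sup>2 \<le> p k * (2 * ((cmod (x k))\<^sup>2 + (cmod (y k))\<^sup>2))"
      by (rule mult_left_mono[OF _ p])
    then show ?thesis by (simp add: algebra_simps)
  qed
  have sxy: "summable (\<lambda>k. p k * (cmod (x k + y k))\<^sup>2)"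
    by (rule summable_comparison_test'[OF s]) (use le p in \<open>simp add: abs_mult\<close>)
  then show "wfin p (x + y)" by (simp add: wfin_def)
  have "ws p (x + y) \<le> (\<Sum>k. 2 * (p k * (cmod (x k))\<^sup>2 + p k * (cmod (y k))\<^sup>2))"
    unfolding ws_def plus_fun_apply using sxy s le by (intro suminf_le)
  also have "\<dots> = 2 * (ws p x + ws p y)"
    using assms(2,3) unfolding ws_def wfin_def by (subst suminf_mult) (auto intro: summable_add simp: suminf_add)
  finally show "ws p (x + y) \<le> 2 * (ws p x + ws p y)" .
qed

lemma ws_uminus: "wfin p ((-1) \<odot> x) \<longleftrightarrow> wfin p x" "ws p ((-1) \<odot> x) = ws p x"
  by (simp_all add: wfin_def ws_def)

lemma ws_restrict:
  assumes p: "\<And>k. 0 \<le> p k" and "wfin p x"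
  shows "wfin p (\<lambda>k. if P k then x k else 0)" "ws p (\<lambda>k. if P k then x k else 0) \<le> ws p x"
proof -
  have s: "summable (\<lambda>k. p k * (cmod (if P k then x k else 0))\<^sup>2)"
    by (rule summable_comparison_test'[OF assms(2)[unfolded wfin_def]]) (use p in \<open>simp add: abs_mult\<close>)
  then show "wfin p (\<lambda>k. if P k then x k else 0)" by (simp add: wfin_def)
  show "ws p (\<lambda>k. if P k then x k else 0) \<le> ws p x"
    unfolding ws_def using s assms(2) p by (intro suminf_le) (auto simp: wfin_def)
qed

text \<open>This is (Pi(|u|^2 u)|p) = (u^2|p u): the projection disappears because p has nonnegative
  frequencies, and the conjugate factor moves to the other side, leaving plain products. The cut-off
  of p makes the outer sum finite.\<close>

lemma szego_nl_pairing:
  assumes u: "wfin wt u" and p: "\<And>k. n \<le> k \<Longrightarrow> p k = 0"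
  shows "(\<Sum>k<n. cnj (p k) * szego_nl u k) = lip (cp u u) (cp p u)"
proof -
  have cpL: "cp u u \<in> L2" using cp_wt(1)[OF u u] by (simp add: wfin_one_iff)
  have uL: "u \<in> L2" using wfin_wt_one[OF u] by (simp add: wfin_one_iff)
  define F where "F k l = (if k \<le> l then cnj (p k) * (cp u u l * cnj (u (l - k))) else 0)" for k l
  have s0: "summable (\<lambda>m. cp u u (k + m) * cnj (u m))" for k
    by (rule L2_summable[OF L2_shift[OF cpL] uL])
  have sF: "summable (F k)" for k
  proof -
    have "summable (\<lambda>m. F k (m + k))"
      using summable_mult[OF s0, of "cnj (p k)" k] by (simp add: F_def add.commute)
    then show ?thesis by (rule summable_iff_shift[THEN iffD1])
  qed
  have "cnj (p k) * szego_nl u k = suminf (F k)" for k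
  proof -
    have "suminf (F k) = (\<Sum>m. F k (m + k))"
      using suminf_split_initial_segment[OF sF[of k], of k] by (simp add: F_def)
    also have "\<dots> = (\<Sum>m. cnj (p k) * (cp u u (k + m) * cnj (u m)))" by (simp add: F_def add.commute)
    also have "\<dots> = cnj (p k) * (\<Sum>m. cp u u (k + m) * cnj (u m))" by (rule suminf_mult[OF s0])
    finally show ?thesis unfolding szego_nl_def cp_def by (simp add: mult.commute)
  qed
  then have "(\<Sum>k<n. cnj (p k) * szego_nl u k) = (\<Sum>l. \<Sum>k<n. F k l)"
    using suminf_sum[of "{..<n}" F] sF by simp
  also have "\<dots> = lip (cp u u) (cp p u)"
    unfolding lip_def
  proof (intro suminf_cong)
    fix l
    have "(\<Sum>k<n. F k l) = (\<Sum>k\<in>{..<n} \<inter> {..l}. cnj (p k) * (cp u u l * cnj (u (l - k))))"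
      unfolding F_def by (subst sum.inter_restrict) auto
    also have "\<dots> = (\<Sum>k\<le>l. cnj (p k) * (cp u u l * cnj (u (l - k))))"
      using p by (intro sum.mono_neutral_left) (auto, meson linorder_not_le)
    also have "\<dots> = cp u u l * cnj (cp p u l)"
      unfolding cp_def[of p u] by (simp add: sum_distrib_left mult_ac)
    finally show "(\<Sum>k<n. F k l) = cp u u l * cnj (cp p u l)" .
  qed
  finally show ?thesis .
qed

lemma lip_add2: "x \<in> L2 \<Longrightarrow> y \<in> L2 \<Longrightarrow> z \<in> L2 \<Longrightarrow> lip z (x + y) = lip z x + lip z y"
  using lip_cnj[OF subspD(2)[OF L2_subsp], of x y z] lip_add[of x y z] lip_cnj[of x z] lip_cnj[of y z] by simp

text \<open>All terms of the expansion that are not controlled by \<open>\<parallel>p\<parallel>\<^sup>2\<close> are real.\<close>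
lemma cubic_difference:
  assumes v: "wfin wt v" "summable (\<lambda>k. cmod (v k))" and p: "wfin wt p" "summable (\<lambda>k. cmod (p k))"
  shows "\<bar>Im (lip (cp (v + p) (v + p)) (cp p (v + p)) - lip (cp v v) (cp p v))\<bar>
    \<le> ((\<Sum>k. cmod (v k))\<^sup>2 + (\<Sum>k. cmod (v k)) * (\<Sum>k. cmod (p k))) * ws one p"
proof -
  define V P where "V = (\<Sum>k. cmod (v k))" and "P = (\<Sum>k. cmod (p k))"
  have V0: "0 \<le> V" unfolding V_def by (rule suminf_nonneg[OF v(2)]) simp
  have P0: "0 \<le> P" unfolding P_def by (rule suminf_nonneg[OF p(2)]) simp
  have p1: "wfin one p" by (rule wfin_wt_one[OF p(1)])
  have n0: "0 \<le> ws one p" by (rule ws_nonneg[OF p1]) simp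
  have L: "cp v v \<in> L2" "cp p v \<in> L2" "cp p p \<in> L2"
    using cp_wt(1)[OF v(1) v(1)] cp_wt(1)[OF p(1) v(1)] cp_wt(1)[OF p(1) p(1)] by (simp_all add: wfin_one_iff)
  note add_in = subspD(2)[OF L2_subsp]
  have e1: "cp (v + p) (v + p) = cp v v + cp p v + (cp p v + cp p p)"
    unfolding cp_add_left cp_add_right cp_commute[of v p] by (simp add: add_ac)
  have "lip (cp (v + p) (v + p)) (cp p (v + p)) = lip (cp v v) (cp p v) + lip (cp v v) (cp p p)
     + 2 * lip (cp p v) (cp p v) + 2 * lip (cp p v) (cp p p) + lip (cp p p) (cp p v) + lip (cp p p) (cp p p)"
    unfolding e1 unfolding cp_add_right
    by (simp only: lip_add lip_add2 L add_in) (simp add: algebra_simps)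
  moreover have "Im (lip (cp p v) (cp p v)) = 0" "Im (lip (cp p p) (cp p p)) = 0"
    using lip_cnj[OF L(2) L(2)] lip_cnj[OF L(3) L(3)] by (simp_all add: complex_eq_iff)
  \<comment> \<open>The exchanged pairing is a conjugate, so it cancels the imaginary part of one of
    the two copies of (p v|p p).\<close>
  moreover have "Im (lip (cp p p) (cp p v)) = - Im (lip (cp p v) (cp p p))"
    using lip_cnj[OF L(2) L(3)] by simp
  ultimately have "Im (lip (cp (v + p) (v + p)) (cp p (v + p)) - lip (cp v v) (cp p v))
      = Im (lip (cp v v) (cp p p)) + Im (lip (cp p v) (cp p p))" by simp
  also have "\<bar>\<dots>\<bar> \<le> cmod (lip (cp v v) (cp p p)) + cmod (lip (cp p v) (cp p p))"
    using abs_Im_le_cmod[of "lip (cp v v) (cp p p)"] abs_Im_le_cmod[of "lip (cp p v) (cp p p)"] by linarith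
  also have "cmod (lip (cp v v) (cp p p)) \<le> V\<^sup>2 * ws one p"
  proof -
    \<comment> \<open>Coefficients of p^2 are bounded by the squared L2 norm of p, while v^2 has l1
      norm at most V^2; pairing sup with l1 avoids any norm of p stronger than L2.\<close>
    have sup: "cmod (cp p p n) \<le> ws one p" for n
    proof -
      have "cmod (cp p p n) \<le> (\<Sum>i\<le>n. cmod (p i) * cmod (p (n - i)))" by (rule cmod_cp_le)
      also have "\<dots> \<le> (\<Sum>i\<le>n. ((cmod (p i))\<^sup>2 + (cmod (p (n - i)))\<^sup>2) / 2)"
      proof (intro sum_mono)
        fix i
        show "cmod (p i) * cmod (p (n - i)) \<le> ((cmod (p i))\<^sup>2 + (cmod (p (n - i)))\<^sup>2) / 2"
          using sum_squares_bound[of "cmod (p i)" "cmod (p (n - i))"] by simp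
      qed
      also have "\<dots> = (\<Sum>i\<le>n. (cmod (p i))\<^sup>2)"
        using sum.nat_diff_reindex[of "\<lambda>i. (cmod (p i))\<^sup>2" "Suc n"]
        by (simp add: sum_divide_distrib[symmetric] sum.distrib lessThan_Suc_atMost)
      also have "\<dots> \<le> ws one p"
        using sum_le_suminf[of "\<lambda>k. (cmod (p k))\<^sup>2" "{..n}"] p1 by (simp add: ws_def wfin_def)
      finally show ?thesis .
    qed
    have sv: "summable (\<lambda>k. norm (cmod (v k)))" using v(2) by simp
    have prod: "summable (\<lambda>n. \<Sum>i\<le>n. cmod (v i) * cmod (v (n - i)))"
      "(\<Sum>n. \<Sum>i\<le>n. cmod (v i) * cmod (v (n - i))) = V\<^sup>2"
      using summable_Cauchy_product[OF sv sv] Cauchy_product[OF sv sv] by (simp_all add: V_def power2_eq_square)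
    have s: "summable (\<lambda>n. (\<Sum>i\<le>n. cmod (v i) * cmod (v (n - i))) * ws one p)" by (rule summable_mult2[OF prod(1)])
    have le: "norm (cp v v n * cnj (cp p p n)) \<le> (\<Sum>i\<le>n. cmod (v i) * cmod (v (n - i))) * ws one p" for n
      unfolding norm_mult using sup[of n] cmod_cp_le[of v v n] n0
      by (intro mult_mono sum_nonneg) auto
    have sn: "summable (\<lambda>n. norm (cp v v n * cnj (cp p p n)))"
      by (rule summable_comparison_test'[OF s]) (use le in simp)
    have "cmod (lip (cp v v) (cp p p)) \<le> (\<Sum>n. norm (cp v v n * cnj (cp p p n)))"
      unfolding lip_def by (rule summable_norm[OF sn])
    also have "\<dots> \<le> (\<Sum>n. (\<Sum>i\<le>n. cmod (v i) * cmod (v (n - i))) * ws one p)"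
      by (rule suminf_le[OF le sn s])
    also have "\<dots> = V\<^sup>2 * ws one p" using suminf_mult2[OF prod(1), of "ws one p"] prod(2) by simp
    finally show ?thesis .
  qed
  also have "cmod (lip (cp p v) (cp p p)) \<le> (V * P) * ws one p"
  proof -
    have "cmod (lip (cp p v) (cp p p)) \<le> sqrt (ws one (cp p v)) * sqrt (ws one (cp p p))"
      using L by (intro cmod_lip_le) (simp_all add: wfin_one_iff)
    also have "\<dots> \<le> sqrt (V\<^sup>2 * ws one p) * sqrt (P\<^sup>2 * ws one p)"
      using cp_l1(2)[OF v(2) p1] cp_l1(2)[OF p(2) p1] L n0
      by (intro mult_mono real_sqrt_le_mono) (auto simp: V_def P_def cp_commute[of p v] wfin_one_iff intro!: ws_nonneg)
    also have "\<dots> = (V * P) * ws one p" using V0 P0 n0 by (simp add: real_sqrt_mult)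
    finally show ?thesis .
  qed
  finally show ?thesis by (simp add: V_def P_def algebra_simps)
qed

text \<open>Cauchy-Schwarz against the harmonic sum. The logarithm measures how far H^(1/2) is from
  the bounded functions.\<close>

lemma low_frequency_l1:
  assumes p: "wfin wt p" "\<And>k. n \<le> k \<Longrightarrow> p k = 0"
  shows "summable (\<lambda>k. cmod (p k))" "(\<Sum>k. cmod (p k)) \<le> sqrt ((1 + ln (1 + real n)) * ws wt p)"
proof -
  show s: "summable (\<lambda>k. cmod (p k))" by (rule summable_finite[of "{..<n}"]) (use p(2) in \<open>auto simp: not_less\<close>)
  have eq: "(\<Sum>k. cmod (p k)) = (\<Sum>k<n. cmod (p k))"
    by (rule suminf_finite) (use p(2) in \<open>auto simp: not_less\<close>)
  have "(\<Sum>k<n. cmod (p k))\<^sup>2 = (\<Sum>k<n. (1 / sqrt (1 + real k)) * (sqrt (1 + real k) * cmod (p k)))\<^sup>2"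
    by (simp add: add_nonneg_eq_0_iff)
  also have "\<dots> \<le> (\<Sum>k<n. (1 / sqrt (1 + real k))\<^sup>2) * (\<Sum>k<n. (sqrt (1 + real k) * cmod (p k))\<^sup>2)"
    by (rule Cauchy_Schwarz_ineq_sum)
  also have "(\<Sum>k<n. (1 / sqrt (1 + real k))\<^sup>2) = (\<Sum>k<n. inverse (real (Suc k)))"
    by (intro sum.cong) (auto simp: power_divide field_simps)
  also have "\<dots> = harm n" unfolding harm_def
    by (simp add: sum.atLeast1_atMost_eq)
  also have "(\<Sum>k<n. (sqrt (1 + real k) * cmod (p k))\<^sup>2) = (\<Sum>k<n. (1 + real k) * (cmod (p k))\<^sup>2)"
    by (intro sum.cong) (auto simp: power_mult_distrib)
  also have "\<dots> \<le> ws wt p"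
    using p(1) unfolding ws_def wfin_def by (intro sum_le_suminf) auto
  also have "harm n \<le> 1 + ln (1 + real n)"
  proof (cases "n = 0")
    case False
    then obtain m where m: "n = Suc m" by (cases n) auto
    have "harm n \<le> ln (real n) + 1"
      using decseqD[OF decseq_harm_diff_ln, of 0 m] by (simp add: m harm_def)
    also have "ln (real n) \<le> ln (1 + real n)" using False by (subst ln_le_cancel_iff) auto
    finally show ?thesis by simp
  qed (simp add: harm_def)
  finally have "(\<Sum>k<n. cmod (p k))\<^sup>2 \<le> (1 + ln (1 + real n)) * ws wt p"
    using ws_nonneg[OF p(1)] by (simp add: mult_left_mono mult_right_mono harm_nonneg)
  then show "(\<Sum>k. cmod (p k)) \<le> sqrt ((1 + ln (1 + real n)) * ws wt p)"
    unfolding eq by (rule real_le_rsqrt)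
qed

text \<open>For k >= n one has sqrt (1 + k) <= (1 + k) / sqrt (1 + n): giving up half of the weight
  buys a negative power of the cut-off.\<close>

lemma high_frequency:
  assumes q: "wfin wt q" "\<And>k. k < n \<Longrightarrow> q k = 0"
  shows "wfin sqwt q" "ws sqwt q \<le> ws wt q / sqrt (1 + real n)"
proof -
  have le: "sqrt (1 + real k) * (cmod (q k))\<^sup>2 \<le> ((1 + real k) * (cmod (q k))\<^sup>2) / sqrt (1 + real n)" for k
  proof (cases "k < n")
    case True
    then show ?thesis using q(2) by simp
  next
    case False
    then have "sqrt (1 + real n) \<le> sqrt (1 + real k)" by simp
    then have "sqrt (1 + real k) * sqrt (1 + real n) \<le> sqrt (1 + real k) * sqrt (1 + real k)"
      by (intro mult_left_mono) auto
    also have "\<dots> = 1 + real k" by simp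
    finally have "sqrt (1 + real k) \<le> (1 + real k) / sqrt (1 + real n)"
      by (simp add: field_simps add_pos_nonneg)
    then have "sqrt (1 + real k) * (cmod (q k))\<^sup>2 \<le> (1 + real k) / sqrt (1 + real n) * (cmod (q k))\<^sup>2"
      by (rule mult_right_mono) simp
    then show ?thesis by simp
  qed
  have s: "summable (\<lambda>k. ((1 + real k) * (cmod (q k))\<^sup>2) / sqrt (1 + real n))"
    using q(1) unfolding wfin_def by (rule summable_divide)
  have s': "summable (\<lambda>k. sqrt (1 + real k) * (cmod (q k))\<^sup>2)"
    by (rule summable_comparison_test'[OF s]) (use le in \<open>simp add: abs_mult\<close>)
  then show "wfin sqwt q" by (simp add: wfin_def)
  show "ws sqwt q \<le> ws wt q / sqrt (1 + real n)"
    unfolding ws_def using suminf_le[OF le s' s] suminf_divide[OF q(1)[unfolded wfin_def]] by simp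
qed

text \<open>For positive times y exp(-\<alpha> s) - \<beta> s is nonincreasing; negative times are
  reflected.\<close>

lemma gronwall_zero:
  fixes y :: "real \<Rightarrow> real"
  assumes d: "\<And>s. \<bar>s\<bar> \<le> \<bar>t\<bar> \<Longrightarrow> (y has_real_derivative y' s) (at s)"
    and b: "\<And>s. \<bar>s\<bar> \<le> \<bar>t\<bar> \<Longrightarrow> \<bar>y' s\<bar> \<le> \<alpha> * y s + \<beta>"
    and y0: "y 0 = 0" and \<alpha>: "0 \<le> \<alpha>" and \<beta>: "0 \<le> \<beta>"
  shows "y t \<le> \<beta> * \<bar>t\<bar> * exp (\<alpha> * \<bar>t\<bar>)"
proof -
  have pos: "y t \<le> \<beta> * t * exp (\<alpha> * t)" if t: "0 \<le> t"
    and d: "\<And>s. 0 \<le> s \<Longrightarrow> s \<le> t \<Longrightarrow> (y has_real_derivative y' s) (at s)"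
    and b: "\<And>s. 0 \<le> s \<Longrightarrow> s \<le> t \<Longrightarrow> \<bar>y' s\<bar> \<le> \<alpha> * y s + \<beta>" and y0: "y 0 = 0"
    for t :: real and y y' :: "real \<Rightarrow> real"
  proof -
    define z where "z s = y s * exp (- \<alpha> * s) - \<beta> * s" for s
    have "z t \<le> z 0"
    proof (rule DERIV_nonpos_imp_nonincreasing[OF t])
      fix s assume s: "0 \<le> s" "s \<le> t"
      have "(z has_real_derivative (y' s - \<alpha> * y s) * exp (- \<alpha> * s) - \<beta>) (at s)"
        unfolding z_def by (auto intro!: derivative_eq_intros d s simp: algebra_simps)
      moreover have "(y' s - \<alpha> * y s) * exp (- \<alpha> * s) - \<beta> \<le> 0"
      proof -
        have "(y' s - \<alpha> * y s) * exp (- \<alpha> * s) \<le> \<beta> * exp (- \<alpha> * s)"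
          using b[OF s] by (intro mult_right_mono) auto
        also have "\<dots> \<le> \<beta> * 1" using \<beta> \<alpha> s by (intro mult_left_mono) auto
        finally show ?thesis by simp
      qed
      ultimately show "\<exists>D. (z has_real_derivative D) (at s) \<and> D \<le> 0" by blast
    qed
    then have "y t * exp (- \<alpha> * t) \<le> \<beta> * t" by (simp add: z_def y0)
    then have "y t * exp (- \<alpha> * t) * exp (\<alpha> * t) \<le> \<beta> * t * exp (\<alpha> * t)" by (rule mult_right_mono) simp
    then show ?thesis by (simp add: mult.assoc exp_add[symmetric])
  qed
  show ?thesis
  proof (cases "0 \<le> t")
    case True
    then show ?thesis using pos[of t y y'] d b y0 by simp
  next
    case False
    have "y (- (- t)) \<le> \<beta> * (- t) * exp (\<alpha> * (- t))"
    proof (rule pos[of "- t" "\<lambda>s. y (- s)" "\<lambda>s. - y' (- s)"])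
      fix s assume s: "0 \<le> s" "s \<le> - t"
      show "((\<lambda>s. y (- s)) has_real_derivative - y' (- s)) (at s)"
        using DERIV_chain'[OF DERIV_minus[OF DERIV_ident, of s UNIV] d[of "- s"]] s by simp
      show "\<bar>- y' (- s)\<bar> \<le> \<alpha> * y (- s) + \<beta>" using b[of "- s"] s by simp
    qed (use False y0 in auto)
    then show ?thesis using False by simp
  qed
qed

text \<open>Split w = u - v at frequency n into p + q and put g = v + p, so that u = g + q.
  Comparing g with v is \<open>cubic_difference\<close>, where only p and v need l1 bounds. Every
  other term contains q and is small by \<open>high_frequency\<close>; the square roots turn that
  gain into the fourth root.\<close>

lemma energy_estimate:
  fixes n :: nat
  assumes C: "0 \<le> C" "\<And>n. (\<Sum>i\<le>n. 1 / (sqrt (1 + real i) * (1 + real (n - i)))) \<le> C"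
    and u: "wfin wt u" "ws wt u \<le> M" and v: "wfin wt v" "ws wt v \<le> M"
    and v1: "summable (\<lambda>k. cmod (v k))" "(\<Sum>k. cmod (v k)) \<le> B"
  defines "p \<equiv> (\<lambda>k. if k < n then u k - v k else 0)"
  shows "\<bar>Im (\<Sum>k<n. cnj (p k) * (szego_nl u k - szego_nl v k))\<bar>
    \<le> (B\<^sup>2 + B * sqrt ((1 + ln (1 + real n)) * (4 * M))) * ws one p
      + (sqrt (C * (4 * M * (22 * M))) * sqrt (4 * M * M)
          + sqrt (10 * M * (10 * M)) * sqrt (C * (4 * M * (4 * M)))) / sqrt (sqrt (1 + real n))"
proof -
  define w where "w = u + (-1) \<odot> v"
  define q where "q = (\<lambda>k. if \<not> k < n then w k else 0)"
  define g where "g = v + p"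
  have w_eq: "w k = u k - v k" for k by (simp add: w_def)
  have p_eq: "p = (\<lambda>k. if k < n then w k else 0)" unfolding p_def w_eq ..
  have wt0: "0 \<le> wt k" for k by simp
  \<comment> \<open>The constants iterate the factor 2 of \<open>ws_add\<close>: 4 M = 2 (M + M),
    then 10 M = 2 (M + 4 M) for g and 22 M = 2 (M + 10 M) for u + g.\<close>
  have w: "wfin wt w" "ws wt w \<le> 4 * M"
    using ws_add[OF wt0 u(1), of "(-1) \<odot> v"] v u(2) unfolding w_def ws_uminus by auto
  have M0: "0 \<le> M" using ws_nonneg[OF u(1) wt0] u(2) by linarith
  have p: "wfin wt p" "ws wt p \<le> 4 * M"
    using ws_restrict[OF wt0 w(1), of "\<lambda>k. k < n"] w(2) unfolding p_eq by auto
  have q: "wfin wt q" "ws wt q \<le> 4 * M"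
    using ws_restrict[OF wt0 w(1), of "\<lambda>k. \<not> k < n"] w(2) unfolding q_def by auto
  have g: "wfin wt g" "ws wt g \<le> 10 * M"
    using ws_add[OF wt0 v(1) p(1)] v(2) p(2) unfolding g_def by auto
  have ug: "wfin wt (u + g)" "ws wt (u + g) \<le> 22 * M"
    using ws_add[OF wt0 u(1) g(1)] u(2) g(2) by auto
  have u_eq: "u = g + q"
    by (auto simp: fun_eq_iff g_def p_eq q_def w_eq)
  define s where "s = sqrt (1 + real n)"
  have s: "0 < s" by (simp add: s_def add_pos_nonneg)
  have qh: "wfin sqwt q" "ws sqwt q \<le> 4 * M / s"
  proof -
    have qz: "q k = 0" if "k < n" for k using that by (simp add: q_def)
    show "wfin sqwt q" by (rule high_frequency(1)[OF q(1) qz])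
    have "ws sqwt q \<le> ws wt q / s" unfolding s_def by (rule high_frequency(2)[OF q(1) qz])
    also have "\<dots> \<le> 4 * M / s" using q(2) s by (intro divide_right_mono) auto
    finally show "ws sqwt q \<le> 4 * M / s" .
  qed
  have sq_pos: "0 < sqwt k" "0 < wt k" for k by (simp_all add: add_pos_nonneg)
  have cpq: "wfin one (cp q x)" "ws one (cp q x) \<le> C * (4 * M * X) / s" if x: "wfin wt x" "ws wt x \<le> X" for x X
  proof -
    note cw = cp_weighted[OF sq_pos(1) sq_pos(2) C qh(1) x(1)]
    show "wfin one (cp q x)" by (rule cw(1))
    have "ws one (cp q x) \<le> C * (ws sqwt q * ws wt x)" by (rule cw(2))
    also have "\<dots> \<le> C * (4 * M / s * X)"
      using qh x C(1) M0 s ws_nonneg[OF x(1) wt0] by (intro mult_left_mono mult_mono) auto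
    finally show "ws one (cp q x) \<le> C * (4 * M * X) / s" by simp
  qed
  have cpM: "ws one (cp x y) \<le> X * Y" if "wfin wt x" "wfin wt y" "ws wt x \<le> X" "ws wt y \<le> Y" for x y X Y
  proof -
    have "ws one (cp x y) \<le> ws wt x * ws wt y" by (rule cp_wt(2)[OF that(1,2)])
    also have "\<dots> \<le> X * Y"
      using that ws_nonneg[OF that(1) wt0] ws_nonneg[OF that(2) wt0] by (intro mult_mono) auto
    finally show ?thesis .
  qed
  have L: "cp g g \<in> L2" "cp q (u + g) \<in> L2" "cp p g \<in> L2" "cp p q \<in> L2" "cp p u \<in> L2"
    using cp_wt(1)[OF g(1) g(1)] cp_wt(1)[OF q(1) ug(1)] cp_wt(1)[OF p(1) g(1)] cp_wt(1)[OF p(1) q(1)]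
      cp_wt(1)[OF p(1) u(1)] by (simp_all add: wfin_one_iff)
  have uu: "cp u u = cp g g + cp q (u + g)"
  proof -
    have "cp u u = cp (g + q) u" using u_eq by simp
    also have "\<dots> = cp g u + cp q u" by (rule cp_add_left)
    also have "cp g u = cp g (g + q)" using u_eq by simp
    also have "\<dots> = cp g g + cp q g" unfolding cp_add_right cp_commute[of g q] ..
    finally have "cp u u = cp g g + cp q g + cp q u" .
    then show ?thesis unfolding cp_add_right by (simp only: add_ac)
  qed
  have pu: "cp p u = cp p g + cp p q" using u_eq cp_add_right[of p g q] by simp
  have split: "lip (cp u u) (cp p u) = lip (cp g g) (cp p g) + lip (cp g g) (cp p q) + lip (cp q (u + g)) (cp p u)"
  proof -
    have "lip (cp u u) (cp p u) = lip (cp g g) (cp p u) + lip (cp q (u + g)) (cp p u)"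
      unfolding uu by (rule lip_add[OF L(1,2,5)])
    also have "lip (cp g g) (cp p u) = lip (cp g g) (cp p g) + lip (cp g g) (cp p q)"
      unfolding pu by (rule lip_add2[OF L(3,4,1)])
    finally show ?thesis .
  qed
  have pz: "p k = 0" if "n \<le> k" for k using that by (simp add: p_def)
  have "(\<Sum>k<n. cnj (p k) * (szego_nl u k - szego_nl v k))
      = lip (cp u u) (cp p u) - lip (cp v v) (cp p v)"
    using szego_nl_pairing[OF u(1), of n p] szego_nl_pairing[OF v(1), of n p] pz
    by (simp add: right_diff_distrib sum_subtractf)
  also have "\<dots> = (lip (cp g g) (cp p g) - lip (cp v v) (cp p v))
      + (lip (cp q (u + g)) (cp p u) + lip (cp g g) (cp p q))"
    unfolding split by simp
  finally have "\<bar>Im (\<Sum>k<n. cnj (p k) * (szego_nl u k - szego_nl v k))\<bar>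
      \<le> \<bar>Im (lip (cp g g) (cp p g) - lip (cp v v) (cp p v))\<bar>
        + (cmod (lip (cp q (u + g)) (cp p u)) + cmod (lip (cp g g) (cp p q)))"
    using abs_Im_le_cmod[of "lip (cp q (u + g)) (cp p u)"] abs_Im_le_cmod[of "lip (cp g g) (cp p q)"]
    by (simp only: plus_complex.sel)
  also have "\<bar>Im (lip (cp g g) (cp p g) - lip (cp v v) (cp p v))\<bar>
      \<le> (B\<^sup>2 + B * sqrt ((1 + ln (1 + real n)) * (4 * M))) * ws one p"
  proof -
    have low: "summable (\<lambda>k. cmod (p k))" "(\<Sum>k. cmod (p k)) \<le> sqrt ((1 + ln (1 + real n)) * ws wt p)"
      by (rule low_frequency_l1[OF p(1) pz], assumption)+
    have V0: "0 \<le> (\<Sum>k. cmod (v k))" by (rule suminf_nonneg[OF v1(1)]) simp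
    have P0: "0 \<le> (\<Sum>k. cmod (p k))" by (rule suminf_nonneg[OF low(1) norm_ge_zero])
    have "(\<Sum>k. cmod (p k)) \<le> sqrt ((1 + ln (1 + real n)) * (4 * M))"
      using low(2) p(2) by (rule order_trans[OF _ real_sqrt_le_mono[OF mult_left_mono]])
        (rule add_nonneg_nonneg, simp_all)
    then have "(\<Sum>k. cmod (v k))\<^sup>2 + (\<Sum>k. cmod (v k)) * (\<Sum>k. cmod (p k))
        \<le> B\<^sup>2 + B * sqrt ((1 + ln (1 + real n)) * (4 * M))"
      using v1(2) V0 P0 by (intro add_mono power_mono mult_mono) auto
    then have "((\<Sum>k. cmod (v k))\<^sup>2 + (\<Sum>k. cmod (v k)) * (\<Sum>k. cmod (p k))) * ws one p
        \<le> (B\<^sup>2 + B * sqrt ((1 + ln (1 + real n)) * (4 * M))) * ws one p"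
      by (rule mult_right_mono[OF _ ws_nonneg[OF wfin_wt_one[OF p(1)]]]) simp
    with cubic_difference[OF v(1) v1(1) p(1) low(1)] show ?thesis unfolding g_def by linarith
  qed
  also have "cmod (lip (cp q (u + g)) (cp p u)) \<le> sqrt (C * (4 * M * (22 * M)) / s) * sqrt (4 * M * M)"
  proof -
    have "cmod (lip (cp q (u + g)) (cp p u)) \<le> sqrt (ws one (cp q (u + g))) * sqrt (ws one (cp p u))"
      using L by (intro cmod_lip_le) (simp_all add: wfin_one_iff)
    also have "\<dots> \<le> sqrt (C * (4 * M * (22 * M)) / s) * sqrt (4 * M * M)"
      using cpq(2)[OF ug] cpM[OF p(1) u(1) p(2) u(2)] C(1) M0 s L
      by (intro mult_mono real_sqrt_le_mono) (auto simp: wfin_one_iff intro!: ws_nonneg)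
    finally show ?thesis .
  qed
  also have "cmod (lip (cp g g) (cp p q)) \<le> sqrt (10 * M * (10 * M)) * sqrt (C * (4 * M * (4 * M)) / s)"
  proof -
    have "cmod (lip (cp g g) (cp p q)) \<le> sqrt (ws one (cp g g)) * sqrt (ws one (cp p q))"
      using L by (intro cmod_lip_le) (simp_all add: wfin_one_iff)
    also have "\<dots> \<le> sqrt (10 * M * (10 * M)) * sqrt (C * (4 * M * (4 * M)) / s)"
      using cpq(2)[OF p] cpM[OF g(1) g(1) g(2) g(2)] M0 L unfolding cp_commute[of p q]
      by (intro mult_mono real_sqrt_le_mono) (auto simp: wfin_one_iff intro!: ws_nonneg)
    finally show ?thesis .
  qed
  finally show ?thesis
    by (simp add: s_def real_sqrt_divide add_divide_distrib)
qed

lemma hs_half_less: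
  assumes "hs_sq (1/2) x < ennreal \<epsilon>" "0 < \<epsilon>"
  shows "wfin wt x" "ws wt x \<le> 2 * \<epsilon>"
proof -
  let ?h = "\<lambda>k. (1 + (real k)\<^sup>2) powr (1/2) * (cmod (x k))\<^sup>2"
  have "in_Hs_plus (1/2) x"
    unfolding in_Hs_plus_def infinity_ennreal_def by (rule less_trans[OF assms(1)]) simp
  then have s: "summable ?h" and f: "wfin wt x" by (simp_all add: in_Hs_plus_iff in_Hs_half_iff[unfolded in_Hs_plus_iff] wfin_def)
  show "wfin wt x" by (rule f)
  have "ennreal (suminf ?h) < ennreal \<epsilon>"
    using assms(1) unfolding hs_sq_def by (subst (asm) suminf_ennreal2) (auto intro: s)
  then have lt: "suminf ?h < \<epsilon>" using assms(2) suminf_nonneg[OF s] by (simp add: ennreal_less_iff)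
  have le: "(1 + real k) * (cmod (x k))\<^sup>2 \<le> 2 * ?h k" for k
    using half_weight_bounds(1)[of k] unfolding mult.assoc[symmetric] by (rule mult_right_mono) simp
  have "ws wt x \<le> (\<Sum>k. 2 * ?h k)"
    unfolding ws_def using le f[unfolded wfin_def] summable_mult[OF s, of 2] by (rule suminf_le)
  also have "\<dots> = 2 * suminf ?h" by (rule suminf_mult[OF s])
  finally show "ws wt x \<le> 2 * \<epsilon>" using lt by simp
qed

section \<open>Uniqueness and conclusion\<close>

lemma locally_bounded_imp_bounded:
  fixes f :: "real \<Rightarrow> real"
  assumes "\<And>t. \<exists>\<delta>>0. \<exists>M. \<forall>\<tau>. \<bar>\<tau> - t\<bar> < \<delta> \<longrightarrow> f \<tau> \<le> M"
  shows "\<exists>M. \<forall>\<tau>. \<bar>\<tau>\<bar> \<le> R \<longrightarrow> f \<tau> \<le> M"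
proof -
  obtain \<delta> M where \<delta>: "\<And>t. 0 < \<delta> t" "\<And>t \<tau>. \<bar>\<tau> - t\<bar> < \<delta> t \<Longrightarrow> f \<tau> \<le> M t"
    using assms by metis
  have "cball 0 R \<subseteq> (\<Union>t\<in>cball 0 R. ball t (\<delta> t))" using \<delta>(1) by (auto intro!: bexI)
  then obtain I where I: "finite I" "cball 0 R \<subseteq> (\<Union>t\<in>I. ball t (\<delta> t))"
    using compactE_image[OF compact_cball[of "0::real" R], of "cball 0 R" "\<lambda>t. ball t (\<delta> t)"] by (metis open_ball)
  have "f \<tau> \<le> Max (insert 0 (M ` I))" if "\<bar>\<tau>\<bar> \<le> R" for \<tau>
  proof -
    have "\<tau> \<in> cball 0 R" using that by simp
    then obtain t where t: "t \<in> I" "\<tau> \<in> ball t (\<delta> t)" using I(2) by blast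
    then have "f \<tau> \<le> M t" by (intro \<delta>(2)) (simp add: dist_real_def abs_minus_commute)
    also have "\<dots> \<le> Max (insert 0 (M ` I))" using I(1) t(1) by (intro Max_ge) auto
    finally show ?thesis .
  qed
  then show ?thesis by blast
qed

text \<open>Continuity in H^(1/2) bounds the norm near each time, and compactness extends the bound
  to bounded time intervals.\<close>

lemma solution_bounded:
  assumes "szego_solution u"
  shows "wfin wt (u t)" "\<exists>M. \<forall>\<tau>. \<bar>\<tau>\<bar> \<le> R \<longrightarrow> ws wt (u \<tau>) \<le> M"
proof -
  have fin: "wfin wt (u t)" for t
    using assms unfolding szego_solution_def in_Hs_half_iff wfin_def by blast
  show "wfin wt (u t)" by (rule fin)
  show "\<exists>M. \<forall>\<tau>. \<bar>\<tau>\<bar> \<le> R \<longrightarrow> ws wt (u \<tau>) \<le> M"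
  proof (rule locally_bounded_imp_bounded)
    fix t
    have "(0::real) < 1" by simp
    then obtain \<delta> where \<delta>: "\<delta> > 0"
      "\<And>\<tau>. \<bar>\<tau> - t\<bar> < \<delta> \<Longrightarrow> hs_sq (1/2) (\<lambda>k. u \<tau> k - u t k) < ennreal 1"
      using assms unfolding szego_solution_def by blast
    have "ws wt (u \<tau>) \<le> 2 * (2 * 1 + ws wt (u t))" if "\<bar>\<tau> - t\<bar> < \<delta>" for \<tau>
    proof -
      note d = hs_half_less[OF \<delta>(2)[OF that] zero_less_one]
      have "u \<tau> = (\<lambda>k. u \<tau> k - u t k) + u t" by (simp add: fun_eq_iff)
      then have "ws wt (u \<tau>) = ws wt ((\<lambda>k. u \<tau> k - u t k) + u t)" by (rule arg_cong)
      also have "\<dots> \<le> 2 * (ws wt (\<lambda>k. u \<tau> k - u t k) + ws wt (u t))"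
        by (rule ws_add(2)[OF _ d(1) fin]) simp
      finally show ?thesis using d(2) by simp
    qed
    then show "\<exists>\<delta>>0. \<exists>M. \<forall>\<tau>. \<bar>\<tau> - t\<bar> < \<delta> \<longrightarrow> ws wt (u \<tau>) \<le> M" using \<delta>(1) by blast
  qed
qed

text \<open>The \<open>L\<^sup>2\<close> distance at frequencies below \<open>n\<close> obeys a Gronwall inequality whose rate grows like
  \<open>sqrt (ln n)\<close> and whose defect decays like \<open>n\<^sup>-\<^sup>1\<^sup>/\<^sup>4\<close>, which wins as \<open>n\<close> tends to infinity.\<close>
lemma szego_weak_strong_uniqueness:
  assumes u: "szego_solution u"
    and v: "\<And>t. wfin wt (v t)" "\<And>t. ws wt (v t) \<le> Mv"
    and v1: "\<And>t. summable (\<lambda>k. cmod (v t k))" "\<And>t. (\<Sum>k. cmod (v t k)) \<le> B"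
    and v': "\<And>t k. ((\<lambda>\<tau>. v \<tau> k) has_vector_derivative (- \<i> * szego_nl (v t) k)) (at t)"
    and init: "u 0 = v 0"
  shows "u t = v t"
proof
  fix k
  obtain C where C: "0 \<le> C" "\<And>n. (\<Sum>i\<le>n. 1 / (sqrt (1 + real i) * (1 + real (n - i)))) \<le> C"
    using cp_sqwt_constant by blast
  obtain Mu where Mu: "\<And>\<tau>. \<bar>\<tau>\<bar> \<le> \<bar>t\<bar> \<Longrightarrow> ws wt (u \<tau>) \<le> Mu" using solution_bounded(2)[OF u] by blast
  \<comment> \<open>The maxima with 1, here and in \<open>B'\<close>, supply the strict positivity
    used in the asymptotic estimate.\<close>
  define M where "M = max 1 (max Mu Mv)"
  have M: "\<bar>\<tau>\<bar> \<le> \<bar>t\<bar> \<Longrightarrow> ws wt (u \<tau>) \<le> M" "ws wt (v \<tau>) \<le> M" "0 < M" for \<tau>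
    using Mu[of \<tau>] v(2)[of \<tau>] by (auto simp: M_def)
  define B' where "B' = max 1 B"
  have B': "(\<Sum>k. cmod (v \<tau> k)) \<le> B'" "0 < B'" for \<tau> using v1(2)[of \<tau>] by (auto simp: B'_def)
  define K where "K = sqrt (C * (4 * M * (22 * M))) * sqrt (4 * M * M)
          + sqrt (10 * M * (10 * M)) * sqrt (C * (4 * M * (4 * M)))"
  have K0: "0 \<le> K" using C(1) M(3) by (simp add: K_def)
  define \<alpha> where "\<alpha> n = 2 * (B'\<^sup>2 + B' * sqrt ((1 + ln (1 + real n)) * (4 * M)))" for n :: nat
  define \<beta> where "\<beta> n = 2 * (K / sqrt (sqrt (1 + real n)))" for n :: nat
  have est: "(\<Sum>k<n. (cmod (u t k - v t k))\<^sup>2) \<le> \<beta> n * \<bar>t\<bar> * exp (\<alpha> n * \<bar>t\<bar>)" for n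
  proof (rule gronwall_zero)
    fix s assume s: "\<bar>s\<bar> \<le> \<bar>t\<bar>"
    define p where "p = (\<lambda>k. if k < n then u s k - v s k else 0)"
    have u': "((\<lambda>\<tau>. u \<tau> k) has_vector_derivative (- \<i> * szego_nl (u s) k)) (at s)" for k
      using u unfolding szego_solution_def by blast
    \<comment> \<open>The derivative of |w|^2 is 2 Re (cnj w * w') with w' = -i D, which equals 2 Im
      (cnj w * D); therefore \<open>energy_estimate\<close> bounds an imaginary part.\<close>
    have d: "((\<lambda>\<tau>. (cmod (u \<tau> k - v \<tau> k))\<^sup>2) has_real_derivative
        2 * Im (cnj (u s k - v s k) * (szego_nl (u s) k - szego_nl (v s) k))) (at s)" for k
    proof -
      define D where "D = szego_nl (u s) k - szego_nl (v s) k"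
      have "((\<lambda>\<tau>. u \<tau> k - v \<tau> k) has_vector_derivative (- \<i> * D)) (at s)"
        using has_vector_derivative_diff[OF u' v'[where k = k and t = s], of k] by (simp add: D_def algebra_simps)
      then have re: "((\<lambda>\<tau>. Re (u \<tau> k - v \<tau> k)) has_real_derivative Im D) (at s)"
        and im: "((\<lambda>\<tau>. Im (u \<tau> k - v \<tau> k)) has_real_derivative - Re D) (at s)"
        unfolding has_real_derivative_iff_has_vector_derivative
        by (auto dest: bounded_linear.has_vector_derivative[OF bounded_linear_Re]
          bounded_linear.has_vector_derivative[OF bounded_linear_Im])
      have "((\<lambda>\<tau>. (Re (u \<tau> k - v \<tau> k))\<^sup>2 + (Im (u \<tau> k - v \<tau> k))\<^sup>2) has_real_derivative
          (2 * Re (u s k - v s k) * Im D + 2 * Im (u s k - v s k) * (- Re D))) (at s)"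
        by (rule derivative_eq_intros re im refl)+ (simp add: algebra_simps)
      then show ?thesis unfolding D_def[symmetric] cmod_power2 by (simp add: algebra_simps)
    qed
    show "((\<lambda>\<tau>. \<Sum>k<n. (cmod (u \<tau> k - v \<tau> k))\<^sup>2) has_real_derivative
        2 * Im (\<Sum>k<n. cnj (p k) * (szego_nl (u s) k - szego_nl (v s) k))) (at s)"
    proof -
      have "((\<lambda>\<tau>. \<Sum>k<n. (cmod (u \<tau> k - v \<tau> k))\<^sup>2) has_real_derivative
          (\<Sum>k<n. 2 * Im (cnj (u s k - v s k) * (szego_nl (u s) k - szego_nl (v s) k)))) (at s)"
        by (rule DERIV_sum) (rule d)
      also have "(\<Sum>k<n. 2 * Im (cnj (u s k - v s k) * (szego_nl (u s) k - szego_nl (v s) k)))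
          = 2 * Im (\<Sum>k<n. cnj (p k) * (szego_nl (u s) k - szego_nl (v s) k))"
        unfolding Im_sum sum_distrib_left by (intro sum.cong) (auto simp: p_def)
      finally show ?thesis .
    qed
    have wsp: "ws one p = (\<Sum>k<n. (cmod (u s k - v s k))\<^sup>2)"
    proof -
      have "ws one p = (\<Sum>k<n. (cmod (p k))\<^sup>2)"
        unfolding ws_def by (subst suminf_finite[of "{..<n}"]) (auto simp: p_def)
      then show ?thesis by (simp add: p_def)
    qed
    have "\<bar>Im (\<Sum>k<n. cnj (p k) * (szego_nl (u s) k - szego_nl (v s) k))\<bar>
        \<le> (B'\<^sup>2 + B' * sqrt ((1 + ln (1 + real n)) * (4 * M))) * ws one p + K / sqrt (sqrt (1 + real n))"
      using energy_estimate[OF C solution_bounded(1)[OF u] M(1)[OF s] v(1) M(2) v1(1) B'(1), where n = n]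
      unfolding p_def K_def .
    then have "2 * \<bar>Im (\<Sum>k<n. cnj (p k) * (szego_nl (u s) k - szego_nl (v s) k))\<bar>
        \<le> 2 * ((B'\<^sup>2 + B' * sqrt ((1 + ln (1 + real n)) * (4 * M))) * ws one p + K / sqrt (sqrt (1 + real n)))"
      by (rule mult_left_mono) simp
    then show "\<bar>2 * Im (\<Sum>k<n. cnj (p k) * (szego_nl (u s) k - szego_nl (v s) k))\<bar>
        \<le> \<alpha> n * (\<Sum>k<n. (cmod (u s k - v s k))\<^sup>2) + \<beta> n"
      unfolding wsp[symmetric] \<alpha>_def \<beta>_def by (simp only: abs_mult abs_numeral distrib_left distrib_right mult.assoc)
  qed (use init K0 B'(2) M(3) in \<open>simp_all add: \<alpha>_def \<beta>_def\<close>)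
  have "(\<lambda>n. \<beta> n * \<bar>t\<bar> * exp (\<alpha> n * \<bar>t\<bar>)) \<longlonglongrightarrow> 0"
  proof -
    \<comment> \<open>The added 1 keeps c positive also at t = 0.\<close>
    define c where "c = 2 * B' * \<bar>t\<bar> + 1"
    define a where "a = 2 * B'\<^sup>2 * \<bar>t\<bar>"
    have c: "0 < c" using B'(2) by (simp add: c_def add_nonneg_pos)
    \<comment> \<open>The exponential of a multiple of sqrt (ln n) grows more slowly than every
      positive power of n, in particular than the fourth root.\<close>
    have lim: "(\<lambda>n :: nat. exp (c * sqrt ((1 + ln (1 + real n)) * (4 * M))) / sqrt (sqrt (1 + real n))) \<longlonglongrightarrow> 0"
      using c M(3) by real_asymp
    have bnd: "norm (\<beta> n * \<bar>t\<bar> * exp (\<alpha> n * \<bar>t\<bar>)) \<le> (2 * K * \<bar>t\<bar> * exp a) *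
        (exp (c * sqrt ((1 + ln (1 + real n)) * (4 * M))) / sqrt (sqrt (1 + real n)))" for n
    proof -
      define S where "S = sqrt ((1 + ln (1 + real n)) * (4 * M))"
      have "\<alpha> n * \<bar>t\<bar> = a + (2 * B' * \<bar>t\<bar>) * S" by (simp add: \<alpha>_def a_def S_def algebra_simps)
      also have "\<dots> \<le> a + c * S" using M(3) by (intro add_left_mono mult_right_mono) (auto simp: c_def S_def)
      finally have "exp (\<alpha> n * \<bar>t\<bar>) \<le> exp a * exp (c * S)" by (simp add: exp_add[symmetric])
      then have le: "\<beta> n * \<bar>t\<bar> * exp (\<alpha> n * \<bar>t\<bar>) \<le> \<beta> n * \<bar>t\<bar> * (exp a * exp (c * S))"
        using K0 by (intro mult_left_mono) (auto simp: \<beta>_def)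
      have nn: "0 \<le> \<beta> n * \<bar>t\<bar> * exp (\<alpha> n * \<bar>t\<bar>)" using K0 by (simp add: \<beta>_def)
      have "\<beta> n * \<bar>t\<bar> * (exp a * exp (c * S))
          = (2 * K * \<bar>t\<bar> * exp a) * (exp (c * S) / sqrt (sqrt (1 + real n)))" by (simp add: \<beta>_def)
      with le show ?thesis unfolding real_norm_def abs_of_nonneg[OF nn] S_def[symmetric] by (simp only:)
    qed
    show ?thesis
    proof (rule Lim_null_comparison)
      show "\<forall>\<^sub>F n in sequentially. norm (\<beta> n * \<bar>t\<bar> * exp (\<alpha> n * \<bar>t\<bar>)) \<le> (2 * K * \<bar>t\<bar> * exp a) *
        (exp (c * sqrt ((1 + ln (1 + real n)) * (4 * M))) / sqrt (sqrt (1 + real n)))"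
        using bnd by (intro always_eventually allI)
      show "(\<lambda>n. (2 * K * \<bar>t\<bar> * exp a) * (exp (c * sqrt ((1 + ln (1 + real n)) * (4 * M))) / sqrt (sqrt (1 + real n)))) \<longlonglongrightarrow> 0"
        by (rule tendsto_mult_right_zero[OF lim])
    qed
  qed
  moreover have "\<forall>\<^sub>F n in sequentially. (cmod (u t k - v t k))\<^sup>2 \<le> \<beta> n * \<bar>t\<bar> * exp (\<alpha> n * \<bar>t\<bar>)"
    using eventually_gt_at_top[of k]
  proof eventually_elim
    case (elim n)
    have "(cmod (u t k - v t k))\<^sup>2 \<le> (\<Sum>k<n. (cmod (u t k - v t k))\<^sup>2)"
      using elim by (intro member_le_sum) auto
    with est[of n] show ?case by (rule order_trans[rotated])
  qed
  ultimately have "(cmod (u t k - v t k))\<^sup>2 \<le> 0"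
    by (intro tendsto_lowerbound) auto
  then show "u t k = v t k" by simp
qed

lemma geo_l1:
  assumes "geo K q x" "0 \<le> q" "q < 1"
  shows "summable (\<lambda>k. cmod (x k))" "(\<Sum>k. cmod (x k)) \<le> K / (1 - q)"
proof -
  have s: "summable (\<lambda>k. K * q ^ k)" using assms by (intro summable_mult summable_geometric) auto
  have le: "cmod (x k) \<le> K * q ^ k" for k using assms(1) by (simp add: geo_def)
  show s': "summable (\<lambda>k. cmod (x k))" by (rule summable_comparison_test'[OF s]) (use le in simp)
  have "(\<Sum>k. cmod (x k)) \<le> (\<Sum>k. K * q ^ k)" by (rule suminf_le[OF le s' s])
  also have "\<dots> = K / (1 - q)" using assms suminf_geometric[of q] by (subst suminf_mult) auto
  finally show "(\<Sum>k. cmod (x k)) \<le> K / (1 - q)" .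
qed

theorem theorem2:
  fixes d :: nat and u0 :: seq and u :: "real \<Rightarrow> seq"
  assumes "d \<ge> 1"
    and "u0 \<in> V d"
    and "szego_solution u"
    and "u 0 = u0"
  shows "(\<exists>n::nat. n \<ge> 1 \<and> (\<exists>\<omega> :: nat \<Rightarrow> real. \<exists>\<Phi> :: (nat \<Rightarrow> real) \<Rightarrow> seq.
            torus_map n \<Phi> \<and> (\<forall>\<theta>. \<Phi> \<theta> \<in> V d) \<and> smooth_L2 n \<Phi> \<and>
            (\<forall>t. u t = \<Phi> (\<lambda>j. \<omega> j * t))))
       \<and> (\<forall>s::real. s > 1/2 \<longrightarrow> (\<exists>C::real. \<forall>t. hs_sq s (u t) \<le> ennreal C))"
proof -
  obtain W b H T e f g lam kap where
    S: "spectral_hankel_pair W lip ((d + 1) div 2) b T H e f g lam kap"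
    and rank: "has_dim (T ` W) (d div 2)" and J_u: "hankel_pair.J lip T e (hankel_pair.u H e) = u0"
    using V_spectral_hankel_pair[OF assms(2)] by blast
  interpret S: spectral_hankel_pair W lip "(d + 1) div 2" b T H e f g lam kap by (rule S)
  \<comment> \<open>The explicit solution; its uniform geometric decay gives both the H^(1/2) bound
    and the l1 bound that uniqueness demands of v.\<close>
  define v where "v t = S.\<Phi> (\<lambda>j. S.\<omega> j * t)" for t
  obtain K q where Kq: "0 \<le> q" "q < 1" "\<And>\<theta>. geo K q (S.\<Phi> \<theta>)"
    using S.\<Phi>_geo unfolding uniformly_geo_def by blast
  have geo_v: "geo K q (v t)" for t unfolding v_def by (rule Kq(3))
  obtain M0 where M0: "0 \<le> M0" "\<And>K u. geo K q u \<Longrightarrow> hs_sq (1/2) u \<le> ennreal (K\<^sup>2 * M0)"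
    using geo_hs_bound[OF Kq(1,2)] by blast
  \<comment> \<open>The added 1 makes the bound strict, as \<open>hs_half_less\<close>
    expects.\<close>
  have pos: "0 < K\<^sup>2 * M0 + 1" using M0(1) by (simp add: add_nonneg_pos)
  have "hs_sq (1/2) (v t) < ennreal (K\<^sup>2 * M0 + 1)" for t
    by (rule le_less_trans[OF M0(2)[OF geo_v]]) (use M0(1) in \<open>simp add: ennreal_less_iff\<close>)
  note v_half = hs_half_less[OF this pos]
  have uv: "u t = v t" for t
  proof (rule szego_weak_strong_uniqueness[OF assms(3) v_half])
    show "summable (\<lambda>k. cmod (v t k))" for t by (rule geo_l1(1)[OF geo_v Kq(1,2)])
    show "(\<Sum>k. cmod (v t k)) \<le> K / (1 - q)" for t by (rule geo_l1(2)[OF geo_v Kq(1,2)])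
    show "((\<lambda>\<tau>. v \<tau> k) has_vector_derivative - \<i> * szego_nl (v t) k) (at t)" for t k
      unfolding v_def by (rule S.\<Phi>_flow)
    show "u 0 = v 0" unfolding v_def S.\<Phi>_0 assms(4) by (rule J_u[symmetric])
  qed
  \<comment> \<open>One angle for each index of the two eigenbases of a space of dimension (d + 1)
    div 2.\<close>
  have "1 \<le> 2 * ((d + 1) div 2)" using assms(1) by linarith
  then have "\<exists>n::nat. n \<ge> 1 \<and> (\<exists>\<omega> :: nat \<Rightarrow> real. \<exists>\<Phi> :: (nat \<Rightarrow> real) \<Rightarrow> seq.
            torus_map n \<Phi> \<and> (\<forall>\<theta>. \<Phi> \<theta> \<in> V d) \<and> smooth_L2 n \<Phi> \<and> (\<forall>t. u t = \<Phi> (\<lambda>j. \<omega> j * t)))"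
    using S.\<Phi>_torus_map S.\<Phi>_in_V[OF refl rank] S.\<Phi>_smooth uv unfolding v_def by blast
  \<comment> \<open>The geometric bound is uniform in time, so the Sobolev bounds follow for all s
    at once.\<close>
  moreover have "\<exists>C::real. \<forall>t. hs_sq s (u t) \<le> ennreal C" for s
    using geo_hs_bound[OF Kq(1,2), of s] geo_v unfolding uv by blast
  ultimately show ?thesis by blast
qed

end
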